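(* For all integers $r$ and $k$ with $k\geq 2r+2\geq 8$, there exists $N_{r,k}$ such that for every $n\geq N_{r,k}$, if $\mathcal{H}$ is an $n$-vertex $2$-connected $r$-graph with no Berge cycle of length at least $k$, then $$e(\mathcal{H})\leq \binom{\lfloor (k-1)/2\rfloor}{r-1}\left(n-\lceil (k+1)/2\rceil\right)+\binom{\lceil (k+1)/2\rceil}{r}.$$
   Context: An $r$-graph is a hypergraph all of whose hyperedges are $r$-element subsets of the vertex set; $e(\mathcal{H})$ is its number of hyperedges. A Berge cycle of length $\ell$ is a sequence of $\ell$ distinct vertices $v_1,\dots,v_\ell$ and $\ell$ distinct hyperedges $e_1,\dots,e_\ell$ with $\{v_i,v_{i+1}\}\subseteq e_i$ for all $i$ (indices mod $\ell$). A hypergraph is connected if its vertex set cannot be partitioned into two nonempty parts with no hyperedge meeting both parts. A hypergraph $\mathcal{H}$ is $2$-connected if it is connected and has neither a cut vertex (a vertex $v$ such that $V(\mathcal{H})=\{v\}\cup V_1\cup V_2$ with $V_1,V_2$ nonempty and disjoint and every hyperedge contained in $\{v\}\cup V_1$ or in $\{v\}\cup V_2$) nor a cut hyperedge (a hyperedge $e$ such that $V(\mathcal{H})=V_1\cup V_2$ with $V_1,V_2$ nonempty and disjoint and every hyperedge $f\neq e$ contained in $V_1$ or in $V_2$). *)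

theory Defs
  imports Complex_Main
begin

text \<open>A hypergraph is given by its vertex set \<open>V\<close> and its set \<open>E\<close> of hyperedges (so there are no
  repeated hyperedges). Graphs are finite throughout.\<close>

definition r_graph :: "nat \<Rightarrow> 'a set \<Rightarrow> 'a set set \<Rightarrow> bool" where
  "r_graph r V E \<longleftrightarrow> finite V \<and> (\<forall>e\<in>E. e \<subseteq> V \<and> card e = r)"

text \<open>Vertices and hyperedges are indexed from \<open>0\<close>, so the successor of the last index
  \<open>length vs - 1\<close> is \<open>0\<close>.\<close>

definition berge_cycle :: "'a set \<Rightarrow> 'a set set \<Rightarrow> 'a list \<Rightarrow> 'a set list \<Rightarrow> bool" where
  "berge_cycle V E vs es \<longleftrightarrow>
     length es = length vs \<and> distinct vs \<and> distinct es \<and> set vs \<subseteq> V \<and> set es \<subseteq> E \<and>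
     (\<forall>i<length vs. {vs ! i, vs ! (Suc i mod length vs)} \<subseteq> es ! i)"

definition hconnected :: "'a set \<Rightarrow> 'a set set \<Rightarrow> bool" where
  "hconnected V E \<longleftrightarrow>
     \<not> (\<exists>V1 V2. V1 \<noteq> {} \<and> V2 \<noteq> {} \<and> V1 \<inter> V2 = {} \<and> V = V1 \<union> V2 \<and>
          \<not> (\<exists>e\<in>E. e \<inter> V1 \<noteq> {} \<and> e \<inter> V2 \<noteq> {}))"

text \<open>The three sets \<open>{v}\<close>, \<open>V1\<close>, \<open>V2\<close> partition \<open>V\<close>: if \<open>v \<in> V1\<close> were allowed, then
  \<open>V1 = {v}\<close> would make every vertex a cut vertex.\<close>

definition cut_vertex :: "'a set \<Rightarrow> 'a set set \<Rightarrow> 'a \<Rightarrow> bool" where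
  "cut_vertex V E v \<longleftrightarrow>
     (\<exists>V1 V2. V = {v} \<union> V1 \<union> V2 \<and> V1 \<noteq> {} \<and> V2 \<noteq> {} \<and> V1 \<inter> V2 = {} \<and> v \<notin> V1 \<and> v \<notin> V2 \<and>
        (\<forall>e\<in>E. e \<subseteq> {v} \<union> V1 \<or> e \<subseteq> {v} \<union> V2))"

definition cut_hyperedge :: "'a set \<Rightarrow> 'a set set \<Rightarrow> 'a set \<Rightarrow> bool" where
  "cut_hyperedge V E e \<longleftrightarrow>
     e \<in> E \<and>
     (\<exists>V1 V2. V = V1 \<union> V2 \<and> V1 \<noteq> {} \<and> V2 \<noteq> {} \<and> V1 \<inter> V2 = {} \<and>
        (\<forall>f\<in>E. f \<noteq> e \<longrightarrow> f \<subseteq> V1 \<or> f \<subseteq> V2))"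

definition two_connected :: "'a set \<Rightarrow> 'a set set \<Rightarrow> bool" where
  "two_connected V E \<longleftrightarrow>
     hconnected V E \<and> \<not> (\<exists>v. cut_vertex V E v) \<and> \<not> (\<exists>e. cut_hyperedge V E e)"

end

(* Let t = floor((k-1)/2) and d = C(t, r-1). Berge cycles are cycles of the bipartite incidence graph, with nodes
   Inl v for vertices and Inr e for hyperedges, and in a 2-connected hypergraph this graph stays connected after the
   deletion of any node.

   If Q is a connected set of nodes in which all core vertices have degree more than d, then between two of the
   neighbours ("ports") of Q there is a path through Q with at least t + 2 - M vertices, M being the number of ports.
   A long path would close to a long cycle, so all paths are bounded; hence a large set of vertices of minimum
   degree more than d has many components outside a bounded set with the same neighbourhood there, and the port paths
   through them close up to a cycle of length at least k. So such sets have bounded size.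

   If now the number of hyperedges is about dn or more, peeling off vertices of degree at most d shows that
   many vertices have the same link F of d sets of size r - 1. Without long cycles, F consists of all (r-1)-subsets of
   a t-set A. A path through a component outside A with v interior vertices then extends to a cycle of
   length at least 2t - 1 + v. For k = 2t + 1 this makes every component degenerate over A; for k = 2t + 2 a single
   component survives, and it exceeds the degenerate count by at most C(t, r-2). *)
theory Submission
  imports Defs
begin

section \<open>Reachability inside a set of nodes\<close>

text \<open>The size \<open>t + 2 - M\<close> is dictated by the way port paths are combined: a
  cycle through \<open>m\<close> common vertices that uses two special paths, and one further vertex
  between the other consecutive ones, has \<open>2 m - 2\<close> vertices besides those of the
  special paths. Two paths with \<open>t + 2 - m\<close> vertices therefore make
  \<open>2 t + 2 \<ge> k\<close>. The obstacle is that a component outside the common neighbourhood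
  need not be 2-connected by itself and may have hyperedges as ports. Hence the longest-path
  argument is run inside nested separations, along a path that always keeps a way out to another
  port. The degree of its last vertex is then compared with \<open>d\<close>: more than
  \<open>d\<close> hyperedges at one vertex do not fit into \<open>t + 1\<close> vertices. By
  Pascal's rule the claimed bound is \<open>d (n - t) + C(t, r)\<close> for
  \<open>k = 2 t + 1\<close>. For \<open>k = 2 t + 2\<close> there is the additional term
  \<open>C(t, r - 2)\<close>, the number of hyperedges that contain two given vertices outside
  \<open>A\<close> and \<open>r - 2\<close> vertices of \<open>A\<close>.\<close>

locale ugraph =
  fixes adj :: "'n \<Rightarrow> 'n \<Rightarrow> bool"
  assumes adj_sym: "adj x y \<Longrightarrow> adj y x"
begin

definition reach :: "'n set \<Rightarrow> 'n \<Rightarrow> 'n \<Rightarrow> bool" where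
  "reach U x y \<longleftrightarrow> x \<in> U \<and> (\<lambda>a b. adj a b \<and> b \<in> U)\<^sup>*\<^sup>* x y"

definition tch :: "'n set \<Rightarrow> 'n \<Rightarrow> 'n set \<Rightarrow> bool" where
  "tch U x T \<longleftrightarrow> (\<exists>b c. reach U x b \<and> c \<in> T \<and> adj b c)"

definition conn :: "'n set \<Rightarrow> bool" where
  "conn U \<longleftrightarrow> (\<forall>x\<in>U. \<forall>y\<in>U. reach U x y)"

definition nbr :: "'n set \<Rightarrow> 'n set" where
  "nbr U = {b. b \<notin> U \<and> (\<exists>a\<in>U. adj a b)}"

definition pth :: "'n list \<Rightarrow> bool" where
  "pth xs \<longleftrightarrow> xs \<noteq> [] \<and> distinct xs \<and> successively adj xs"

text \<open>Only the inner nodes are listed, so that paths through disjoint sets can be chained at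
  common ports.\<close>

definition opath :: "'n set \<Rightarrow> 'n \<Rightarrow> 'n \<Rightarrow> 'n list \<Rightarrow> bool" where
  "opath U p q xs \<longleftrightarrow> pth xs \<and> set xs \<subseteq> U \<and> adj p (hd xs) \<and> adj (last xs) q"

definition cyc :: "'n list \<Rightarrow> bool" where
  "cyc c \<longleftrightarrow> 3 \<le> length c \<and> distinct c \<and> successively adj c \<and> adj (last c) (hd c)"

lemma adj_commute: "adj x y \<longleftrightarrow> adj y x"
  using adj_sym by blast

lemma reach_refl: "x \<in> U \<Longrightarrow> reach U x x"
  by (simp add: reach_def)

lemma reach_step: "reach U x y \<Longrightarrow> adj y z \<Longrightarrow> z \<in> U \<Longrightarrow> reach U x z"
  unfolding reach_def by (auto intro: rtranclp.rtrancl_into_rtrancl)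

lemma reach_in: "reach U x y \<Longrightarrow> x \<in> U \<and> y \<in> U"
  unfolding reach_def by (metis (no_types, lifting) rtranclp.cases)

lemma reach_induct [consumes 1, case_names refl step]:
  assumes "reach U x y" "x \<in> U \<Longrightarrow> P x"
    "\<And>y z. reach U x y \<Longrightarrow> P y \<Longrightarrow> adj y z \<Longrightarrow> z \<in> U \<Longrightarrow> P z"
  shows "P y"
proof -
  have x: "x \<in> U" using assms(1) by (simp add: reach_def)
  have "(\<lambda>a b. adj a b \<and> b \<in> U)\<^sup>*\<^sup>* x y" using assms(1) by (simp add: reach_def)
  then have "reach U x y \<and> P y"
  proof induction
    case base
    then show ?case using x assms(2) reach_refl by blast
  next
    case (step y z)
    then show ?case using assms(3) reach_step by blast
  qed
  then show ?thesis by blast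
qed

lemma reach_trans: "reach U x y \<Longrightarrow> reach U y z \<Longrightarrow> reach U x z"
  unfolding reach_def by auto

lemma reach_sym: "reach U x y \<Longrightarrow> reach U y x"
proof (induction rule: reach_induct)
  case refl
  then show ?case by (rule reach_refl)
next
  case (step y z)
  have "reach U z y"
    using step reach_refl reach_step adj_sym reach_in by meson
  then show ?case using step reach_trans by blast
qed

lemma reach_mono: "reach U x y \<Longrightarrow> U \<subseteq> W \<Longrightarrow> reach W x y"
  by (induction rule: reach_induct) (auto intro: reach_refl reach_step)

lemma tch_mono: "tch U x T \<Longrightarrow> U \<subseteq> W \<Longrightarrow> tch W x T"
  unfolding tch_def using reach_mono by blast

lemma tch_reach: "reach U x y \<Longrightarrow> tch U y T \<Longrightarrow> tch U x T"
  unfolding tch_def using reach_trans by blast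

lemma tch_in: "tch U x T \<Longrightarrow> x \<in> U"
  unfolding tch_def using reach_in by blast

lemma reach_exit:
  assumes "reach U s c" "s \<in> B" "c \<notin> B"
  shows "\<exists>a\<in>B. \<exists>b\<in>U - B. adj a b \<and> reach U s a"
proof -
  have "c \<in> B \<or> (\<exists>a\<in>B. \<exists>b\<in>U - B. adj a b \<and> reach U s a)"
    using assms(1)
  proof (induction rule: reach_induct)
    case refl
    then show ?case using assms(2) by blast
  next
    case (step y z)
    then show ?case by blast
  qed
  then show ?thesis using assms(3) by blast
qed

lemma pth_rev: "pth xs \<Longrightarrow> pth (rev xs)"
  unfolding pth_def by (simp add: adj_commute)

lemma opath_rev: "opath U p q xs \<Longrightarrow> opath U q p (rev xs)"
  unfolding opath_def using pth_rev
  by (auto simp: hd_rev last_rev pth_def adj_commute)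

lemma opath_mono: "opath U p q xs \<Longrightarrow> U \<subseteq> W \<Longrightarrow> opath W p q xs"
  unfolding opath_def by blast

lemma pth_append:
  assumes "pth xs" "pth ys" "adj (last xs) (hd ys)" "set xs \<inter> set ys = {}"
  shows "pth (xs @ ys)"
  using assms unfolding pth_def by (auto simp: successively_append_iff)

lemma pth_appendD:
  assumes "pth (xs @ ys)"
  shows "xs \<noteq> [] \<Longrightarrow> pth xs" "ys \<noteq> [] \<Longrightarrow> pth ys"
    "xs \<noteq> [] \<Longrightarrow> ys \<noteq> [] \<Longrightarrow> adj (last xs) (hd ys)" "set xs \<inter> set ys = {}"
  using assms unfolding pth_def by (auto simp: successively_append_iff)

lemma reach_path:
  assumes "reach U x y"
  shows "\<exists>xs. pth xs \<and> hd xs = x \<and> last xs = y \<and> set xs \<subseteq> U"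
  using assms
proof (induction rule: reach_induct)
  case refl
  then show ?case by (intro exI[of _ "[x]"]) (auto simp: pth_def)
next
  case (step y z)
  then obtain xs where xs: "pth xs" "hd xs = x" "last xs = y" "set xs \<subseteq> U" by blast
  show ?case
  proof (cases "z \<in> set xs")
    case True
    then obtain ys zs where e: "xs = ys @ z # zs" by (meson split_list)
    have "pth (ys @ [z])" using xs(1) unfolding e pth_def
      by (auto simp: successively_append_iff)
    moreover have "hd (ys @ [z]) = x" using xs(2) unfolding e by (cases ys) auto
    ultimately show ?thesis using xs(4) unfolding e by (intro exI[of _ "ys @ [z]"]) auto
  next
    case False
    have "pth (xs @ [z])" using xs step.hyps False
      by (intro pth_append) (auto simp: pth_def)
    moreover have "hd (xs @ [z]) = x" using xs by (auto simp: pth_def)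
    ultimately show ?thesis using xs(4) step.hyps by (intro exI[of _ "xs @ [z]"]) auto
  qed
qed

lemma tch_path:
  assumes "tch U x T"
  shows "\<exists>xs c. pth xs \<and> hd xs = x \<and> set xs \<subseteq> U \<and> c \<in> T \<and> adj (last xs) c"
  using assms reach_path unfolding tch_def by (metis (no_types, lifting))

text \<open>At most the node \<open>w\<close> connects \<open>B\<close> with the rest of
  \<open>U\<close>, so an excursion of the walk into \<open>B\<close> starts and ends at
  \<open>w\<close> and can be cut out. The second conjunct is what the induction remembers during an
  excursion: \<open>w\<close> has already been reached outside \<open>B\<close>.\<close>

lemma reach_bypass:
  assumes "reach U z y" "z \<notin> B" "\<And>a b. a \<in> B \<Longrightarrow> adj a b \<Longrightarrow> b \<in> U \<Longrightarrow> b \<in> B \<union> W" "W \<subseteq> {w}"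
  shows "(y \<notin> B \<longrightarrow> reach (U - B) z y) \<and> (y \<in> B \<longrightarrow> reach (U - B) z w)"
  using assms(1)
proof (induction rule: reach_induct)
  case refl
  then show ?case using assms(2) by (auto intro: reach_refl)
next
  case (step y y')
  have yU: "y \<in> U" using step reach_in by blast
  consider "y \<notin> B" "y' \<notin> B" | "y \<notin> B" "y' \<in> B" | "y \<in> B" "y' \<notin> B" | "y \<in> B" "y' \<in> B" by blast
  then show ?case
  proof cases
    case 1
    then show ?thesis using step reach_step[of "U - B" z y y'] by blast
  next
    case 2
    then have "y = w" using assms(3)[of y' y] assms(4) step adj_sym yU by blast
    then show ?thesis using step 2 by blast
  next
    case 3
    then have "y' = w" using assms(3)[of y y'] assms(4) step by blast
    then show ?thesis using step 3 by blast
  next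
    case 4
    then show ?thesis using step by blast
  qed
qed

text \<open>Whenever the walk leaves \<open>B\<close> it stands at \<open>w\<close>; what follows
  until the next return is a walk from \<open>w\<close> outside \<open>B\<close>.\<close>

lemma reach_bypass2:
  assumes "reach U z y" "z \<in> B" "\<And>a b. a \<in> B \<Longrightarrow> adj a b \<Longrightarrow> b \<in> U \<Longrightarrow> b \<in> B \<union> W" "W \<subseteq> {w}"
  shows "y \<in> B \<or> reach (U - B) w y"
  using assms(1)
proof (induction rule: reach_induct)
  case refl
  then show ?case using assms(2) by blast
next
  case (step y y')
  show ?case
  proof (cases "y' \<in> B")
    case False
    note F = this
    show ?thesis
    proof (cases "y \<in> B")
      case True
      then have "y' = w" using assms(3)[of y y'] assms(4) step F by blast
      then show ?thesis using step F reach_refl[of w "U - B"] by blast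
    next
      case False
      then show ?thesis using step F reach_step[of "U - B" w y y'] by blast
    qed
  qed blast
qed

definition comp_of :: "'n set \<Rightarrow> 'n \<Rightarrow> 'n set" where
  "comp_of U x = {y. reach U x y}"

lemma comp_of_sub: "comp_of U x \<subseteq> U"
  unfolding comp_of_def using reach_in by blast

lemma comp_of_self: "x \<in> U \<Longrightarrow> x \<in> comp_of U x"
  unfolding comp_of_def by (simp add: reach_refl)

lemma comp_of_closed: "a \<in> comp_of U x \<Longrightarrow> adj a b \<Longrightarrow> b \<in> U \<Longrightarrow> b \<in> comp_of U x"
  unfolding comp_of_def using reach_step by blast

lemma reach_comp_of: "reach U x y \<Longrightarrow> reach (comp_of U x) x y"
proof (induction rule: reach_induct)
  case refl
  then show ?case using comp_of_self reach_refl by blast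
next
  case (step y z)
  then show ?case using reach_step comp_of_closed
    by (metis comp_of_def mem_Collect_eq)
qed

lemma conn_comp_of: "conn (comp_of U x)"
  unfolding conn_def using reach_comp_of reach_sym reach_trans
  by (metis comp_of_def mem_Collect_eq)

lemma comp_of_nbr: "nbr (comp_of U x) \<inter> U = {}"
  unfolding nbr_def using comp_of_closed by blast

lemma tch_nbr:
  assumes "x \<in> Q" "reach W x y" "y \<notin> Q"
  shows "tch (Q \<inter> W) x (nbr Q \<inter> W)"
proof -
  have x: "x \<in> W" using assms reach_in by blast
  let ?C = "comp_of (Q \<inter> W) x"
  have "x \<in> ?C" "y \<notin> ?C" using comp_of_self assms x comp_of_sub by blast+
  then obtain a b where ab: "a \<in> ?C" "b \<in> W - ?C" "adj a b" using reach_exit[OF assms(2)] by blast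
  then have "b \<notin> Q" using comp_of_closed by blast
  then have "b \<in> nbr Q \<inter> W" using ab comp_of_sub[of "Q \<inter> W" x] unfolding nbr_def by blast
  then show ?thesis using ab unfolding tch_def comp_of_def by blast
qed

section \<open>Nested separations\<close>

text \<open>The last conjunct is the remnant of 2-connectedness that is handed from region to
  region: no node separates a core vertex of \<open>R\<close> from the exit set
  \<open>T\<close>.\<close>

definition inv :: "'n set \<Rightarrow> 'n set \<Rightarrow> 'n \<Rightarrow> 'n set \<Rightarrow> bool" where
  "inv S R x T \<longleftrightarrow> finite R \<and> x \<in> R \<and> (\<forall>y\<in>R. reach R x y) \<and> R \<inter> T = {} \<and>
     (\<forall>w. \<forall>s\<in>S \<inter> R - {w}. tch (R - {w}) s T)"

text \<open>Among the connected sets in \<open>R - {x}\<close> that contain a core vertex and have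
  at most one further neighbour there, a smallest one is taken as \<open>B\<close>, much like an end
  block. Minimality restores the invariant in \<open>B\<close>, with the attaching node as the new
  exit if there is one. The walk can proceed from \<open>x\<close> into \<open>B\<close>:
  connectedness of \<open>R\<close>, or the old invariant with the attaching node deleted, forces a
  neighbour of \<open>x\<close> in \<open>B\<close>.\<close>

lemma inv_step:
  assumes inv: "inv S R x T" and ess: "S \<inter> R - {x} \<noteq> {}"
  obtains B u W where "u \<in> B" "adj x u" "B \<subseteq> R - {x}" "S \<inter> B \<noteq> {}" "W \<subseteq> R - {x} - B"
     "inv S B u (if W = {} then T else W)"
     "\<And>a b. a \<in> B \<Longrightarrow> b \<in> R - {x} \<Longrightarrow> adj a b \<Longrightarrow> b \<in> B \<union> W"
     "W = {} \<or> (\<exists>w. W = {w} \<and> tch (R - {x} - B) w T \<and> (\<forall>a\<in>B. \<forall>c\<in>T. \<not> adj a c))"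
     "\<And>z. z \<in> S \<inter> R - {x} - B \<Longrightarrow> tch (R - {x} - B) z T"
proof -
  define R' where "R' = R - {x}"
  have fR: "finite R" and xR: "x \<in> R" and cR: "\<And>y. y \<in> R \<Longrightarrow> reach R x y" and RT: "R \<inter> T = {}"
    and b: "\<And>w s. s \<in> S \<Longrightarrow> s \<in> R \<Longrightarrow> s \<noteq> w \<Longrightarrow> tch (R - {w}) s T"
    using inv unfolding inv_def by auto
  \<comment> \<open>A candidate that is attached by a node must not touch \<open>T\<close> itself;
    then every way from it to \<open>T\<close> inside \<open>R\<close> passes that node or
    \<open>x\<close>.\<close>
  define cand where "cand B W \<longleftrightarrow> B \<subseteq> R' - W \<and> W \<subseteq> R' \<and> (\<exists>w. W \<subseteq> {w}) \<and> conn B \<and> S \<inter> B \<noteq> {} \<and>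
     (\<forall>a\<in>B. \<forall>b\<in>R'. adj a b \<longrightarrow> b \<in> B \<union> W) \<and> (W \<noteq> {} \<longrightarrow> (\<forall>a\<in>B. \<forall>c\<in>T. \<not> adj a c))" for B W
  obtain s0 where s0: "s0 \<in> S" "s0 \<in> R'" using ess unfolding R'_def by blast
  have "cand (comp_of R' s0) {}" unfolding cand_def
    using comp_of_sub[of R' s0] comp_of_self[OF s0(2)] s0 conn_comp_of comp_of_closed[of _ R' s0] by blast
  then have "\<exists>B. \<exists>W. cand B W" by blast
  then obtain B where B: "\<exists>W. cand B W" and Bmin: "\<And>B' W. cand B' W \<Longrightarrow> card B \<le> card B'"
    using ex_has_least_nat[of "\<lambda>B. \<exists>W. cand B W" _ card] by blast
  then obtain W where W: "cand B W" by blast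
  have BR: "B \<subseteq> R'" "B \<inter> W = {}" "W \<subseteq> R'" and cB: "conn B" and SB: "S \<inter> B \<noteq> {}"
    and cl: "\<And>a b. a \<in> B \<Longrightarrow> adj a b \<Longrightarrow> b \<in> R' \<Longrightarrow> b \<in> B \<union> W"
    and nT: "\<And>a c. W \<noteq> {} \<Longrightarrow> a \<in> B \<Longrightarrow> c \<in> T \<Longrightarrow> \<not> adj a c"
    using W unfolding cand_def by blast+
  obtain w where w: "W \<subseteq> {w}" using W unfolding cand_def by blast
  have fB: "finite B" using BR fR unfolding R'_def by (meson finite_Diff finite_subset)
  obtain s where s: "s \<in> S" "s \<in> B" using SB by blast
  have sR: "s \<in> R" "s \<noteq> x" using s BR unfolding R'_def by auto
  have "\<exists>u\<in>B. adj x u"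
  proof (cases "W = {}")
    case True
    have "reach R s x" using cR[OF sR(1)] reach_sym by blast
    moreover have "x \<notin> B" using BR R'_def by blast
    ultimately obtain a c where ac: "a \<in> B" "c \<in> R - B" "adj a c" using reach_exit s by meson
    then have "c = x" using cl[of a c] True unfolding R'_def by blast
    then show ?thesis using ac adj_sym by blast
  next
    case False
    then have Ww: "W = {w}" using w by blast
    then have "s \<noteq> w" using s BR by blast
    then have "tch (R - {w}) s T" using b s sR by blast
    then obtain b' c where bc: "reach (R - {w}) s b'" "c \<in> T" "adj b' c" unfolding tch_def by blast
    have "b' \<notin> B" using nT bc False by blast
    then obtain a e where ae: "a \<in> B" "e \<in> R - {w} - B" "adj a e" using reach_exit[OF bc(1) s(2)] by blast
    then have "e = x" using cl[of a e] Ww unfolding R'_def by blast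
    then show ?thesis using ae adj_sym by blast
  qed
  then obtain u where u: "u \<in> B" "adj x u" by blast
  let ?T = "if W = {} then T else W"
  have Btouch: "\<exists>a\<in>B. \<exists>c\<in>?T. adj a c"
  proof -
    have "tch R' s T" using b[OF s(1) sR] unfolding R'_def .
    then obtain b' c where bc: "reach R' s b'" "c \<in> T" "adj b' c" unfolding tch_def by blast
    show ?thesis
    proof (cases "b' \<in> B")
      case True
      then show ?thesis using bc nT by (cases "W = {}") auto
    next
      case False
      then obtain a e where "a \<in> B" "e \<in> R' - B" "adj a e" using reach_exit[OF bc(1) s(2)] by blast
      then show ?thesis using cl[of a e] by (cases "W = {}") auto
    qed
  qed
  have "inv S B u ?T" unfolding inv_def
  proof (intro conjI allI ballI)
    show "finite B" "u \<in> B" by (fact fB, fact u(1))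
    show "reach B u y" if "y \<in> B" for y using that cB u unfolding conn_def by blast
    show "B \<inter> ?T = {}" using BR RT unfolding R'_def by auto
    fix w' s' assume s': "s' \<in> S \<inter> B - {w'}"
    show "tch (B - {w'}) s' ?T"
    proof (cases "w' \<in> B")
      case False
      then have "B - {w'} = B" by blast
      then show ?thesis using Btouch cB s' unfolding tch_def conn_def by (metis DiffE IntD2)
    next
      case True
      let ?C = "comp_of (B - {w'}) s'"
      show ?thesis
      proof (rule ccontr)
        assume n: "\<not> tch (B - {w'}) s' ?T"
        have nadj: "\<And>a c. a \<in> ?C \<Longrightarrow> c \<in> ?T \<Longrightarrow> \<not> adj a c" using n unfolding tch_def comp_of_def by blast
        have CB: "?C \<subseteq> B - {w'}" by (rule comp_of_sub)
        \<comment> \<open>If \<open>w'\<close> cut \<open>s'\<close> off from the exit, the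
          component of \<open>s'\<close> would be a candidate attached by \<open>w'\<close> alone,
          and it is smaller than \<open>B\<close>.\<close>
        have "cand ?C {w'}" unfolding cand_def
        proof (intro conjI ballI impI)
          show "?C \<subseteq> R' - {w'}" using CB BR by blast
          show "{w'} \<subseteq> R'" using True BR by blast
          show "\<exists>w. {w'} \<subseteq> {w}" by blast
          show "conn ?C" by (rule conn_comp_of)
          show "S \<inter> ?C \<noteq> {}" using s' comp_of_self[of s' "B - {w'}"] by blast
          show "e \<in> ?C \<union> {w'}" if "a \<in> ?C" "e \<in> R'" "adj a e" for a e
          proof -
            have "e \<in> B \<union> W" using cl[of a e] that CB by blast
            moreover have "e \<notin> W" using nadj[of a e] that by (cases "W = {}") auto
            ultimately show ?thesis using comp_of_closed[of a "B - {w'}" s' e] that by blast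
          qed
          show "\<not> adj a c" if "a \<in> ?C" "c \<in> T" for a c
          proof (cases "W = {}")
            case True
            then show ?thesis using nadj that by simp
          next
            case False
            then show ?thesis using nT that CB by blast
          qed
        qed
        then have "card B \<le> card ?C" by (rule Bmin)
        moreover have "card ?C < card B" using CB True fB by (intro psubset_card_mono) blast+
        ultimately show False by simp
      qed
    qed
  qed
  moreover have "tch (R' - B) z T" if z: "z \<in> S \<inter> R - {x} - B" for z
  proof -
    have "tch R' z T" using b[of z x] z unfolding R'_def by blast
    then obtain b' c where bc: "reach R' z b'" "c \<in> T" "adj b' c" unfolding tch_def by blast
    have zB: "z \<notin> B" using z by blast
    have "reach (R' - B) z b'"
    proof (cases "W = {}")
      case True
      have "b' \<notin> B"
      proof
        assume "b' \<in> B"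
        then have "reach R' b' z" "b' \<in> B" using bc reach_sym by blast+
        then obtain a e where "a \<in> B" "e \<in> R' - B" "adj a e" using reach_exit[of R' b' z B] zB by blast
        then show False using cl True by blast
      qed
      then show ?thesis using reach_bypass[OF bc(1) zB _ w] cl by blast
    next
      case False
      then have "b' \<notin> B" using nT bc by blast
      then show ?thesis using reach_bypass[OF bc(1) zB _ w] cl by blast
    qed
    then show ?thesis using bc unfolding tch_def by blast
  qed
  moreover have "W = {} \<or> (\<exists>w. W = {w} \<and> tch (R' - B) w T \<and> (\<forall>a\<in>B. \<forall>c\<in>T. \<not> adj a c))"
  proof (cases "W = {}")
    case False
    then have Ww: "W = {w}" using w by blast
    have "tch R' s T" using b[OF s(1) sR] unfolding R'_def .
    then obtain b' c where bc: "reach R' s b'" "c \<in> T" "adj b' c" unfolding tch_def by blast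
    have "b' \<notin> B" using nT False bc by blast
    then have "reach (R' - B) w b'" using reach_bypass2[OF bc(1) s(2) _ w] cl by blast
    then have "tch (R' - B) w T" using bc unfolding tch_def by blast
    then show ?thesis using Ww nT False by blast
  qed simp
  moreover have "W \<subseteq> R' - B" using BR by blast
  ultimately show thesis using that[of u B W] u BR(1) SB cl unfolding R'_def by blast
qed

text \<open>Besides the invariant of the current region, the state records that nothing left behind
  is lost: core vertices off the path and outside \<open>R\<close> still reach \<open>T0\<close>
  away from both, and so does the separating node if the exit is a single node. This allows the path
  to be completed and rotated at the end.\<close>

definition proc_state :: "'n set \<Rightarrow> 'n set \<Rightarrow> 'n \<Rightarrow> 'n set \<Rightarrow> 'n list \<Rightarrow> 'n set \<Rightarrow> 'n set \<Rightarrow> bool" where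
  "proc_state S R0 x0 T0 P R T \<longleftrightarrow> pth P \<and> hd P = x0 \<and> set P \<subseteq> R0 \<and> R \<subseteq> R0 \<and>
     R \<inter> set P = {last P} \<and> inv S R (last P) T \<and> S \<inter> R \<noteq> {} \<and>
     (\<forall>a\<in>R. \<forall>b\<in>R0 \<union> T0. adj a b \<longrightarrow> b \<in> R \<union> T \<union> set P) \<and>
     (\<forall>z\<in>S \<inter> R0 - set P - R. tch (R0 - set P - R) z T0) \<and>
     (T = T0 \<or> (\<exists>w\<in>R0 - R - set P. T = {w} \<and> tch (R0 - set P - R) w T0 \<and> (\<forall>a\<in>R. \<forall>c\<in>T0. \<not> adj a c)))"

text \<open>Each step appends a node to \<open>P\<close> and replaces \<open>R\<close> by a smaller
  region. A step is possible as long as \<open>R\<close> has a core vertex other than the end of the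
  path, so the process stops exactly when that end is the only core vertex left.\<close>

lemma proc_terminal:
  assumes "inv S R0 x0 T0" "S \<inter> R0 \<noteq> {}"
  shows "\<exists>P R T. proc_state S R0 x0 T0 P R T \<and> S \<inter> R = {last P}"
proof -
  have init: "proc_state S R0 x0 T0 [x0] R0 T0"
    using assms unfolding proc_state_def inv_def pth_def by auto
  have "\<exists>P R T. proc_state S R0 x0 T0 P R T \<and> S \<inter> R = {last P}" if "proc_state S R0 x0 T0 P R T" for P R T
    using that
  proof (induction "card R" arbitrary: P R T rule: less_induct)
    case less
    note st = less.prems
    show ?case
    proof (cases "S \<inter> R - {last P} = {}")
      case True
      then have "S \<inter> R = {last P}" using st unfolding proc_state_def by blast
      then show ?thesis using st by blast
    next
      case False
      define x where "x = last P"
      have inv: "inv S R x T" and P: "pth P" "hd P = x0" "set P \<subseteq> R0" "R \<subseteq> R0" "R \<inter> set P = {x}"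
        and cl0: "\<And>a b. a \<in> R \<Longrightarrow> b \<in> R0 \<union> T0 \<Longrightarrow> adj a b \<Longrightarrow> b \<in> R \<union> T \<union> set P"
        and z0: "\<And>z. z \<in> S \<inter> R0 - set P - R \<Longrightarrow> tch (R0 - set P - R) z T0"
        and T: "T = T0 \<or> (\<exists>w\<in>R0 - R - set P. T = {w} \<and> tch (R0 - set P - R) w T0 \<and> (\<forall>a\<in>R. \<forall>c\<in>T0. \<not> adj a c))"
        using st unfolding proc_state_def x_def by blast+
      have ess: "S \<inter> R - {x} \<noteq> {}" using False unfolding x_def .
      obtain B u W where B: "u \<in> B" "adj x u" "B \<subseteq> R - {x}" "S \<inter> B \<noteq> {}" "W \<subseteq> R - {x} - B"
        and iB: "inv S B u (if W = {} then T else W)"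
        and cl: "\<And>a b. a \<in> B \<Longrightarrow> b \<in> R - {x} \<Longrightarrow> adj a b \<Longrightarrow> b \<in> B \<union> W"
        and W: "W = {} \<or> (\<exists>w. W = {w} \<and> tch (R - {x} - B) w T \<and> (\<forall>a\<in>B. \<forall>c\<in>T. \<not> adj a c))"
        and zB: "\<And>z. z \<in> S \<inter> R - {x} - B \<Longrightarrow> tch (R - {x} - B) z T"
        by (rule inv_step[OF inv ess], rule that)
      let ?P = "P @ [u]" and ?T = "if W = {} then T else W"
      have uP: "u \<notin> set P" using B P by blast
      have Pn: "P \<noteq> []" using P(1) unfolding pth_def by blast
      have sub: "R - {x} - B \<subseteq> R0 - set ?P - B" using P B by auto
      have sub2: "R0 - set P - R \<subseteq> R0 - set ?P - B" using B by auto
      \<comment> \<open>If the old exit is a single node, a walk to it is prolonged by the recorded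
        walk from that node to \<open>T0\<close>.\<close>
      have lift: "tch (R0 - set ?P - B) z T0" if zt: "tch (R - {x} - B) z T" for z
      proof (cases "T = T0")
        case True
        then show ?thesis using zt sub tch_mono by blast
      next
        case False
        then obtain w where w: "T = {w}" "tch (R0 - set P - R) w T0" using T by blast
        obtain b' where b': "reach (R - {x} - B) z b'" "adj b' w" using zt w unfolding tch_def by blast
        have wt: "tch (R0 - set ?P - B) w T0" using w sub2 tch_mono by blast
        have "reach (R0 - set ?P - B) z w"
          using b' sub wt reach_mono reach_step tch_in by metis
        then show ?thesis using wt tch_reach by blast
      qed
      have "proc_state S R0 x0 T0 ?P B ?T" unfolding proc_state_def
      proof (intro conjI ballI impI)
        show "pth ?P" using P(1) B(2) uP unfolding x_def by (intro pth_append) (auto simp: pth_def)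
        show "hd ?P = x0" using P Pn by simp
        show "set ?P \<subseteq> R0" "B \<subseteq> R0" using P B by auto
        show "B \<inter> set ?P = {last ?P}" using B P by auto
        show "inv S B (last ?P) ?T" using iB by simp
        show "S \<inter> B \<noteq> {}" by fact
        show "b \<in> B \<union> ?T \<union> set ?P" if "a \<in> B" "b \<in> R0 \<union> T0" "adj a b" for a b
        proof -
          have "b \<in> R \<union> T \<union> set P" using cl0[of a b] that B by blast
          moreover have "b \<in> B \<union> W" if "b \<in> R - {x}" using cl[of a b] \<open>a \<in> B\<close> that \<open>adj a b\<close> by blast
          moreover have "x \<in> set P" using P by blast
          moreover have "b \<notin> T" if "W \<noteq> {}" using W that \<open>a \<in> B\<close> \<open>adj a b\<close> by blast
          ultimately show ?thesis by auto
        qed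
        show "tch (R0 - set ?P - B) z T0" if z: "z \<in> S \<inter> R0 - set ?P - B" for z
        proof (cases "z \<in> R")
          case True
          then have "z \<in> S \<inter> R - {x} - B" using z P by auto
          then show ?thesis using zB lift by blast
        next
          case False
          then have "tch (R0 - set P - R) z T0" using z0 z by auto
          then show ?thesis using sub2 tch_mono by blast
        qed
        show "?T = T0 \<or> (\<exists>w\<in>R0 - B - set ?P. ?T = {w} \<and> tch (R0 - set ?P - B) w T0 \<and> (\<forall>a\<in>B. \<forall>c\<in>T0. \<not> adj a c))"
        proof (cases "W = {}")
          case True
          show ?thesis
          proof (cases "T = T0")
            case True
            then show ?thesis using \<open>W = {}\<close> by simp
          next
            case False
            then obtain w where w: "w \<in> R0 - R - set P" "T = {w}" "tch (R0 - set P - R) w T0" "\<forall>a\<in>R. \<forall>c\<in>T0. \<not> adj a c"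
              using T by blast
            have "w \<in> R0 - B - set ?P" using w B by auto
            moreover have "tch (R0 - set ?P - B) w T0" using w sub2 tch_mono by blast
            moreover have "\<forall>a\<in>B. \<forall>c\<in>T0. \<not> adj a c" using w B by blast
            ultimately show ?thesis using w \<open>W = {}\<close> by auto
          qed
        next
          case False
          then obtain w where w: "W = {w}" "tch (R - {x} - B) w T" "\<forall>a\<in>B. \<forall>c\<in>T. \<not> adj a c" using W by blast
          have "w \<in> R0 - B - set ?P" using w B P by auto
          moreover have "tch (R0 - set ?P - B) w T0" using w lift by blast
          moreover have "\<forall>a\<in>B. \<forall>c\<in>T0. \<not> adj a c"
          proof (cases "T = T0")
            case True
            then show ?thesis using w by blast
          next
            case False
            then show ?thesis using T B by blast
          qed
          ultimately show ?thesis using w by auto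
        qed
      qed
      moreover have "card B < card R"
        using B inv unfolding inv_def by (intro psubset_card_mono) blast+
      ultimately show ?thesis using less.hyps by blast
    qed
  qed
  then show ?thesis using init by blast
qed

text \<open>The outcome of walking from the port \<open>p\<close> along \<open>P\<close> and shrinking the unexplored part \<open>R\<close> until its only
  core vertex is the last one of \<open>P\<close>. From \<open>R\<close> one exits into \<open>T\<close>, which is either the set of the remaining ports or a single
  separating node \<open>w\<close>, from which the ports are still reachable outside \<open>P\<close> and \<open>R\<close>.\<close>

definition term_cfg :: "'n set \<Rightarrow> 'n \<Rightarrow> 'n set \<Rightarrow> 'n list \<Rightarrow> 'n set \<Rightarrow> 'n set \<Rightarrow> bool" where
  "term_cfg Q p S P R T \<longleftrightarrow> p \<in> nbr Q \<and> pth P \<and> hd P = p \<and> set P \<subseteq> insert p Q \<and> R \<subseteq> Q \<and>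
     R \<inter> set P = {last P} \<and> S \<inter> R = {last P} \<and>
     (\<forall>a\<in>R. \<forall>b. adj a b \<longrightarrow> b \<in> R \<union> T \<union> set P) \<and>
     (\<forall>z\<in>S \<inter> Q - set P - R. tch (Q - set P - R) z (nbr Q - {p})) \<and> tch R (last P) T \<and>
     (T = nbr Q - {p} \<or> (\<exists>w\<in>Q - R - set P. T = {w} \<and> tch (Q - set P - R) w (nbr Q - {p})))"

lemma proc_stateD:
  assumes "proc_state S R0 x0 T0 P R T"
  shows "pth P" "hd P = x0" "set P \<subseteq> R0" "R \<subseteq> R0" "R \<inter> set P = {last P}" "inv S R (last P) T"
    "\<And>a b. a \<in> R \<Longrightarrow> b \<in> R0 \<union> T0 \<Longrightarrow> adj a b \<Longrightarrow> b \<in> R \<union> T \<union> set P"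
    "\<And>z. z \<in> S \<inter> R0 - set P - R \<Longrightarrow> tch (R0 - set P - R) z T0"
    "T = T0 \<or> (\<exists>w\<in>R0 - R - set P. T = {w} \<and> tch (R0 - set P - R) w T0 \<and> (\<forall>a\<in>R. \<forall>c\<in>T0. \<not> adj a c))"
  using assms unfolding proc_state_def by (simp_all only: simp_thms)

text \<open>Hypothesis \<open>b\<close> says that no node cuts a core vertex off from the ports
  other than \<open>p\<close>. Then \<open>Q\<close> together with \<open>p\<close> satisfies the
  invariant, and the process can start at \<open>p\<close> with all other ports as exits.\<close>

lemma term_noninitial:
  assumes fin: "finite Q" and cQ: "conn Q" and p: "p \<in> nbr Q" and S: "S \<subseteq> Q" "S \<noteq> {}"
    and b: "\<And>w s. s \<in> S \<Longrightarrow> s \<noteq> w \<Longrightarrow> tch (Q - {w}) s (nbr Q - {p})"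
  shows "\<exists>P R T. term_cfg Q p S P R T"
proof -
  obtain a where a: "a \<in> Q" "adj a p" and pQ: "p \<notin> Q" using p unfolding nbr_def by blast
  have "inv S (insert p Q) p (nbr Q - {p})" unfolding inv_def
  proof (intro conjI ballI allI)
    show "finite (insert p Q)" using fin by simp
    show "p \<in> insert p Q" by simp
    show "reach (insert p Q) p y" if "y \<in> insert p Q" for y
    proof (cases "y = p")
      case True
      then show ?thesis by (simp add: reach_refl)
    next
      case False
      then have "reach Q a y" using that cQ a unfolding conn_def by blast
      then have "reach (insert p Q) a y" using reach_mono by blast
      moreover have "reach (insert p Q) p a"
        using reach_step[OF reach_refl[of p "insert p Q"]] a adj_sym by blast
      ultimately show ?thesis using reach_trans by blast
    qed
    show "insert p Q \<inter> (nbr Q - {p}) = {}" unfolding nbr_def by blast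
    show "tch (insert p Q - {w}) s (nbr Q - {p})" if "s \<in> S \<inter> insert p Q - {w}" for w s
      using b[of s w] that tch_mono[of "Q - {w}" s _ "insert p Q - {w}"] by blast
  qed
  moreover have "S \<inter> insert p Q \<noteq> {}" using S by blast
  ultimately obtain P R T where st: "proc_state S (insert p Q) p (nbr Q - {p}) P R T" and SR: "S \<inter> R = {last P}"
    using proc_terminal by blast
  note P = proc_stateD(1-5)[OF st] and iv = proc_stateD(6)[OF st] and cl = proc_stateD(7)[OF st]
    and z = proc_stateD(8)[OF st] and T = proc_stateD(9)[OF st]
  have pP: "p \<in> set P" using P(1,2) unfolding pth_def by (metis hd_in_set)
  have lS: "last P \<in> S" "last P \<in> R" using SR by blast+
  have pR: "p \<notin> R"
  proof
    assume "p \<in> R"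
    then have "p \<in> R \<inter> set P" using pP by simp
    then have "p = last P" unfolding P(5) by simp
    then show False using lS S pQ by blast
  qed
  have eq: "insert p Q - set P - R = Q - set P - R" and eq2: "insert p Q - R - set P = Q - R - set P"
    using pP by auto
  have "tch (R - {p}) (last P) T" using iv lS pR unfolding inv_def by blast
  then have tR: "tch R (last P) T" using pR by simp
  have RQ: "R \<subseteq> Q" using P(4) pR by blast
  have "term_cfg Q p S P R T" unfolding term_cfg_def
  proof (intro conjI ballI allI impI)
    show "e \<in> R \<union> T \<union> set P" if "c \<in> R" "adj c e" for c e
    proof (rule cl[OF that(1) _ that(2)])
      show "e \<in> insert p Q \<union> (nbr Q - {p})" using that RQ unfolding nbr_def by blast
    qed
    show "tch (Q - set P - R) y (nbr Q - {p})" if "y \<in> S \<inter> Q - set P - R" for y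
      using z[of y] that eq by auto
    show "T = nbr Q - {p} \<or> (\<exists>w\<in>Q - R - set P. T = {w} \<and> tch (Q - set P - R) w (nbr Q - {p}))"
      using T unfolding eq eq2 by blast
  qed (use P p SR tR RQ in auto)
  then show ?thesis by blast
qed

text \<open>In the remaining case a node \<open>w0\<close> and a port \<open>p0\<close> together
  separate a core vertex from the other ports. A smallest connected set \<open>B\<close> with all
  neighbours in some such pair \<open>{w, p}\<close> is chosen, and the process runs from
  \<open>p\<close> inside \<open>B\<close> with exit \<open>w\<close>. As \<open>B\<close> touches
  no port besides \<open>p\<close>, the path does not touch the other ports either; this extra
  conclusion excludes the weak outcome of \<open>beta_edge\<close> later on.\<close>

lemma term_initial:
  assumes fin: "finite Q" and cQ: "conn Q" and S: "S \<subseteq> Q"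
    and two: "\<And>p. p \<in> nbr Q \<Longrightarrow> \<exists>q\<in>nbr Q. q \<noteq> p"
    and H2: "\<And>w s. s \<in> S \<Longrightarrow> s \<noteq> w \<Longrightarrow> tch (Q - {w}) s (nbr Q)"
    and ini: "p0 \<in> nbr Q" "s0 \<in> S" "s0 \<noteq> w0" "\<not> tch (Q - {w0}) s0 (nbr Q - {p0})"
  shows "\<exists>p P R w. w \<in> Q \<and> term_cfg Q p S P R {w} \<and> (\<forall>a\<in>set P - {p}. \<forall>y\<in>nbr Q - {p}. \<not> adj a y)"
proof -
  define cand where "cand p w B \<longleftrightarrow> p \<in> nbr Q \<and> w \<in> Q \<and> B \<subseteq> Q - {w} \<and> conn B \<and> S \<inter> B \<noteq> {} \<and> nbr B \<subseteq> {w, p}" for p w B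
  have w0: "w0 \<in> Q"
  proof (rule ccontr)
    assume n: "w0 \<notin> Q"
    obtain q where q: "q \<in> nbr Q" "q \<noteq> p0" using two ini by blast
    then obtain a where a: "a \<in> Q" "adj a q" unfolding nbr_def by blast
    have "reach Q s0 a" using cQ a S ini unfolding conn_def by blast
    then have "tch Q s0 (nbr Q - {p0})" using a q unfolding tch_def by blast
    moreover have "Q - {w0} = Q" using n by blast
    ultimately show False using ini by simp
  qed
  have "cand p0 w0 (comp_of (Q - {w0}) s0)" unfolding cand_def
  proof (intro conjI)
    show "S \<inter> comp_of (Q - {w0}) s0 \<noteq> {}" using comp_of_self[of s0 "Q - {w0}"] ini S by blast
    show "nbr (comp_of (Q - {w0}) s0) \<subseteq> {w0, p0}"
    proof
      fix b assume "b \<in> nbr (comp_of (Q - {w0}) s0)"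
      then obtain a where a: "a \<in> comp_of (Q - {w0}) s0" "adj a b" "b \<notin> comp_of (Q - {w0}) s0"
        unfolding nbr_def by blast
      have aQ: "a \<in> Q" using a comp_of_sub by blast
      show "b \<in> {w0, p0}"
      proof (cases "b \<in> Q")
        case True
        then show ?thesis using a comp_of_closed by blast
      next
        case False
        then have "b \<in> nbr Q" using a aQ unfolding nbr_def by blast
        then show ?thesis using ini a unfolding tch_def comp_of_def by blast
      qed
    qed
  qed (use ini w0 comp_of_sub conn_comp_of in auto)
  then have "\<exists>B. \<exists>p w. cand p w B" by blast
  then obtain B where B: "\<exists>p w. cand p w B" and Bmin: "\<And>B' p w. cand p w B' \<Longrightarrow> card B \<le> card B'"
    using ex_has_least_nat[of "\<lambda>B. \<exists>p w. cand p w B" _ card] by blast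
  then obtain p w where c: "cand p w B" by blast
  have p: "p \<in> nbr Q" and w: "w \<in> Q" and BQ: "B \<subseteq> Q - {w}" and cB: "conn B" and SB: "S \<inter> B \<noteq> {}"
    and nB: "nbr B \<subseteq> {w, p}" using c unfolding cand_def by blast+
  have pQ: "p \<notin> Q" using p unfolding nbr_def by blast
  have fB: "finite B" using fin BQ by (meson finite_Diff finite_subset)
  obtain s where s: "s \<in> S" "s \<in> B" using SB by blast
  obtain aw where aw: "aw \<in> B" "adj aw w"
  proof -
    have "reach Q s w" using cQ s S w unfolding conn_def by blast
    moreover have "w \<notin> B" using BQ by blast
    ultimately obtain a b where ab: "a \<in> B" "b \<in> Q - B" "adj a b" using reach_exit s by meson
    then have "b \<in> nbr B" unfolding nbr_def by blast
    then have "b = w" using nB ab pQ by blast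
    then show ?thesis using that ab by blast
  qed
  obtain ap where ap: "ap \<in> B" "adj ap p"
  proof -
    have "tch (Q - {w}) s (nbr Q)" using H2 s BQ by blast
    then obtain b c where bc: "reach (Q - {w}) s b" "c \<in> nbr Q" "adj b c" unfolding tch_def by blast
    have "b \<in> B"
    proof (rule ccontr)
      assume "b \<notin> B"
      then obtain a e where ae: "a \<in> B" "e \<in> Q - {w} - B" "adj a e" using reach_exit[OF bc(1) s(2)] by blast
      then have "e \<in> nbr B" unfolding nbr_def by blast
      then show False using nB ae pQ by blast
    qed
    moreover have "c \<notin> Q" using bc unfolding nbr_def by blast
    ultimately have "c \<in> nbr B" "c \<noteq> w" using bc BQ w unfolding nbr_def by blast+
    then have "c = p" using nB by blast
    then show ?thesis using that bc \<open>b \<in> B\<close> by blast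
  qed
  have SB': "S \<inter> B \<subseteq> B" by blast
  \<comment> \<open>The exit set is now the node \<open>w\<close>. A node \<open>w'\<close>
    violating the invariant would, together with \<open>p\<close>, cut off a smaller
    candidate.\<close>
  have iv: "inv (S \<inter> B) (insert p B) p {w}" unfolding inv_def
  proof (intro conjI ballI allI)
    show "finite (insert p B)" using fB by simp
    show "p \<in> insert p B" by simp
    show "reach (insert p B) p y" if "y \<in> insert p B" for y
    proof (cases "y = p")
      case True
      then show ?thesis by (simp add: reach_refl)
    next
      case False
      then have "reach B ap y" using that cB ap unfolding conn_def by blast
      then have "reach (insert p B) ap y" using reach_mono by blast
      moreover have "reach (insert p B) p ap"
        using reach_step[OF reach_refl[of p "insert p B"]] ap adj_sym by blast
      ultimately show ?thesis using reach_trans by blast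
    qed
    show "insert p B \<inter> {w} = {}" using BQ pQ w by blast
    fix w' s' assume s': "s' \<in> S \<inter> B \<inter> insert p B - {w'}"
    show "tch (insert p B - {w'}) s' {w}"
    proof (cases "w' \<in> B")
      case False
      have "tch B s' {w}" using cB aw s' unfolding tch_def conn_def by blast
      then show ?thesis using False tch_mono[of B s' "{w}" "insert p B - {w'}"] by blast
    next
      case True
      let ?C = "comp_of (B - {w'}) s'"
      show ?thesis
      proof (rule ccontr)
        assume n: "\<not> tch (insert p B - {w'}) s' {w}"
        have n2: "\<not> adj a w" if "a \<in> ?C" for a
        proof
          assume "adj a w"
          then have "tch (B - {w'}) s' {w}" using that unfolding tch_def comp_of_def by blast
          then show False using n tch_mono[of "B - {w'}" s' "{w}" "insert p B - {w'}"] by blast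
        qed
        have CB: "?C \<subseteq> B - {w'}" by (rule comp_of_sub)
        have "cand p w' ?C" unfolding cand_def
        proof (intro conjI)
          show "S \<inter> ?C \<noteq> {}" using comp_of_self[of s' "B - {w'}"] s' by blast
          show "nbr ?C \<subseteq> {w', p}"
          proof
            fix b assume "b \<in> nbr ?C"
            then obtain a where a: "a \<in> ?C" "adj a b" "b \<notin> ?C" unfolding nbr_def by blast
            show "b \<in> {w', p}"
            proof (cases "b \<in> B")
              case True
              then show ?thesis using a comp_of_closed[of a "B - {w'}" s' b] by blast
            next
              case False
              then have "b \<in> nbr B" using a CB unfolding nbr_def by blast
              then show ?thesis using nB n2 a by blast
            qed
          qed
        qed (use p True BQ CB conn_comp_of in auto)
        then have "card B \<le> card ?C" by (rule Bmin)
        moreover have "card ?C < card B" using CB True fB by (intro psubset_card_mono) blast+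
        ultimately show False by simp
      qed
    qed
  qed
  moreover have "S \<inter> B \<inter> insert p B \<noteq> {}" using SB by blast
  ultimately obtain P R T where st: "proc_state (S \<inter> B) (insert p B) p {w} P R T" and SR: "S \<inter> B \<inter> R = {last P}"
    using proc_terminal by blast
  note P = proc_stateD(1-5)[OF st] and iv' = proc_stateD(6)[OF st] and cl = proc_stateD(7)[OF st]
    and z = proc_stateD(8)[OF st] and T = proc_stateD(9)[OF st]
  have pP: "p \<in> set P" using P(1,2) unfolding pth_def by (metis hd_in_set)
  have lS: "last P \<in> S" "last P \<in> R" "last P \<in> B" using SR by blast+
  have pR: "p \<notin> R"
  proof
    assume "p \<in> R"
    then have "p \<in> R \<inter> set P" using pP by simp
    then have "p = last P" unfolding P(5) by simp
    then show False using lS S pQ by blast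
  qed
  have RB: "R \<subseteq> B" using P pR by blast
  have "tch (R - {p}) (last P) T" using iv' lS pR unfolding inv_def by blast
  then have tR: "tch R (last P) T" using pR by simp
  have sub1: "insert p B - set P - R \<subseteq> Q - set P - R" using pP BQ by blast
  have wB: "w \<notin> B" using BQ by blast
  have clB: "\<And>a b. a \<in> B \<Longrightarrow> adj a b \<Longrightarrow> b \<in> Q \<Longrightarrow> b \<in> B \<union> {w}"
    using nB pQ unfolding nbr_def by blast
  have QB: "Q - B \<subseteq> Q - set P - R" using P(3) RB pQ by blast
  have wt: "tch (Q - B) w (nbr Q - {p})"
  proof -
    obtain q where q: "q \<in> nbr Q" "q \<noteq> p" using two p by blast
    then obtain a where a: "a \<in> Q" "adj a q" "q \<notin> Q" unfolding nbr_def by blast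
    have "a \<notin> B"
    proof
      assume "a \<in> B"
      then have "q \<in> nbr B" using a BQ unfolding nbr_def by blast
      then show False using nB q a w by blast
    qed
    moreover have "reach Q a w" using cQ a w unfolding conn_def by blast
    ultimately have "reach (Q - B) a w" using reach_bypass[of Q a w B "{w}" w] clB wB by blast
    then show ?thesis using reach_sym a q unfolding tch_def by blast
  qed
  then have wt2: "tch (Q - set P - R) w (nbr Q - {p})" using QB tch_mono by blast
  have wQ: "w \<in> Q - set P - R" using wB w QB by blast
  have chain: "tch (Q - set P - R) y (nbr Q - {p})" if y: "tch (insert p B - set P - R) y {w}" for y
  proof -
    obtain b where "reach (insert p B - set P - R) y b" "adj b w" using y unfolding tch_def by blast
    then have "reach (Q - set P - R) y w" using sub1 reach_mono reach_step wQ by metis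
    then show ?thesis using wt2 tch_reach by blast
  qed
  \<comment> \<open>The final exit is \<open>w\<close> or a separator met during the process, a
    single node in either case.\<close>
  obtain w' where w': "T = {w'}" "w' \<in> Q - R - set P" "tch (Q - set P - R) w' (nbr Q - {p})"
  proof (cases "T = {w}")
    case True
    then show ?thesis using that wQ wt2 by blast
  next
    case False
    then obtain w' where "w' \<in> insert p B - R - set P" "T = {w'}" "tch (insert p B - set P - R) w' {w}" using T by blast
    then show ?thesis using that[of w'] chain sub1 by blast
  qed
  have "term_cfg Q p S P R T" unfolding term_cfg_def
  proof (intro conjI ballI allI impI)
    show "set P \<subseteq> insert p Q" "R \<subseteq> Q" using P RB BQ by blast+
    show "S \<inter> R = {last P}" using SR RB by blast
    show "e \<in> R \<union> T \<union> set P" if "c \<in> R" "adj c e" for c e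
    proof (rule cl[OF that(1) _ that(2)])
      show "e \<in> insert p B \<union> {w}" using that RB nB unfolding nbr_def by blast
    qed
    show "tch (Q - set P - R) y (nbr Q - {p})" if y: "y \<in> S \<inter> Q - set P - R" for y
    proof (cases "y \<in> B")
      case True
      then show ?thesis using z[of y] y chain by blast
    next
      case False
      have "reach Q y w" using cQ y w unfolding conn_def by blast
      then have "reach (Q - B) y w" using reach_bypass[of Q y w B "{w}" w] clB wB False by blast
      then have "tch (Q - B) y (nbr Q - {p})" using wt tch_reach by blast
      then show ?thesis using QB tch_mono by blast
    qed
    show "T = nbr Q - {p} \<or> (\<exists>w\<in>Q - R - set P. T = {w} \<and> tch (Q - set P - R) w (nbr Q - {p}))"
      using w' by blast
  qed (use P p tR in auto)
  moreover have "\<not> adj a y" if "a \<in> set P - {p}" "y \<in> nbr Q - {p}" for a y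
  proof
    assume "adj a y"
    moreover have "a \<in> B" using that P by blast
    moreover have "y \<notin> Q" using that unfolding nbr_def by blast
    ultimately have "y \<in> nbr B" "y \<noteq> w" using BQ w unfolding nbr_def by blast+
    then show False using nB that by blast
  qed
  ultimately show ?thesis using w' by blast
qed

section \<open>Port paths obtained from a terminal configuration\<close>

lemma opathI:
  assumes "pth (p # xs)" "xs \<noteq> []" "set xs \<subseteq> Q" "adj (last xs) q"
  shows "opath Q p q xs"
  using assms unfolding opath_def pth_def by (cases xs) auto

lemma cfgD:
  assumes "term_cfg Q p S P R T"
  shows "p \<in> nbr Q" "pth P" "hd P = p" "set P \<subseteq> insert p Q" "R \<subseteq> Q"
    "R \<inter> set P = {last P}" "S \<inter> R = {last P}" "tch R (last P) T"
    "\<And>a b. a \<in> R \<Longrightarrow> adj a b \<Longrightarrow> b \<in> R \<union> T \<union> set P"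
    "\<And>z. z \<in> S \<inter> Q - set P - R \<Longrightarrow> tch (Q - set P - R) z (nbr Q - {p})"
    "T = nbr Q - {p} \<or> (\<exists>w\<in>Q - R - set P. T = {w} \<and> tch (Q - set P - R) w (nbr Q - {p}))"
  using assms unfolding term_cfg_def by (simp_all only: simp_thms)

lemma cfg_split:
  assumes "term_cfg Q p S P R T" "S \<subseteq> Q"
  shows "\<exists>P'. P = p # P' \<and> P' \<noteq> [] \<and> set P' \<subseteq> Q \<and> p \<notin> Q"
proof -
  have P: "pth P" "hd P = p" "set P \<subseteq> insert p Q" "p \<in> nbr Q" "last P \<in> S"
    using cfgD(1,2,3,4,7)[OF assms(1)] by blast+
  then have pQ: "p \<notin> Q" unfolding nbr_def by blast
  obtain P' where P': "P = p # P'" using P unfolding pth_def by (cases P) auto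
  have "P' \<noteq> []" using P' P pQ assms by auto
  moreover have "set P' \<subseteq> Q" using P' P unfolding pth_def by auto
  ultimately show ?thesis using P' pQ by blast
qed

text \<open>The path follows \<open>P\<close>, crosses \<open>R\<close> to an exit and, if the exit
  is a separating node, continues from there to a port outside \<open>P\<close> and
  \<open>R\<close>. The three stretches lie in disjoint regions.\<close>

lemma cfg_plain:
  assumes cfg: "term_cfg Q p S P R T" and S: "S \<subseteq> Q"
  shows "\<exists>q\<in>nbr Q - {p}. \<exists>xs. opath Q p q xs \<and> set P - {p} \<subseteq> set xs \<and> (T \<noteq> nbr Q - {p} \<longrightarrow> T \<subseteq> set xs)"
proof -
  obtain P' where P': "P = p # P'" "P' \<noteq> []" "set P' \<subseteq> Q" "p \<notin> Q" using cfg_split[OF cfg S] by blast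
  note P = cfgD(2,5,6,8)[OF cfg]
  note T = cfgD(11)[OF cfg]
  obtain ys c where ys: "pth ys" "hd ys = last P" "set ys \<subseteq> R" "c \<in> T" "adj (last ys) c"
    using tch_path[OF P(4)] by blast
  obtain ys' where ys': "ys = last P # ys'" using ys unfolding pth_def by (cases ys) auto
  have PP: "pth (P @ ys')"
  proof (cases "ys' = []")
    case False
    have "last P \<notin> set ys'" using ys(1) unfolding ys' pth_def by simp
    moreover have "set ys' \<inter> set P \<subseteq> R \<inter> set P" using ys(3) unfolding ys' by auto
    ultimately have "set P \<inter> set ys' = {}" unfolding P(3) by auto
    moreover have "pth ys'" "adj (last P) (hd ys')" using ys(1) False unfolding ys' pth_def by (auto simp: successively_Cons)
    ultimately show ?thesis using P(1) pth_append by blast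
  qed (use P in simp)
  have lst: "adj (last (P @ ys')) c" using ys(5) unfolding ys' by (cases "ys' = []") auto
  have ysQ: "set ys' \<subseteq> R" using ys ys' by auto
  show ?thesis
  proof (cases "T = nbr Q - {p}")
    case True
    have "opath Q p c (P' @ ys')"
    proof (rule opathI)
      show "pth (p # P' @ ys')" using PP P' by simp
      show "adj (last (P' @ ys')) c" using lst P' by (cases ys') auto
    qed (use P' ysQ P in auto)
    then show ?thesis using True ys(4) P' by (intro bexI[of _ c] exI[of _ "P' @ ys'"]) auto
  next
    case False
    then obtain w where w: "w \<in> Q - R - set P" "T = {w}" "tch (Q - set P - R) w (nbr Q - {p})" using T by blast
    obtain zs q where zs: "pth zs" "hd zs = w" "set zs \<subseteq> Q - set P - R" "q \<in> nbr Q - {p}" "adj (last zs) q"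
      using tch_path[OF w(3)] by blast
    have zn: "zs \<noteq> []" using zs unfolding pth_def by blast
    have "pth ((P @ ys') @ zs)"
    proof (rule pth_append[OF PP zs(1)])
      show "adj (last (P @ ys')) (hd zs)" using lst w ys(4) zs(2) by simp
      show "set (P @ ys') \<inter> set zs = {}" using zs(3) ysQ by auto
    qed
    then have "opath Q p q (P' @ ys' @ zs)" using P' ysQ zs zn P
      by (intro opathI) auto
    moreover have "w \<in> set zs" using zs zn hd_in_set by metis
    ultimately show ?thesis using zs(4) P' w by (intro bexI[of _ q] exI[of _ "P' @ ys' @ zs"]) auto
  qed
qed

text \<open>The rotation: if \<open>g\<close> also contains the end of the path, then the tail after \<open>g\<close> can be reversed,
  which frees the end of \<open>g\<close> for an exit to \<open>z\<close>.\<close>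

lemma cfg_rotate:
  assumes cfg: "term_cfg Q p S P R T" and S: "S \<subseteq> Q"
    and dec: "P = P1 @ g # P2" "P1 \<noteq> []" "P2 \<noteq> []"
    and f: "f \<in> R" "f \<notin> set P" "adj (last P1) f" "adj f (last P)"
    and z: "z \<in> S \<inter> Q - set P - R" "adj g z"
  shows "\<exists>q\<in>nbr Q - {p}. \<exists>xs. opath Q p q xs \<and> insert z (set P - {p}) \<subseteq> set xs"
proof -
  note P = cfgD(2,3,5,4)[OF cfg]
  have "tch (Q - set P - R) z (nbr Q - {p})" using cfgD(10)[OF cfg] z by blast
  then obtain zs q where zs: "pth zs" "hd zs = z" "set zs \<subseteq> Q - set P - R" "q \<in> nbr Q - {p}" "adj (last zs) q"
    using tch_path by blast
  have zn: "zs \<noteq> []" using zs unfolding pth_def by blast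
  obtain P1' where P1': "P1 = p # P1'" using P dec by (cases P1) auto
  have "pth (P1 @ (g # P2))" using P dec by simp
  then have p1: "pth P1" and "pth (g # P2)" and d1: "set P1 \<inter> set (g # P2) = {}"
    using pth_appendD[of P1 "g # P2"] dec by auto
  then have "pth ([g] @ P2)" by simp
  then have p2: "pth P2" and g2: "adj g (hd P2)" and d2: "g \<notin> set P2"
    using pth_appendD[of "[g]" P2] dec by auto
  have "last P = last P2" using dec by simp
  then have f4: "adj f (last P2)" using f by simp
  have "pth (P1 @ [f])" using p1 f dec by (intro pth_append) (auto simp: pth_def)
  then have "pth ((P1 @ [f]) @ rev P2)"
  proof (rule pth_append)
    show "pth (rev P2)" using p2 pth_rev by blast
    show "adj (last (P1 @ [f])) (hd (rev P2))" using f4 dec by (simp add: hd_rev)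
    show "set (P1 @ [f]) \<inter> set (rev P2) = {}" using d1 f dec by auto
  qed
  then have "pth (((P1 @ [f]) @ rev P2) @ [g])"
  proof (rule pth_append)
    show "pth [g]" by (simp add: pth_def)
    show "adj (last ((P1 @ [f]) @ rev P2)) (hd [g])" using g2 dec adj_sym by (simp add: last_rev)
    show "set ((P1 @ [f]) @ rev P2) \<inter> set [g] = {}" using d1 d2 f dec by auto
  qed
  then have "pth ((((P1 @ [f]) @ rev P2) @ [g]) @ zs)"
  proof (rule pth_append[OF _ zs(1)])
    show "adj (last (((P1 @ [f]) @ rev P2) @ [g])) (hd zs)" using z zs(2) by simp
    show "set (((P1 @ [f]) @ rev P2) @ [g]) \<inter> set zs = {}" using zs(3) f dec by auto
  qed
  then have "pth (p # P1' @ f # rev P2 @ g # zs)" unfolding P1' by simp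
  moreover have "set (P1' @ f # rev P2 @ g # zs) \<subseteq> Q"
  proof -
    have "p \<notin> set P1'" "p \<notin> set (g # P2)" using p1 d1 unfolding P1' pth_def by auto
    then show ?thesis using P f zs dec unfolding P1' by auto
  qed
  ultimately have "opath Q p q (P1' @ f # rev P2 @ g # zs)" using zs zn by (intro opathI) auto
  moreover have "z \<in> set zs" using zs zn hd_in_set by metis
  ultimately show ?thesis using zs(4) dec unfolding P1'
    by (intro bexI[of _ q] exI[of _ "P1' @ f # rev P2 @ g # zs"]) auto
qed

end

section \<open>Binomial estimates\<close>

lemma choose_ge_self:
  assumes "1 \<le> m" "m < n"
  shows "n \<le> n choose m"
  using assms
proof (induction n arbitrary: m)
  case (Suc n)
  show ?case
  proof (cases "m = n")
    case True
    then have "Suc n choose m = Suc n" using binomial_symmetric[of m "Suc n"] by simp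
    then show ?thesis by simp
  next
    case False
    obtain m' where m: "m = Suc m'" using Suc.prems by (cases m) auto
    have "n \<le> n choose m" using Suc False by auto
    moreover have "1 \<le> n choose m'" using Suc.prems m by (simp add: Suc_leI)
    ultimately show ?thesis unfolding m by simp
  qed
qed simp

text \<open>Every increment of the upper index adds at least one by Pascal's rule. In the degree
  counts this makes \<open>h\<close> hyperedge ports no more costly than \<open>h\<close> additional
  vertices.\<close>

lemma choose_add_le:
  assumes "m \<le> n"
  shows "(n choose Suc m) + h \<le> (n + h) choose Suc m"
proof (induction h)
  case (Suc h)
  have "1 \<le> (n + h) choose m" using assms by (simp add: Suc_leI)
  then show ?case using Suc by simp
qed simp

lemma choose_mono1: "n \<le> n' \<Longrightarrow> n choose m \<le> n' choose m"
  by (rule binomial_right_mono)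

lemma pascal_t:
  assumes "3 \<le> r" "r \<le> t"
  shows "t choose (r - 1) = ((t - 1) choose (r - 2)) + ((t - 1) choose (r - 1))"
    "t - 1 \<le> (t - 1) choose (r - 2)"
    "(t - 1) choose (r - 1) = ((t - 2) choose (r - 2)) + ((t - 2) choose (r - 1))"
    "1 \<le> (t - 2) choose (r - 2)" "t \<le> t choose (r - 1)"
proof -
  define q u where "q = r - 2" and "u = t - 2"
  then have r: "r = q + 2" and t: "t = Suc (Suc u)" using assms by simp_all
  show "t choose (r - 1) = ((t - 1) choose (r - 2)) + ((t - 1) choose (r - 1))" unfolding r t by simp
  show "(t - 1) choose (r - 1) = ((t - 2) choose (r - 2)) + ((t - 2) choose (r - 1))" unfolding r t by simp
  show "t - 1 \<le> (t - 1) choose (r - 2)" using choose_ge_self[of q "t - 1"] assms unfolding r t by simp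
  show "1 \<le> (t - 2) choose (r - 2)" using assms unfolding r t by (simp add: Suc_leI)
  show "t \<le> t choose (r - 1)" using choose_ge_self[of "r - 1" t] assms by simp
qed

text \<open>This estimate and the next two bound the degree of the last vertex of the path:
  \<open>j\<close> is the number of vertices on the path, \<open>z\<close> the number of vertices in
  \<open>Z\<close>, \<open>h\<close> the number of hyperedge ports and \<open>b\<close> the number
  of counted hyperedges on the path. The binomial stands for the hyperedges among
  \<open>j + z\<close> vertices; \<open>h\<close> is absorbed into its upper index, and
  \<open>b\<close> into \<open>C(t - 1, r - 2)\<close>, which is at least
  \<open>t - 1\<close>.\<close>

lemma num_small:
  fixes t r j z h b :: nat
  assumes rt: "3 \<le> r" "r \<le> t" and j: "1 \<le> j" "j + z + h \<le> t" "b \<le> j" "z = 0 \<Longrightarrow> b + 1 \<le> j"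
  shows "((j - 1 + z) choose (r - 1)) + h + b \<le> t choose (r - 1)"
proof (cases "r - 2 \<le> j - 1 + z")
  case True
  have "((j - 1 + z) choose (r - 1)) + h \<le> (j - 1 + z + h) choose (r - 1)"
    using choose_add_le[OF True, of h] rt by (simp add: Suc_diff_Suc numeral_2_eq_2 Suc_diff_le)
  also have "\<dots> \<le> (t - 1) choose (r - 1)" using j by (intro choose_mono1) simp
  finally show ?thesis using pascal_t(1,2)[OF rt] j by (cases "z = 0") linarith+
next
  case False
  then have "(j - 1 + z) choose (r - 1) = 0" by (simp add: binomial_eq_0)
  moreover have "h + b \<le> t" using j by simp
  ultimately show ?thesis using pascal_t(5)[OF rt] by linarith
qed

lemma num_inside:
  fixes t r j z h :: nat
  assumes rt: "3 \<le> r" "r \<le> t" and j: "1 \<le> j" "j + z + h = t + 1"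
  shows "((j - 1 + z) choose (r - 1)) + h \<le> t choose (r - 1)"
proof (cases "r - 2 \<le> j - 1 + z")
  case True
  have "((j - 1 + z) choose (r - 1)) + h \<le> (j - 1 + z + h) choose (r - 1)"
    using choose_add_le[OF True, of h] rt by (simp add: Suc_diff_Suc numeral_2_eq_2 Suc_diff_le)
  also have "j - 1 + z + h = t" using j by simp
  finally show ?thesis .
next
  case False
  then have "(j - 1 + z) choose (r - 1) = 0" by (simp add: binomial_eq_0)
  moreover have "h \<le> t" using j by simp
  ultimately show ?thesis using pascal_t(5)[OF rt] by linarith
qed

text \<open>The upper index is one lower than in \<open>num_inside\<close>, as for hyperedges that
  avoid one more vertex; this loss makes room for the \<open>b\<close> hyperedges on the
  path.\<close>

lemma num_rotate:
  fixes t r j z h b :: nat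
  assumes rt: "3 \<le> r" "r \<le> t" and j: "1 \<le> j" "j + z + h = t + 1" "2 \<le> z + h" "b \<le> j" "z = 0 \<Longrightarrow> b + 1 \<le> j"
  shows "((j - 1 + z - 1) choose (r - 1)) + h + b \<le> t choose (r - 1)"
proof (cases "h = 0")
  case True
  have "(j - 1 + z - 1) choose (r - 1) \<le> (t - 1) choose (r - 1)" using j by (intro choose_mono1) simp
  moreover have "b \<le> t - 1" using j True by simp
  ultimately show ?thesis using pascal_t(1,2)[OF rt] True by linarith
next
  case False
  have "(j - 1 + z - 1) choose (r - 1) \<le> (t - 2) choose (r - 1)" using j False by (intro choose_mono1) simp
  moreover have "h + b \<le> t" using j by (cases "z = 0") auto
  ultimately show ?thesis using pascal_t(1-4)[OF rt] rt by linarith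
qed

section \<open>The incidence graph\<close>

definition inc :: "'a set set \<Rightarrow> 'a + 'a set \<Rightarrow> 'a + 'a set \<Rightarrow> bool" where
  "inc E x y \<longleftrightarrow> (\<exists>v e. e \<in> E \<and> v \<in> e \<and> (x = Inl v \<and> y = Inr e \<or> x = Inr e \<and> y = Inl v))"

lemma inc_simps [simp]:
  "inc E (Inl v) (Inr e) \<longleftrightarrow> e \<in> E \<and> v \<in> e" "inc E (Inr e) (Inl v) \<longleftrightarrow> e \<in> E \<and> v \<in> e"
  "\<not> inc E (Inl v) (Inl u)" "\<not> inc E (Inr e) (Inr f)"
  unfolding inc_def by auto

lemma inc_InlD: "inc E (Inl v) y \<Longrightarrow> \<exists>e\<in>E. y = Inr e \<and> v \<in> e"
  and inc_InrD: "inc E (Inr e) y \<Longrightarrow> \<exists>v\<in>e. y = Inl v \<and> e \<in> E"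
  and inc_InlD2: "inc E y (Inl v) \<Longrightarrow> \<exists>e\<in>E. y = Inr e \<and> v \<in> e"
  and inc_InrD2: "inc E y (Inr e) \<Longrightarrow> \<exists>v\<in>e. y = Inl v \<and> e \<in> E"
  unfolding inc_def by auto

lemma inc_isl: "inc E x y \<Longrightarrow> isl y \<longleftrightarrow> \<not> isl x"
  unfolding inc_def by auto

locale hgraph = fixes E :: "'a set set"

sublocale hgraph \<subseteq> ugraph "inc E"
  by unfold_locales (auto simp: inc_def)

text \<open>Paths are measured by their vertex nodes, as the length of a Berge cycle is.\<close>

definition nv :: "('a + 'b) list \<Rightarrow> nat" where
  "nv xs = length (filter isl xs)"

lemma nv_simps [simp]: "nv [] = 0" "nv (Inl v # xs) = Suc (nv xs)" "nv (Inr e # xs) = nv xs"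
  "nv (xs @ ys) = nv xs + nv ys" "nv (rev xs) = nv xs"
  unfolding nv_def by (simp_all add: rev_filter[symmetric])

lemma Inl_vimage_filter: "{v. Inl v \<in> set xs} = projl ` set (filter isl xs)"
  by (force simp: isl_def)

lemma nv_card:
  assumes "distinct xs"
  shows "nv xs = card {v. Inl v \<in> set xs}"
proof -
  have "inj_on projl (set (filter isl xs))" by (auto simp: inj_on_def isl_def)
  then show ?thesis unfolding Inl_vimage_filter nv_def using assms
    by (metis card_image distinct_card distinct_filter)
qed

lemma finite_Inl_set: "finite {v. Inl v \<in> set xs}" "finite {e. Inr e \<in> set xs}"
proof -
  have "{v. Inl v \<in> set xs} \<subseteq> projl ` set xs" "{e. Inr e \<in> set xs} \<subseteq> projr ` set xs" by force+
  then show "finite {v. Inl v \<in> set xs}" "finite {e. Inr e \<in> set xs}" by (meson List.finite_set finite_imageI finite_subset)+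
qed

lemma nv_ge:
  assumes "distinct xs" "Inl ` A \<subseteq> set xs"
  shows "card A \<le> nv xs"
proof -
  have "A \<subseteq> {v. Inl v \<in> set xs}" using assms by blast
  then show ?thesis unfolding nv_card[OF assms(1)] by (intro card_mono finite_Inl_set)
qed

lemma nr_card:
  assumes "distinct xs"
  shows "length (filter (\<lambda>x. \<not> isl x) xs) = card {e. Inr e \<in> set xs}"
proof -
  have eq: "{e. Inr e \<in> set xs} = projr ` set (filter (\<lambda>x. \<not> isl x) xs)"
    by (force simp: image_iff split: sum.splits dest: sum.collapse)
  have "inj_on projr (set (filter (\<lambda>x. \<not> isl x) xs))"
    by (auto simp: inj_on_def) (metis sum.collapse(2))
  then show ?thesis unfolding eq using assms by (metis card_image distinct_card distinct_filter)
qed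

lemma alternate:
  assumes "successively (inc E) xs" "xs \<noteq> []" "isl (last xs)"
  shows "nv xs = length (filter (\<lambda>x. \<not> isl x) xs) + (if isl (hd xs) then 1 else 0)"
  using assms
proof (induction xs)
  case (Cons x xs)
  show ?case
  proof (cases "xs = []")
    case True
    then show ?thesis using Cons.prems by (simp add: nv_def)
  next
    case False
    then have "successively (inc E) xs" "inc E x (hd xs)" "isl (last xs)"
      using Cons.prems by (auto simp: successively_Cons)
    then show ?thesis using Cons.IH False inc_isl[of E x "hd xs"] by (auto simp: nv_def)
  qed
qed simp

lemma nv_length:
  assumes "successively (inc E) xs"
  shows "length xs \<le> 2 * nv xs + 1" "2 * nv xs \<le> length xs + 1"
proof -
  have "length xs \<le> 2 * nv xs + (if xs \<noteq> [] \<and> isl (hd xs) then 0 else 1) \<and>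
     2 * nv xs \<le> length xs + (if xs \<noteq> [] \<and> isl (hd xs) then 1 else 0)" using assms
  proof (induction xs)
    case (Cons x xs)
    then show ?case
    proof (cases "xs = []")
      case False
      then have "isl (hd xs) \<longleftrightarrow> \<not> isl x" using Cons.prems inc_isl[of E x "hd xs"] by (auto simp: successively_Cons)
      then show ?thesis using Cons False by (auto simp: successively_Cons nv_def split: if_splits)
    qed (auto simp: nv_def)
  qed simp
  then show "length xs \<le> 2 * nv xs + 1" "2 * nv xs \<le> length xs + 1" by (auto split: if_splits)
qed

lemma card_edges_at:
  fixes K :: "'a set"
  assumes "finite K" "s \<in> K" "\<And>e. e \<in> F \<Longrightarrow> s \<in> e \<and> e \<subseteq> K \<and> card e = r" "1 \<le> r"
  shows "card F \<le> (card K - 1) choose (r - 1)" "finite F"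
proof -
  have sub: "F \<subseteq> insert s ` {B. B \<subseteq> K - {s} \<and> card B = r - 1}"
  proof
    fix e assume "e \<in> F"
    then have e: "s \<in> e" "e \<subseteq> K" "card e = r" using assms by auto
    then have "finite e" using assms finite_subset by blast
    then have "card (e - {s}) = r - 1" using e by simp
    then show "e \<in> insert s ` {B. B \<subseteq> K - {s} \<and> card B = r - 1}" using e by (intro image_eqI[of _ _ "e - {s}"]) auto
  qed
  have fin: "finite {B. B \<subseteq> K - {s} \<and> card B = r - 1}" using assms by simp
  then show "finite F" using sub finite_subset by blast
  have "card F \<le> card {B. B \<subseteq> K - {s} \<and> card B = r - 1}"
    using sub fin surj_card_le by blast
  also have "\<dots> = card (K - {s}) choose (r - 1)" using assms n_subsets[of "K - {s}" "r - 1"] by simp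
  finally show "card F \<le> (card K - 1) choose (r - 1)" using assms by simp
qed

section \<open>Long paths between ports\<close>

text \<open>\<open>S\<close> are the core vertices of \<open>Q\<close> and \<open>F\<close> the hyperedges counted in their degrees. The ports are the nodes
  in \<open>nbr Q\<close>; only those that can lie on counted hyperedges, namely \<open>Z\<close> and the hyperedge ports, enter \<open>M\<close>.\<close>

locale ports = hgraph E for E :: "'a set set" +
  fixes Q :: "('a + 'a set) set" and S Z :: "'a set" and F :: "'a set set" and r t M :: nat
  assumes rt: "3 \<le> r" "r \<le> t"
    and finQ: "finite Q" and finN: "finite (nbr Q)" and cQ: "conn Q"
    and S: "Inl ` S \<subseteq> Q" "S \<noteq> {}"
    and F: "F \<subseteq> E" "\<And>e. e \<in> F \<Longrightarrow> card e = r"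
    and deg: "\<And>s. s \<in> S \<Longrightarrow> t choose (r - 1) < card {e \<in> F. s \<in> e}"
    and inQ: "\<And>e. e \<in> F \<Longrightarrow> Inr e \<in> Q \<Longrightarrow> e \<subseteq> S \<union> Z"
    and Z: "Inl ` Z \<subseteq> nbr Q"
    and M: "card Z + card {e. Inr e \<in> nbr Q} \<le> M" "2 \<le> M"
    and H2: "\<And>w s. s \<in> S \<Longrightarrow> Inl s \<noteq> w \<Longrightarrow> tch (Q - {w}) (Inl s) (nbr Q)"
    and two: "\<And>p. p \<in> nbr Q \<Longrightarrow> \<exists>q\<in>nbr Q. q \<noteq> p"
begin

lemma finite_ports: "finite Z" "finite {e. Inr e \<in> nbr Q}"
proof -
  have "finite (Inl ` Z :: ('a + 'a set) set)" by (rule finite_subset[OF Z finN])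
  then show "finite Z" by (rule finite_imageD) (simp add: inj_on_def)
  have "finite (Inr ` {e. Inr e \<in> nbr Q} :: ('a + 'a set) set)"
    by (rule finite_subset[OF _ finN]) blast
  then show "finite {e. Inr e \<in> nbr Q}" by (rule finite_imageD) (simp add: inj_on_def)
qed

end

section \<open>Counting the hyperedges at the last core vertex of the path\<close>

locale ports_cfg = ports E Q S Z F r t M
  for E :: "'a set set" and Q S Z F r t M +
  fixes p P R T s
  assumes cfg: "term_cfg Q p (Inl ` S) P R T" and lastP: "last P = Inl s"
begin

definition J where "J = {v. Inl v \<in> set P \<and> Inl v \<noteq> p}"
definition U where "U = {e. Inr e \<in> set P}"
definition Yh where "Yh = {e. Inr e \<in> nbr Q}"
definition D where "D = {e \<in> F. s \<in> e}"

lemmas cf = cfgD[OF cfg]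

lemma pQ: "p \<notin> Q" using cf(1) unfolding nbr_def by blast

lemma dP: "distinct P" "P \<noteq> []" "successively (inc E) P"
  using cf(2) unfolding pth_def by auto

lemma sS: "s \<in> S"
proof -
  have "last P \<in> Inl ` S" using cf(7) by blast
  then show ?thesis using lastP by auto
qed

lemma sQ: "Inl s \<in> Q" "Inl s \<noteq> p" "Inl s \<in> R"
proof -
  show "Inl s \<in> Q" using sS S by blast
  then show "Inl s \<noteq> p" using pQ by blast
  show "Inl s \<in> R" using cf(7) lastP by auto
qed

lemma finJ: "finite J" "finite U" "finite Yh"
  unfolding J_def U_def Yh_def using finite_Inl_set[of P] finite_ports by auto

lemma sJ: "s \<in> J"
  unfolding J_def using sQ lastP dP last_in_set[of P] by auto

lemma JQ: "v \<in> J \<Longrightarrow> Inl v \<in> Q \<and> Inl v \<in> set P"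
  unfolding J_def using cf(4) by auto

lemma JZ: "J \<inter> Z = {}"
  using JQ Z unfolding nbr_def by auto

lemma setP: "Inl v \<in> set P \<Longrightarrow> v \<in> J \<or> Inl v = p"
  unfolding J_def by blast

lemma SP: "v \<in> S \<Longrightarrow> Inl v \<in> set P \<Longrightarrow> v \<in> J"
  using setP[of v] S(1) pQ by (metis image_subset_iff)

lemma SR: "v \<in> S \<Longrightarrow> Inl v \<in> R \<Longrightarrow> v = s"
proof -
  assume "v \<in> S" "Inl v \<in> R"
  then have "Inl v \<in> Inl ` S \<inter> R" by blast
  then show "v = s" unfolding cf(7) lastP by simp
qed

lemma split: "\<exists>P'. P = p # P' \<and> P' \<noteq> [] \<and> set P' \<subseteq> Q"
  using cfg_split[OF cfg] S by blast

text \<open>The path alternates and ends in the vertex \<open>s\<close>. A port \<open>p\<close>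
  that is a vertex is left out of \<open>J\<close>, and one that is a hyperedge belongs to
  \<open>U\<close>; so the two counts agree in both cases.\<close>

lemma card_U: "card U = card J"
proof -
  obtain P' where P': "P = p # P'" "P' \<noteq> []" "set P' \<subseteq> Q" using split by blast
  have d: "distinct P'" "p \<notin> set P'" using dP P' by auto
  have J: "J = {v. Inl v \<in> set P'}" unfolding J_def using P' d by auto
  have "nv P = length (filter (\<lambda>x. \<not> isl x) P) + (if isl (hd P) then 1 else 0)"
    using alternate[OF dP(3,2)] lastP by simp
  then have "nv P' = length (filter (\<lambda>x. \<not> isl x) P)" using P' by (auto simp: nv_def)
  then show ?thesis unfolding J U_def using nv_card[OF d(1)] nr_card[OF dP(1)] by simp
qed

lemma jpos: "1 \<le> card J"
  using sJ finJ card_0_eq[of J] by (auto simp: Suc_le_eq card_gt_0_iff)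

lemma D: "finite D" "t choose (r - 1) < card D" "\<And>e. e \<in> D \<Longrightarrow> e \<in> F \<and> e \<in> E \<and> s \<in> e \<and> card e = r"
proof -
  show c: "t choose (r - 1) < card D" using deg[OF sS] unfolding D_def .
  show "finite D" by (rule ccontr) (use c in simp)
  show "\<And>e. e \<in> D \<Longrightarrow> e \<in> F \<and> e \<in> E \<and> s \<in> e \<and> card e = r" unfolding D_def using F by blast
qed

lemma D_nbr: "e \<in> D \<Longrightarrow> Inr e \<in> R \<union> T \<union> set P"
  using cf(9)[of "Inl s" "Inr e"] sQ D by simp

lemma Q_edge: "e \<in> F \<Longrightarrow> Inr e \<in> Q \<Longrightarrow> v \<in> e \<Longrightarrow> v \<in> S \<or> v \<in> Z"
  using inQ by blast

text \<open>A vertex of such a hyperedge is a core vertex or lies in \<open>Z\<close>. The only core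
  vertex in \<open>R\<close> is \<open>s\<close>, so any other one is on the path or is the
  separating node; a vertex in \<open>Z\<close> lies outside \<open>Q\<close> and is a remaining
  port or \<open>p\<close>.\<close>

lemma R_edge:
  assumes e: "e \<in> D" "Inr e \<in> R" and v: "v \<in> e"
  shows "v \<in> J \<or> (v \<in> Z \<and> (T = nbr Q - {p} \<or> Inl v = p)) \<or> (Inl v \<in> T \<and> T \<noteq> nbr Q - {p})"
proof -
  have "Inr e \<in> Q" using e cf(5) by blast
  then have vSZ: "v \<in> S \<or> v \<in> Z" using Q_edge D e v by blast
  have "inc E (Inr e) (Inl v)" using e v D by simp
  then have n: "Inl v \<in> R \<union> T \<union> set P" using cf(9) e by blast
  show ?thesis
  proof (cases "v \<in> S")
    case True
    then have vQ: "Inl v \<in> Q" using S by blast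
    then have "T \<noteq> nbr Q - {p}" if "Inl v \<in> T" using that unfolding nbr_def by blast
    then show ?thesis using n SR[OF True] SP[OF True] sJ by blast
  next
    case False
    then have vZ: "v \<in> Z" using vSZ by blast
    then have "Inl v \<notin> Q" using Z unfolding nbr_def by blast
    moreover have "T \<subseteq> Q" if "T \<noteq> nbr Q - {p}" using that cf(11) by blast
    ultimately have "Inl v \<in> set P" if "T \<noteq> nbr Q - {p}" using n that cf(5) by blast
    then have "Inl v = p" if "T \<noteq> nbr Q - {p}" using that \<open>Inl v \<notin> Q\<close> cf(4) by blast
    then show ?thesis using vZ by blast
  qed
qed

lemma plain: "\<exists>q\<in>nbr Q - {p}. \<exists>xs. opath Q p q xs \<and> card J \<le> nv xs \<and> (T \<noteq> nbr Q - {p} \<longrightarrow> T \<subseteq> set xs)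
    \<and> Inl ` J \<subseteq> set xs"
proof -
  obtain q xs where q: "q \<in> nbr Q - {p}" "opath Q p q xs" "set P - {p} \<subseteq> set xs" "T \<noteq> nbr Q - {p} \<longrightarrow> T \<subseteq> set xs"
    using cfg_plain[OF cfg S(1)] by blast
  moreover have JX: "Inl ` J \<subseteq> set xs" using q(3) unfolding J_def by auto
  moreover have "card J \<le> nv xs" using q(2) JX unfolding opath_def pth_def by (intro nv_ge) auto
  ultimately show ?thesis by blast
qed

lemma edge_on_path:
  assumes g: "g \<in> U" "Inr g \<noteq> p"
  shows "\<exists>P1 P2 x. P = P1 @ Inr g # P2 \<and> P1 \<noteq> [] \<and> P2 \<noteq> [] \<and> last P1 = Inl x \<and> x \<in> g \<and> g \<in> E \<and> x \<noteq> s
     \<and> Inl x \<in> set P \<and> Inr g \<in> Q"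
proof -
  obtain P1 P2 where dec: "P = P1 @ Inr g # P2" using g unfolding U_def by (meson mem_Collect_eq split_list)
  have P1: "P1 \<noteq> []" using dec cf(3) g by auto
  have P2: "P2 \<noteq> []" using dec lastP by auto
  have "inc E (last P1) (Inr g)" using pth_appendD(3)[of P1 "Inr g # P2"] cf(2) P1 unfolding dec by simp
  then obtain x where x: "last P1 = Inl x" "x \<in> g" "g \<in> E" using inc_InrD2 by metis
  have "Inl x \<in> set P1" using x P1 last_in_set by metis
  moreover have "Inl s \<in> set P2" using lastP dec P2 last_in_set[of P2] by simp
  ultimately have "x \<noteq> s" "Inl x \<in> set P" using dP(1) unfolding dec by auto
  moreover have "Inr g \<in> Q" using g cf(4) unfolding U_def by auto
  ultimately show ?thesis using dec P1 P2 x by blast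
qed

text \<open>The hyperedge \<open>f\<close> leads from \<open>x\<close>, the vertex before
  \<open>g\<close>, directly to the end \<open>s\<close>. The tail is then traversed backwards to
  \<open>g\<close>, which is left through the new vertex \<open>z\<close>: one vertex is
  gained.\<close>

lemma rotate:
  assumes g: "g \<in> U" "Inr g \<noteq> p" and dec: "P = P1 @ Inr g # P2" "P1 \<noteq> []" "P2 \<noteq> []" "last P1 = Inl x"
    and f: "f \<in> D" "f \<notin> U" "Inr f \<in> R" "x \<in> f"
    and z: "z \<in> g" "g \<in> E" "z \<in> S" "z \<notin> J"
  shows "\<exists>q\<in>nbr Q - {p}. \<exists>xs. opath Q p q xs \<and> card J + 1 \<le> nv xs"
proof -
  have zP: "Inl z \<notin> set P" using SP z by blast
  have zR: "Inl z \<notin> R" using SR[OF z(3)] z sJ by blast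
  obtain q xs where q: "q \<in> nbr Q - {p}" "opath Q p q xs" "insert (Inl z) (set P - {p}) \<subseteq> set xs"
    using cfg_rotate[OF cfg S(1) dec(1-3), of "Inr f" "Inl z"] f z zP zR dec S D lastP unfolding U_def by auto
  have "Inl ` insert z J \<subseteq> set xs" using q(3) unfolding J_def by auto
  then have "card (insert z J) \<le> nv xs" using q(2) unfolding opath_def pth_def by (intro nv_ge) auto
  then show ?thesis using q z finJ by auto
qed

text \<open>If the plain path is too short, then \<open>j + z + h \<le> t + 1\<close>, where
  \<open>j\<close>, \<open>z\<close>, \<open>h\<close> count the path vertices, \<open>Z\<close> and
  the hyperedge ports. The degree of \<open>s\<close> excludes \<open>j + z + h \<le> t\<close>. In
  the case of equality it still forces a path hyperedge that leaves the \<open>j + z\<close> known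
  vertices, and a hyperedge at \<open>s\<close> with which the path can be rotated. The vertex
  gained is the missing one.\<close>

lemma alpha:
  assumes T: "T = nbr Q - {p}"
  shows "\<exists>q\<in>nbr Q - {p}. \<exists>xs. opath Q p q xs \<and> 1 \<le> nv xs \<and> t + 2 \<le> nv xs + M"
proof (cases "t + 2 \<le> card J + M")
  case True
  then show ?thesis using plain jpos by (meson add_le_mono1 le_trans)
next
  case False
  define z h where "z = card Z" and "h = card Yh"
  define K where "K = J \<union> Z"
  define A where "A = {e \<in> D. e \<subseteq> K}"
  define B where "B = {e \<in> D. e \<in> U \<and> e \<notin> Yh}"
  have finK: "finite K" unfolding K_def using finJ finite_ports by simp
  have cK: "card K = card J + z" unfolding K_def z_def using finJ finite_ports JZ by (simp add: card_Un_disjoint)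
  have zhM: "z + h \<le> M" unfolding z_def h_def Yh_def using M by simp
  have cls: "e \<subseteq> K \<and> Inr e \<in> R \<or> e \<in> Yh \<or> e \<in> U" if e: "e \<in> D" for e
  proof -
    consider "Inr e \<in> R" | "Inr e \<in> nbr Q" | "Inr e \<in> set P" using D_nbr[OF e] T by blast
    then show ?thesis
    proof cases
      case 1
      then have "e \<subseteq> K" using R_edge[OF e] T unfolding K_def by blast
      then show ?thesis using 1 by blast
    qed (auto simp: Yh_def U_def)
  qed
  have cA: "card A \<le> (card J - 1 + z) choose (r - 1)" and fA: "finite A"
  proof -
    have "card A \<le> (card K - 1) choose (r - 1)"
      using finK sJ D rt by (intro card_edges_at(1)[where s = s]) (auto simp: A_def K_def)
    moreover have "card K - 1 = card J - 1 + z" using cK jpos by simp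
    ultimately show "card A \<le> (card J - 1 + z) choose (r - 1)" by simp
    show "finite A" using D unfolding A_def by simp
  qed
  have bU: "B \<subseteq> U" unfolding B_def by blast
  have b: "card B \<le> card J" using bU finJ card_mono card_U by metis
  \<comment> \<open>With \<open>Z\<close> empty, one path hyperedge is missing from
    \<open>B\<close>: the port \<open>p\<close> if it is a hyperedge, and otherwise the first
    hyperedge, which contains the vertex \<open>p\<close> outside \<open>S\<close> and hence is not
    in \<open>F\<close>.\<close>
  have b0: "card B + 1 \<le> card J" if "z = 0"
  proof -
    have "Z = {}" using that finite_ports unfolding z_def by simp
    obtain P' where P': "P = p # P'" "P' \<noteq> []" "set P' \<subseteq> Q" using split by blast
    have "\<exists>g\<in>U. g \<notin> B"
    proof (cases p)
      case (Inr e)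
      then have "e \<in> U" "e \<in> Yh" unfolding U_def Yh_def using P' cf(1) by auto
      then show ?thesis unfolding B_def by blast
    next
      case (Inl v)
      have "inc E p (hd P')" using P' dP by (simp add: successively_Cons)
      then obtain g where g: "hd P' = Inr g" "v \<in> g" using Inl inc_InlD by metis
      then have gQ: "Inr g \<in> Q" "g \<in> U" using P' hd_in_set[of P'] unfolding U_def by auto
      have "g \<notin> F"
      proof
        assume "g \<in> F"
        then have "v \<in> S" using Q_edge gQ g \<open>Z = {}\<close> by blast
        then show False using S pQ Inl by blast
      qed
      then show ?thesis using gQ D unfolding B_def by blast
    qed
    then have "B \<subset> U" using bU by blast
    then have "card B < card U" using finJ by (intro psubset_card_mono)
    then show ?thesis using card_U by simp
  qed
  have DAB: "D \<subseteq> A \<union> Yh \<union> B" using cls unfolding A_def B_def by blast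
  have fB: "finite B" using bU finJ finite_subset by blast
  have cD: "card D \<le> card A + h + card B"
  proof -
    have "card D \<le> card (A \<union> Yh \<union> B)" using DAB fA fB finJ by (intro card_mono) auto
    also have "\<dots> \<le> card (A \<union> Yh) + card B" by (rule card_Un_le)
    also have "\<dots> \<le> card A + h + card B" unfolding h_def using card_Un_le[of A Yh] by simp
    finally show ?thesis .
  qed
  have eqt: "card J + z + h = t + 1"
  proof (rule ccontr)
    assume "card J + z + h \<noteq> t + 1"
    then have "card J + z + h \<le> t" using False zhM by linarith
    then have "((card J - 1 + z) choose (r - 1)) + h + card B \<le> t choose (r - 1)"
      using num_small[OF rt jpos, of z h "card B"] b b0 by blast
    then show False using cD cA D(2) by linarith
  qed
  have zh2: "2 \<le> z + h" using eqt False M zhM by linarith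
  \<comment> \<open>Otherwise the path hyperedges would be counted in the binomial already, and the
    degree of \<open>s\<close> would be at most \<open>C(t, r - 1)\<close>.\<close>
  have "\<exists>g\<in>B. \<not> g \<subseteq> K"
  proof (rule ccontr)
    assume n: "\<not> (\<exists>g\<in>B. \<not> g \<subseteq> K)"
    then have "D \<subseteq> A \<union> Yh" using DAB unfolding A_def B_def by blast
    then have "card D \<le> card (A \<union> Yh)" using fA finJ by (intro card_mono) auto
    also have "\<dots> \<le> card A + h" unfolding h_def by (rule card_Un_le)
    finally show False using num_inside[OF rt jpos eqt] cA D(2) by linarith
  qed
  then obtain g where g: "g \<in> B" "\<not> g \<subseteq> K" by blast
  then have gU: "g \<in> U" "g \<notin> Yh" "g \<in> D" unfolding B_def by auto
  have gp: "Inr g \<noteq> p" using gU cf(1) unfolding Yh_def by auto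
  obtain P1 P2 x where dec: "P = P1 @ Inr g # P2" "P1 \<noteq> []" "P2 \<noteq> []" "last P1 = Inl x" "x \<in> g" "g \<in> E" "x \<noteq> s"
     "Inl x \<in> set P" "Inr g \<in> Q" using edge_on_path[OF gU(1) gp] by blast
  have gSZ: "g \<subseteq> S \<union> Z" using inQ gU dec D by blast
  have xK: "x \<in> K"
  proof -
    have "x \<in> S \<or> x \<in> Z" using gSZ dec by blast
    then show ?thesis using SP dec unfolding K_def by blast
  qed
  obtain z0 where z0: "z0 \<in> g" "z0 \<notin> K" using g by blast
  then have z0S: "z0 \<in> S" "z0 \<notin> J" using gSZ unfolding K_def by blast+
  \<comment> \<open>If no free hyperedge at \<open>s\<close> contained \<open>x\<close>, the free
    ones would live on one vertex less.\<close>
  have "\<exists>f\<in>D. f \<notin> U \<and> f \<notin> Yh \<and> x \<in> f"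
  proof (rule ccontr)
    assume n: "\<not> (\<exists>f\<in>D. f \<notin> U \<and> f \<notin> Yh \<and> x \<in> f)"
    define A' where "A' = {e \<in> D. e \<subseteq> K - {x}}"
    have sub: "D \<subseteq> A' \<union> Yh \<union> B"
    proof
      fix e assume e: "e \<in> D"
      show "e \<in> A' \<union> Yh \<union> B"
      proof (cases "e \<in> U \<or> e \<in> Yh")
        case True
        then show ?thesis using e unfolding B_def by blast
      next
        case False
        then have "e \<subseteq> K" "x \<notin> e" using cls[OF e] n e by blast+
        then show ?thesis using e unfolding A'_def by blast
      qed
    qed
    have sK: "s \<in> K - {x}" using sJ dec unfolding K_def by blast
    have "card A' \<le> (card (K - {x}) - 1) choose (r - 1)"
      using finK sK D rt by (intro card_edges_at(1)[where s = s]) (auto simp: A'_def)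
    moreover have "card (K - {x}) - 1 = card J - 1 + z - 1"
      using xK finK cK jpos by (simp add: card_Diff_singleton)
    ultimately have cA': "card A' \<le> (card J - 1 + z - 1) choose (r - 1)" by simp
    have "finite A'" using D unfolding A'_def by simp
    then have "card D \<le> card (A' \<union> Yh \<union> B)" using sub fB finJ by (intro card_mono) auto
    also have "\<dots> \<le> card (A' \<union> Yh) + card B" by (rule card_Un_le)
    also have "\<dots> \<le> card A' + h + card B" unfolding h_def using card_Un_le[of A' Yh] by simp
    finally show False using num_rotate[OF rt jpos eqt zh2 b] b0 cA' D(2) by linarith
  qed
  then obtain f where f: "f \<in> D" "f \<notin> U" "f \<notin> Yh" "x \<in> f" by blast
  then have "Inr f \<in> R" using cls by blast
  then obtain q xs where "q \<in> nbr Q - {p}" "opath Q p q xs" "card J + 1 \<le> nv xs"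
    using rotate[OF gU(1) gp dec(1-4) f(1,2) _ f(4) z0(1) dec(6) z0S] by blast
  moreover have "t + 2 \<le> nv xs + M" "1 \<le> nv xs" using calculation(3) eqt zhM by linarith+
  ultimately show ?thesis by blast
qed

lemma single:
  assumes "T = {w}" "T \<noteq> nbr Q - {p}"
  shows "w \<in> Q" "w \<notin> set P"
proof -
  obtain w' where w': "w' \<in> Q - R - set P" "T = {w'}"
    using cf(11)
  proof (elim disjE bexE conjE)
    assume "T = nbr Q - {p}"
    then show thesis using assms(2) by (rule notE[rotated])
  qed (rule that)
  then have "w' = w" using assms(1) by simp
  then show "w \<in> Q" "w \<notin> set P" using w'(1) by simp_all
qed

text \<open>The hyperedges at \<open>s\<close> off the path lie within \<open>J\<close>,
  \<open>w\<close> and possibly the port \<open>p\<close>, at most \<open>j + 2\<close> vertices. At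
  most \<open>j\<close> hyperedges are on the path, so the degree of \<open>s\<close> forces
  \<open>j \<ge> t - 1\<close>. The node \<open>w\<close> is a further vertex on the completed
  path.\<close>

lemma beta_vertex:
  assumes T: "T = {Inl w}" "T \<noteq> nbr Q - {p}"
  shows "\<exists>q\<in>nbr Q - {p}. \<exists>xs. opath Q p q xs \<and> t \<le> nv xs"
proof -
  note wQ = single[OF T]
  then have wJ: "w \<notin> J" using JQ by blast
  define K where "K = J \<union> {v \<in> Z. Inl v = p} \<union> {w}"
  have finK: "finite K" unfolding K_def using finJ finite_ports by simp
  have cK: "card K \<le> card J + 2"
  proof -
    have "card {v \<in> Z. Inl v = p} \<le> 1"
      by (rule card_le_Suc0_iff_eq[THEN iffD2, folded One_nat_def]) (use finite_ports in auto)
    then show ?thesis unfolding K_def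
      using card_Un_le[of "J \<union> {v \<in> Z. Inl v = p}" "{w}"] card_Un_le[of J "{v \<in> Z. Inl v = p}"] by simp
  qed
  define A where "A = {e \<in> D. e \<subseteq> K}"
  have "D \<subseteq> A \<union> U"
  proof
    fix e assume e: "e \<in> D"
    then consider "Inr e \<in> R" | "Inr e \<in> set P" using D_nbr[OF e] T by auto
    then show "e \<in> A \<union> U"
    proof cases
      case 1
      then have "e \<subseteq> K" using R_edge[OF e] T unfolding K_def by blast
      then show ?thesis using e unfolding A_def by blast
    qed (auto simp: U_def)
  qed
  moreover have "finite A" using D unfolding A_def by simp
  ultimately have "card D \<le> card (A \<union> U)" using finJ by (intro card_mono) auto
  also have "\<dots> \<le> card A + card J" using card_Un_le[of A U] card_U by simp
  finally have cD: "card D \<le> card A + card J" .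
  have cA: "card A \<le> (card K - 1) choose (r - 1)"
    using finK sJ D rt by (intro card_edges_at(1)[where s = s]) (auto simp: A_def K_def)
  have jt: "t \<le> card J + 1"
  proof (rule ccontr)
    assume "\<not> t \<le> card J + 1"
    then have j: "card J + 1 \<le> t - 1" by linarith
    have "(card K - 1) choose (r - 1) \<le> (t - 1) choose (r - 1)" using cK j by (intro choose_mono1) linarith
    then show False using cA cD D(2) pascal_t(1,2)[OF rt] j by linarith
  qed
  obtain q xs where q: "q \<in> nbr Q - {p}" "opath Q p q xs" "T \<subseteq> set xs" "Inl ` J \<subseteq> set xs" using plain T by blast
  have "card (insert w J) \<le> nv xs" using q T unfolding opath_def pth_def by (intro nv_ge) auto
  then have "t \<le> nv xs" using wJ finJ jt by simp
  then show ?thesis using q by blast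
qed

text \<open>The component of \<open>z\<close> off the path can be left only through one of its
  hyperedges, towards a vertex of the path or a vertex port: there are no hyperedge ports, and by
  \<open>UK\<close> the hyperedges on the path contain no vertex of the component. Deleting
  \<open>w\<close>, and then \<open>s\<close>, does not cut \<open>z\<close> off from the ports,
  which yields two different hyperedges of the component, one at \<open>s\<close> and one at another
  exit vertex. Between them lies a vertex.\<close>

lemma bridge:
  assumes Yh0: "Yh = {}" and UK: "\<And>g. g \<in> U \<Longrightarrow> g \<subseteq> J \<union> {v. Inl v \<notin> Q}"
    and w: "w \<in> E" "Inr w \<in> Q - set P" "s \<in> w" "z \<in> w" "z \<in> S" "Inl z \<notin> set P"
  shows "\<exists>bs h h' k v. pth bs \<and> set bs \<subseteq> Q - set P \<and> hd bs = Inr h \<and> last bs = Inr h' \<and> s \<in> h \<and> h \<in> E \<and> k \<in> h' \<and>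
     h' \<in> E \<and> k \<noteq> s \<and> (Inl k \<in> set P \<or> Inl k \<in> nbr Q) \<and> Inl v \<in> set bs"
proof -
  let ?C = "comp_of (Q - set P) (Inl z)"
  have zQ: "Inl z \<in> Q - set P" using w S by blast
  have CQ: "?C \<subseteq> Q - set P" by (rule comp_of_sub)
  have zC: "Inl z \<in> ?C" using zQ by (rule comp_of_self)
  have wC: "Inr w \<in> ?C" using comp_of_closed[OF zC _ w(2)] w by simp
  have exits: "\<exists>h k. Inr h \<in> ?C \<and> Inr h \<noteq> n \<and> h \<in> E \<and> k \<in> h \<and> (Inl k \<in> set P \<or> Inl k \<in> nbr Q) \<and> Inl k \<noteq> n"
    if n: "n \<in> Q" "n \<noteq> Inl z" for n
  proof -
    have "tch (Q - {n}) (Inl z) (nbr Q)" using H2[OF w(5), of n] n by simp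
    then obtain b c where bc: "reach (Q - {n}) (Inl z) b" "c \<in> nbr Q" "inc E b c" unfolding tch_def by blast
    show ?thesis
    proof (cases "b \<in> ?C")
      case True
      obtain k where k: "c = Inl k" using bc(2) Yh0 unfolding Yh_def by (cases c) auto
      then obtain h where h: "b = Inr h" "h \<in> E" "k \<in> h" using bc(3) inc_InlD2 by metis
      have "b \<noteq> n" using bc reach_in by blast
      moreover have "c \<noteq> n" using bc(2) n unfolding nbr_def by blast
      ultimately show ?thesis using True h k bc by blast
    next
      case False
      then obtain a b' where ab: "a \<in> ?C" "b' \<in> Q - {n} - ?C" "inc E a b'" "reach (Q - {n}) (Inl z) a"
        using reach_exit[OF bc(1) zC] by blast
      have b'P: "b' \<in> set P" using ab comp_of_closed by blast
      have an: "a \<noteq> n" using ab reach_in by blast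
      show ?thesis
      proof (cases b')
        case (Inl k)
        then obtain h where h: "a = Inr h" "h \<in> E" "k \<in> h" using ab(3) inc_InlD2 by metis
        then show ?thesis using ab an b'P Inl by blast
      next
        case (Inr g)
        then obtain v where v: "a = Inl v" "v \<in> g" using ab(3) inc_InrD2 by metis
        have "g \<in> U" using b'P Inr unfolding U_def by simp
        then have "v \<in> J \<or> Inl v \<notin> Q" using UK v by blast
        moreover have "a \<in> Q - set P" using ab CQ by blast
        ultimately have False using v JQ by blast
        then show ?thesis ..
      qed
    qed
  qed
  have zs: "z \<noteq> s" using w(6) lastP dP last_in_set[of P] by metis
  obtain h1 k1 where h1: "Inr h1 \<in> ?C" "h1 \<noteq> w" "h1 \<in> E" "k1 \<in> h1" "Inl k1 \<in> set P \<or> Inl k1 \<in> nbr Q"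
    using exits[of "Inr w"] w(2) by auto
  obtain h2 k2 where h2: "Inr h2 \<in> ?C" "h2 \<in> E" "k2 \<in> h2" "Inl k2 \<in> set P \<or> Inl k2 \<in> nbr Q" "k2 \<noteq> s"
    using exits[of "Inl s"] sQ zs by auto
  \<comment> \<open>Deleting \<open>w\<close> gives an exit \<open>h1\<close> different from
    \<open>w\<close>, and deleting \<open>s\<close> gives an exit \<open>h2\<close> to a vertex
    other than \<open>s\<close>. If \<open>h1\<close> leads only to \<open>s\<close> and
    \<open>h2\<close> is another hyperedge, the pair is \<open>h1\<close>, \<open>h2\<close>;
    otherwise \<open>w\<close> serves as the hyperedge at \<open>s\<close>.\<close>
  have "\<exists>h h' k. Inr h \<in> ?C \<and> Inr h' \<in> ?C \<and> h \<noteq> h' \<and> s \<in> h \<and> h \<in> E \<and> k \<in> h' \<and> h' \<in> E \<and> k \<noteq> s \<and>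
     (Inl k \<in> set P \<or> Inl k \<in> nbr Q)"
  proof (cases "k1 = s")
    case False
    then show ?thesis using h1 wC w by blast
  next
    case True
    then show ?thesis using h1 h2 wC w by (cases "h2 = h1") blast+
  qed
  then obtain h h' k where h: "Inr h \<in> ?C" "Inr h' \<in> ?C" "h \<noteq> h'" "s \<in> h" "h \<in> E" "k \<in> h'" "h' \<in> E" "k \<noteq> s"
     "Inl k \<in> set P \<or> Inl k \<in> nbr Q" by blast
  have "reach ?C (Inr h) (Inr h')" using h conn_comp_of unfolding conn_def by blast
  then obtain bs where bs: "pth bs" "hd bs = Inr h" "last bs = Inr h'" "set bs \<subseteq> ?C" using reach_path by blast
  have "bs \<noteq> []" using bs unfolding pth_def by blast
  then have "2 \<le> length bs" using bs h(3) by (cases bs; cases "tl bs") auto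
  then have "nv bs \<noteq> 0" using nv_length(1)[of E bs] bs unfolding pth_def by auto
  then have "filter isl bs \<noteq> []" unfolding nv_def by simp
  then obtain x where "x \<in> set bs" "isl x" by (meson filter_False)
  then have "Inl (projl x) \<in> set bs" by simp
  then show ?thesis using bs h CQ by blast
qed

text \<open>An exit through a hyperedge adds no vertex, so the count may stop at
  \<open>t - 1\<close> path vertices, but then it is tight everywhere. The missing vertex comes from
  a rotation or, when \<open>M = 2\<close>, from a bridge. The defective alternative remains only
  for \<open>M \<ge> 3\<close>, where \<open>t - 1\<close> vertices suffice for
  \<open>t + 2 - M\<close>. It also records \<open>4 \<le> t\<close>, so that at least three
  vertices remain, and a contact of the path with another port, which is impossible in the situation
  of \<open>term_initial\<close>.\<close>

lemma beta_edge:
  assumes T: "T = {Inr w}" "T \<noteq> nbr Q - {p}"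
  shows "\<exists>q\<in>nbr Q - {p}. \<exists>xs. opath Q p q xs \<and>
     (t \<le> nv xs \<or> (t \<le> nv xs + 1 \<and> 3 \<le> M \<and> 4 \<le> t \<and> \<not> (\<forall>a\<in>set P - {p}. \<forall>y\<in>nbr Q - {p}. \<not> inc E a y)))"
proof (cases "t \<le> card J")
  case True
  then show ?thesis using plain by (meson le_trans)
next
  case False
  note wQ = single[OF T]
  define K where "K = J \<union> {v \<in> Z. Inl v = p}"
  have finK: "finite K" unfolding K_def using finJ finite_ports by simp
  have c1: "card {v \<in> Z. Inl v = p} \<le> 1"
    by (rule card_le_Suc0_iff_eq[THEN iffD2, folded One_nat_def]) (use finite_ports in auto)
  have cK: "card K \<le> card J + card {v \<in> Z. Inl v = p}" unfolding K_def by (rule card_Un_le)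
  define A where "A = {e \<in> D. e \<subseteq> K}"
  define B where "B = {e \<in> D. e \<in> U \<and> \<not> e \<subseteq> K}"
  have fAB: "finite A" "finite B" using D unfolding A_def B_def by simp_all
  have cls: "e \<in> A \<and> Inr e \<in> R \<or> e \<in> U \<or> e = w" if e: "e \<in> D" for e
  proof -
    consider "Inr e \<in> R" | "e = w" | "Inr e \<in> set P" using D_nbr[OF e] T by auto
    then show ?thesis
    proof cases
      case 1
      then have "e \<subseteq> K" using R_edge[OF e] T unfolding K_def by blast
      then show ?thesis using e 1 unfolding A_def by blast
    qed (auto simp: U_def)
  qed
  have cA: "card A \<le> (card K - 1) choose (r - 1)"
    using finK sJ D rt by (intro card_edges_at(1)[where s = s]) (auto simp: A_def K_def)
  have cB: "card B \<le> card J" using card_mono[of U B] finJ card_U unfolding B_def by auto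
  have DAB: "D \<subseteq> A \<union> B \<union> ({w} \<inter> D)" using cls unfolding A_def B_def by blast
  have cD: "card D \<le> card A + card B + card ({w} \<inter> D)"
  proof -
    have "card D \<le> card (A \<union> B \<union> ({w} \<inter> D))" using DAB fAB by (intro card_mono) auto
    also have "\<dots> \<le> card (A \<union> B) + card ({w} \<inter> D)" by (rule card_Un_le)
    finally show ?thesis using card_Un_le[of A B] by linarith
  qed
  have cw: "card ({w} \<inter> D) \<le> 1" using card_mono[of "{w}" "{w} \<inter> D"] by simp
  \<comment> \<open>At most \<open>card J \<le> t - 1\<close> path hyperedges and \<open>w\<close>
    come on top of the binomial, which would be at most \<open>C(t - 2, r - 1)\<close>; the total
    would not exceed \<open>C(t, r - 1)\<close>.\<close>
  have k: "t - 1 \<le> card K - 1"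
  proof (rule ccontr)
    assume "\<not> t - 1 \<le> card K - 1"
    then have "(card K - 1) choose (r - 1) \<le> (t - 2) choose (r - 1)" by (intro choose_mono1) linarith
    then show False using cA cD cB cw D(2) pascal_t(1-4)[OF rt] False by linarith
  qed
  have kt: "card K = t" and jt: "card J + 1 = t" and pz: "card {v \<in> Z. Inl v = p} = 1"
    using k cK c1 False rt by linarith+
  obtain pv where pv: "p = Inl pv" "pv \<in> Z"
  proof -
    have "{v \<in> Z. Inl v = p} \<noteq> {}" using pz by (metis card.empty zero_neq_one)
    then show ?thesis using that by blast
  qed
  have Keq: "K = insert pv J" unfolding K_def using pv by auto
  have cA2: "card A = (t - 1) choose (r - 1)" and cB2: "card B = card J" and wD: "w \<in> D"
  proof -
    have "card D \<ge> ((t - 1) choose (r - 1)) + (t - 1) + 1" using D(2) pascal_t(1,2)[OF rt] by linarith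
    then show "card A = (t - 1) choose (r - 1)" "card B = card J"
      using cA cD cB cw kt jt by simp_all
    have "card A \<le> (t - 1) choose (r - 1)" using cA kt by simp
    then have "card ({w} \<inter> D) \<noteq> 0" using \<open>card D \<ge> _\<close> cD cB kt jt by linarith
    then show "w \<in> D" by auto
  qed
  have BU: "B = U" using card_subset_eq[of U B] finJ cB2 card_U unfolding B_def by auto
  have UD: "g \<in> D" "\<not> g \<subseteq> K" if "g \<in> U" for g using that BU unfolding B_def by auto
  have gQ: "Inr g \<in> Q" "Inr g \<noteq> p" if "g \<in> U" for g using that pv cf(4) unfolding U_def by auto
  have gSZ: "g \<subseteq> S \<union> Z" if "g \<in> U" for g using inQ[of g] UD[OF that] gQ[OF that] D by blast
  \<comment> \<open>The hyperedges in \<open>A\<close> are all those possible at \<open>s\<close>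
    within \<open>K\<close>; avoiding \<open>x\<close> would cost at least one of them.\<close>
  have fx: "\<exists>f\<in>A. x \<in> f" if x: "x \<in> K" "x \<noteq> s" for x
  proof (rule ccontr)
    assume n: "\<not> (\<exists>f\<in>A. x \<in> f)"
    have "card A \<le> (card (K - {x}) - 1) choose (r - 1)"
      using finK sJ D rt x n by (intro card_edges_at(1)[where s = s]) (auto simp: A_def K_def)
    moreover have e: "card (K - {x}) - 1 = t - 2" using x finK kt by simp
    ultimately have "card A \<le> (t - 2) choose (r - 1)" by (simp only: e)
    then show False using cA2 pascal_t(3,4)[OF rt] by linarith
  qed
  show ?thesis
  proof (cases "\<exists>g\<in>U. \<exists>z\<in>g. z \<in> S \<and> z \<notin> J")
    case True
    then obtain g z where g: "g \<in> U" "z \<in> g" "z \<in> S" "z \<notin> J" by blast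
    obtain P1 P2 x where dec: "P = P1 @ Inr g # P2" "P1 \<noteq> []" "P2 \<noteq> []" "last P1 = Inl x" "x \<in> g" "g \<in> E" "x \<noteq> s"
      "Inl x \<in> set P" using edge_on_path[OF g(1) gQ(2)[OF g(1)]] by blast
    have "x \<in> K" using setP[OF dec(8)] pv unfolding Keq by auto
    then obtain f where f: "f \<in> A" "x \<in> f" using fx dec by blast
    have fU: "f \<in> D" "f \<notin> U" using f UD unfolding A_def by blast+
    have "f \<noteq> w"
    proof
      assume "f = w"
      then have "D \<subseteq> A \<union> B" using DAB f by blast
      then have "card D \<le> card (A \<union> B)" using fAB by (intro card_mono) auto
      then have "card D \<le> card A + card B" using card_Un_le[of A B] by linarith
      then show False using D(2) cA2 cB2 jt pascal_t(1,2)[OF rt] by linarith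
    qed
    then have "Inr f \<in> R" using cls[OF fU(1)] fU by blast
    then show ?thesis using rotate[OF g(1) gQ(2)[OF g(1)] dec(1-4) fU _ f(2) g(2) dec(6) g(3,4)] jt by fastforce
  next
    case False
    then have gK: "g \<subseteq> J \<union> Z" if "g \<in> U" for g using gSZ[OF that] that by blast
    have exz: "\<exists>z\<in>g. z \<in> Z \<and> z \<noteq> pv" if "g \<in> U" for g using gK[OF that] UD[OF that] unfolding Keq by blast
    obtain P' where P': "P = p # P'" "P' \<noteq> []" "set P' \<subseteq> Q" using split by blast
    have "inc E p (hd P')" using P' dP by (simp add: successively_Cons)
    then obtain g1 where g1: "hd P' = Inr g1" "pv \<in> g1" "g1 \<in> E" using pv inc_InlD by metis
    then have g1U: "g1 \<in> U" using P' hd_in_set[of P'] unfolding U_def by auto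
    obtain z1 where z1: "z1 \<in> g1" "z1 \<in> Z" "z1 \<noteq> pv" using exz g1U by blast
    have z1N: "Inl z1 \<in> nbr Q - {p}" using z1 Z pv by auto
    have g1P: "Inr g1 \<in> set P - {p}" using g1U pv unfolding U_def by simp
    have fl: "\<not> (\<forall>a\<in>set P - {p}. \<forall>y\<in>nbr Q - {p}. \<not> inc E a y)" 
    proof -
      have "inc E (Inr g1) (Inl z1)" using z1 g1 by simp
      then show ?thesis using z1N g1P by blast
    qed
    \<comment> \<open>For \<open>r = t = 3\<close> the first hyperedge would consist of
      \<open>p\<close>, the next vertex and \<open>s\<close>, because every path hyperedge is
      counted at \<open>s\<close>. But no path hyperedge is contained in \<open>K\<close>.\<close>
    have t4: "4 \<le> t"
    proof (rule ccontr)
      assume "\<not> 4 \<le> t"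
      then have rt3: "r = 3" "t = 3" using rt by auto
      obtain P'' where P'': "P' = Inr g1 # P''" using g1 P' by (cases P') auto
      have "P'' \<noteq> []" using P'' lastP P' by auto
      moreover have "inc E (Inr g1) (hd P'')" using dP P' P'' calculation by (auto simp: successively_Cons)
      ultimately obtain x P3 where x: "P'' = Inl x # P3" "x \<in> g1" using inc_InrD by (cases P'') force+
      have "x \<in> J" unfolding J_def using P' P'' x dP pv by auto
      have "x \<noteq> s"
      proof
        assume "x = s"
        then have "P3 = []" using lastP dP unfolding P' P'' x by (cases P3 rule: rev_cases) auto
        then have "set P = {p, Inr g1, Inl x}" using P' P'' x by simp
        then have "U = {g1}" unfolding U_def using pv by auto
        then show False using card_U jt rt3 by simp
      qed
      have "pv \<noteq> x" "pv \<noteq> s" using \<open>x \<in> J\<close> sJ pv unfolding J_def by auto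
      then have "card {pv, x, s} = 3" using \<open>x \<noteq> s\<close> by simp
      moreover have "{pv, x, s} \<subseteq> g1" "card g1 = 3" using g1 x UD(1)[OF g1U] D rt3 by auto
      moreover have "finite g1" using calculation(3) by (intro card_ge_0_finite) simp
      ultimately have "g1 = {pv, x, s}" using card_subset_eq by metis
      then show False using UD(2)[OF g1U] \<open>x \<in> J\<close> sJ unfolding Keq by blast
    qed
    show ?thesis
    proof (cases "3 \<le> M")
      case True
      then show ?thesis using plain fl t4 jt by fastforce
    next
      case False
      have "card {pv, z1} \<le> card Z" using pv z1 finite_ports by (intro card_mono) auto
      then have "2 \<le> card Z" using z1 by simp
      then have cZ: "card Z = 2" "card Yh = 0" using False M unfolding Yh_def by linarith+
      then have Yh0: "Yh = {}" using finJ by simp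
      have Zeq: "Z = {pv, z1}" using card_subset_eq[of Z "{pv, z1}"] finite_ports cZ pv z1 by simp
      have z1g: "z1 \<in> g" if "g \<in> U" for g using exz[OF that] Zeq by auto
      have zQ: "Inl v \<notin> Q" if "v \<in> Z" for v using that Z unfolding nbr_def by blast
      have wSZ: "w \<subseteq> S \<union> Z" using inQ wD wQ D by blast
      \<comment> \<open>Otherwise all counted hyperedges at \<open>s\<close> would lie in
        \<open>t + 1\<close> vertices, so that there would be at most \<open>C(t, r - 1)\<close> of
        them.\<close>
      have "\<not> w \<subseteq> insert z1 K"
      proof
        assume "w \<subseteq> insert z1 K"
        then have "\<And>e. e \<in> D \<Longrightarrow> e \<subseteq> insert z1 K" using cls gK unfolding A_def K_def Zeq pv by blast
        then have "card D \<le> (card (insert z1 K) - 1) choose (r - 1)"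
          using finK sJ D rt by (intro card_edges_at(1)[where s = s]) (auto simp: K_def)
        moreover have "card (insert z1 K) - 1 \<le> t" using kt card_insert_le_m1[of "t + 1" K z1] by (simp add: card_insert_if finK)
        ultimately show False using D(2) choose_mono1[of "card (insert z1 K) - 1" t "r - 1"] by linarith
      qed
      then obtain z where z: "z \<in> w" "z \<notin> J" "z \<notin> Z" unfolding Keq Zeq by blast
      have zS: "z \<in> S" "Inl z \<notin> set P" using z wSZ SP by blast+
      have UK: "g \<subseteq> J \<union> {v. Inl v \<notin> Q}" if "g \<in> U" for g using gK[OF that] zQ by blast
      obtain bs h h' k v where bs: "pth bs" "set bs \<subseteq> Q - set P" "hd bs = Inr h" "last bs = Inr h'" "s \<in> h" "h \<in> E"
         "k \<in> h'" "h' \<in> E" "k \<noteq> s" "Inl k \<in> set P \<or> Inl k \<in> nbr Q" "Inl v \<in> set bs"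
        using bridge[OF Yh0 UK, of w z] wD D wQ z zS by blast
      have bn: "bs \<noteq> []" using bs unfolding pth_def by blast
      have vJ: "v \<notin> J" using bs JQ by blast
      have fin: ?thesis if "opath Q p q xs" "q \<in> nbr Q - {p}" "set P - {p} \<union> set bs \<subseteq> set xs" for q xs
      proof -
        have "Inl ` insert v J \<subseteq> set xs" using that(3) bs(11) unfolding J_def by auto
        then have "card (insert v J) \<le> nv xs" using that(1) unfolding opath_def pth_def by (intro nv_ge) auto
        then have "t \<le> nv xs" using vJ finJ jt by simp
        then show ?thesis using that by blast
      qed
      have Pbs: "set P \<inter> set bs = {}" using bs(2) by blast
      consider "Inl k \<in> nbr Q - {p}" | "Inl k = p" | "k \<in> J" using bs(10) setP by blast
      then show ?thesis
      proof cases
        case 1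
        have "pth (P @ bs)" using cf(2) bs Pbs lastP by (intro pth_append) auto
        then have "opath Q p (Inl k) (P' @ bs)" using P' bs bn by (intro opathI) auto
        then show ?thesis by (rule fin) (use 1 P' in auto)
      next
        case 2
        \<comment> \<open>The bridge is taken from \<open>p\<close> backwards to \<open>s\<close>,
          then the path backwards to its first hyperedge, which contains the port
          \<open>z1\<close>.\<close>
        have "pth P'" using cf(2) P' pth_appendD(2)[of "[p]" P'] by simp
        then have "pth (rev P')" by (rule pth_rev)
        moreover have "inc E (last (rev bs)) (hd (rev P'))"
          using bs D bn P' lastP by (simp add: last_rev hd_rev)
        moreover have "set (rev bs) \<inter> set (rev P') = {}" using Pbs P' by auto
        ultimately have "pth (rev bs @ rev P')" using pth_append[OF pth_rev[OF bs(1)]] by blast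
        then have "pth ([p] @ (rev bs @ rev P'))"
        proof (rule pth_append[rotated])
          show "pth [p]" by (simp add: pth_def)
          show "inc E (last [p]) (hd (rev bs @ rev P'))" using bs bn 2[symmetric] by (simp add: hd_append hd_rev)
          show "set [p] \<inter> set (rev bs @ rev P') = {}" using Pbs P' pQ by auto
        qed
        moreover have "inc E (last (rev bs @ rev P')) (Inl z1)" using P' g1 z1 by (simp add: last_rev)
        ultimately have "opath Q p (Inl z1) (rev bs @ rev P')" using P' bs bn by (intro opathI) auto
        then show ?thesis by (rule fin) (use z1N P' in auto)
      next
        case 3
        then have kP: "Inl k \<in> set P" "Inl k \<noteq> p" unfolding J_def by auto
        \<comment> \<open>The path is cut before \<open>k\<close>. The hyperedge before the cut
          contains \<open>s\<close>, as all hyperedges of the path do; from \<open>s\<close> the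
          bridge leads to \<open>k\<close>, and the rest of the path is traversed forwards up to the
          hyperedge before \<open>s\<close>, which contains the port \<open>z1\<close>.\<close>
        then obtain L1 L2 where L: "P = L1 @ Inl k # L2" by (meson split_list)
        have L1: "L1 \<noteq> []" using L P' kP by auto
        have L2: "L2 \<noteq> []" using L lastP bs(9) by auto
        have pL: "pth (L1 @ (Inl k # L2))" using cf(2) L by simp
        have "inc E (last L1) (Inl k)" using pth_appendD(3)[OF pL] L1 by simp
        then obtain g where g: "last L1 = Inr g" "g \<in> E" using inc_InlD2 by metis
        then have "g \<in> U" using L L1 last_in_set[of L1] unfolding U_def by simp
        then have sg: "s \<in> g" using UD D by blast
        define L3 where "L3 = butlast L2"
        have L2e: "L2 = L3 @ [Inl s]" using L2 L lastP unfolding L3_def by (metis append_butlast_last_id last_ConsR last_appendR list.distinct(1))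
        have pL2: "pth ((Inl k # L3) @ [Inl s])" using pth_appendD(2)[OF pL] L2e by simp
        then have "inc E (last (Inl k # L3)) (Inl s)" using pth_appendD(3)[OF pL2] by simp
        then obtain g' where g': "last (Inl k # L3) = Inr g'" "g' \<in> E" using inc_InlD2 by metis
        then have "Inr g' \<in> set (Inl k # L3)" using last_in_set[of "Inl k # L3"] by (metis list.distinct(1))
        then have "g' \<in> U" using L L2e unfolding U_def by auto
        then have zg': "z1 \<in> g'" using z1g by blast
        have disj: "set L1 \<inter> set (Inl k # L3) = {}" "Inl s \<notin> set L1" "Inl s \<notin> set (Inl k # L3)"
          using dP(1) unfolding L L2e by auto
        have PL: "set P = set L1 \<union> set (Inl k # L3) \<union> {Inl s}" unfolding L L2e by auto
        have "pth (L1 @ [Inl s])" using pth_appendD(1)[OF pL L1] g sg disj by (intro pth_append) (auto simp: pth_def)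
        then have "pth ((L1 @ [Inl s]) @ bs)"
        proof (rule pth_append[OF _ bs(1)])
          show "inc E (last (L1 @ [Inl s])) (hd bs)" using bs by simp
          show "set (L1 @ [Inl s]) \<inter> set bs = {}" using Pbs PL by auto
        qed
        then have "pth (((L1 @ [Inl s]) @ bs) @ (Inl k # L3))"
        proof (rule pth_append)
          show "pth (Inl k # L3)" using pth_appendD(1)[OF pL2] by simp
          show "inc E (last ((L1 @ [Inl s]) @ bs)) (hd (Inl k # L3))" using bs bn by simp
          show "set ((L1 @ [Inl s]) @ bs) \<inter> set (Inl k # L3) = {}" using Pbs PL disj by auto
        qed
        moreover obtain L1' where L1': "L1 = p # L1'" using L P' L1 by (cases L1) auto
        ultimately have pp: "pth (p # (L1' @ Inl s # bs @ Inl k # L3))" by simp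
        have "opath Q p (Inl z1) (L1' @ Inl s # bs @ Inl k # L3)"
        proof (rule opathI[OF pp])
          have "set L1' \<union> set (Inl k # L3) \<union> {Inl s} \<subseteq> set P'" using PL P' L1' pp unfolding pth_def by auto
          then show "set (L1' @ Inl s # bs @ Inl k # L3) \<subseteq> Q" using P' bs by auto
          show "inc E (last (L1' @ Inl s # bs @ Inl k # L3)) (Inl z1)" using g' zg' by simp
        qed simp
        then show ?thesis by (rule fin) (use z1N PL L1' in auto)
      qed
    qed
  qed
qed

end

section \<open>The two alternatives for paths between ports\<close>

context ports
begin

lemma cfg_end:
  assumes "term_cfg Q p (Inl ` S) P R T"
  shows "\<exists>s. ports_cfg E Q S Z F r t M p P R T s"
proof -
  have "last P \<in> Inl ` S" using cfgD(7)[OF assms] by blast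
  then show ?thesis using assms ports_axioms
    unfolding ports_cfg_def ports_cfg_axioms_def by auto
qed

lemma cfg_cases:
  assumes "term_cfg Q p (Inl ` S) P R T"
  obtains "T = nbr Q - {p}" | w where "T = {Inl w}" "T \<noteq> nbr Q - {p}" | w where "T = {Inr w}" "T \<noteq> nbr Q - {p}"
proof (cases "T = nbr Q - {p}")
  case False
  then obtain w where "T = {w}" using cfgD(11)[OF assms] by blast
  then show ?thesis using that False by (cases w) auto
qed (use that in blast)

text \<open>If the process cannot be started at every port with the others as exits,
  \<open>term_initial\<close> gives a configuration with a single-node exit. Its path touches no
  other port, so the defective alternative of \<open>beta_edge\<close> is impossible and
  \<open>t\<close> vertices are reached.\<close>

lemma initial_or_not:
  "(\<exists>p\<in>nbr Q. \<exists>q\<in>nbr Q - {p}. \<exists>xs. opath Q p q xs \<and> t \<le> nv xs) \<or>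
   (\<forall>p\<in>nbr Q. \<exists>P R T. term_cfg Q p (Inl ` S) P R T)"
proof (cases "\<exists>p0 s0 w0. p0 \<in> nbr Q \<and> s0 \<in> Inl ` S \<and> s0 \<noteq> w0 \<and> \<not> tch (Q - {w0}) s0 (nbr Q - {p0})")
  case True
  then obtain p0 s0 w0 where i: "p0 \<in> nbr Q" "s0 \<in> Inl ` S" "s0 \<noteq> w0" "\<not> tch (Q - {w0}) s0 (nbr Q - {p0})" by blast
  have "\<exists>p P R w. w \<in> Q \<and> term_cfg Q p (Inl ` S) P R {w} \<and> (\<forall>a\<in>set P - {p}. \<forall>y\<in>nbr Q - {p}. \<not> inc E a y)"
    by (rule term_initial[OF finQ cQ S(1) two _ i]) (use H2 in auto)
  then obtain p P R w where w: "w \<in> Q" and cfg: "term_cfg Q p (Inl ` S) P R {w}"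
    and fl: "\<forall>a\<in>set P - {p}. \<forall>y\<in>nbr Q - {p}. \<not> inc E a y" by blast
  obtain s where "ports_cfg E Q S Z F r t M p P R {w} s" using cfg_end[OF cfg] by blast
  then interpret c: ports_cfg E Q S Z F r t M p P R "{w}" s .
  have p: "p \<in> nbr Q" using c.cf(1) .
  have ne: "{w} \<noteq> nbr Q - {p}" using w unfolding nbr_def by blast
  have "\<exists>q\<in>nbr Q - {p}. \<exists>xs. opath Q p q xs \<and> t \<le> nv xs"
  proof (cases w)
    case (Inl v)
    then show ?thesis using c.beta_vertex ne by blast
  next
    case (Inr e)
    then show ?thesis using c.beta_edge[of e] ne fl by blast
  qed
  then show ?thesis using p by blast
next
  case False
  then have "\<exists>P R T. term_cfg Q p (Inl ` S) P R T" if "p \<in> nbr Q" for p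
    using that S by (intro term_noninitial[OF finQ cQ that S(1)]) blast+
  then show ?thesis by blast
qed

text \<open>A path with \<open>t\<close> vertices may be known for one pair of ports only; this is
  enough, because two copies of it close up on the same pair. The weaker bound is given at every
  port, so that the pairs of two special paths can be chosen different.\<close>

theorem long_port_path:
  "(\<exists>p\<in>nbr Q. \<exists>q\<in>nbr Q - {p}. \<exists>xs. opath Q p q xs \<and> t \<le> nv xs) \<or>
   (\<forall>p\<in>nbr Q. \<exists>q\<in>nbr Q - {p}. \<exists>xs. opath Q p q xs \<and> 1 \<le> nv xs \<and> t + 2 \<le> nv xs + M)"
proof -
  have "\<exists>q\<in>nbr Q - {p}. \<exists>xs. opath Q p q xs \<and> 1 \<le> nv xs \<and> t + 2 \<le> nv xs + M"
    if cfg: "term_cfg Q p (Inl ` S) P R T" for p P R T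
  proof -
    obtain s where "ports_cfg E Q S Z F r t M p P R T s" using cfg_end[OF cfg] by blast
    then interpret c: ports_cfg E Q S Z F r t M p P R T s .
    show ?thesis using cfg
    proof (cases rule: cfg_cases)
      case 1
      then show ?thesis by (rule c.alpha)
    next
      case (2 w)
      then obtain q xs where "q \<in> nbr Q - {p}" "opath Q p q xs" "t \<le> nv xs" using c.beta_vertex by blast
      moreover have "1 \<le> nv xs" "t + 2 \<le> nv xs + M" using calculation(3) M rt by linarith+
      ultimately show ?thesis by blast
    next
      case (3 w)
      then obtain q xs where "q \<in> nbr Q - {p}" "opath Q p q xs" "t \<le> nv xs \<or> (t \<le> nv xs + 1 \<and> 3 \<le> M \<and> 4 \<le> t)"
        using c.beta_edge by blast
      moreover have "1 \<le> nv xs" "t + 2 \<le> nv xs + M" using calculation(3) M rt by linarith+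
      ultimately show ?thesis by blast
    qed
  qed
  then show ?thesis using initial_or_not by blast
qed

end

section \<open>Bounded paths and many components\<close>

lemma pigeonhole_fibre:
  assumes "finite A" "finite B" "f ` A \<subseteq> B" "card B * m < card A"
  shows "\<exists>b\<in>B. m < card {a \<in> A. f a = b}"
proof (rule ccontr)
  assume "\<not> ?thesis"
  then have le: "\<And>b. b \<in> B \<Longrightarrow> card {a \<in> A. f a = b} \<le> m" by (meson not_le)
  have "A = (\<Union>b\<in>B. {a \<in> A. f a = b})" using assms by auto
  then have "card A \<le> (\<Sum>b\<in>B. card {a \<in> A. f a = b})" using card_UN_le[OF assms(2)] by metis
  also have "\<dots> \<le> (\<Sum>b\<in>B. m)" using le by (rule sum_mono)
  finally show False using assms by simp
qed

section \<open>Cycles through the ends of a path and the length of paths\<close>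

context ugraph
begin

lemma tch_monoT: "tch U x T \<Longrightarrow> T \<subseteq> T' \<Longrightarrow> tch U x T'"
  unfolding tch_def by blast

lemma cyc_rotate: "cyc (xs @ ys) \<Longrightarrow> cyc (ys @ xs)"
  unfolding cyc_def
  by (cases "xs = []"; cases "ys = []") (auto simp: successively_append_iff)

lemma cyc_rev_Cons:
  assumes "cyc (b # ys)"
  shows "cyc (b # rev ys)"
proof -
  have "cyc (rev (b # ys))" using assms unfolding cyc_def
    by (simp only: length_rev distinct_rev successively_rev adj_commute hd_rev last_rev)
  then have "cyc (rev ys @ [b])" by simp
  then show ?thesis using cyc_rotate[of "rev ys" "[b]"] by simp
qed

lemma cyc_start:
  assumes "cyc c" "b \<in> set c"
  shows "\<exists>ys. cyc (b # ys) \<and> set (b # ys) = set c"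
proof -
  obtain xs zs where c: "c = xs @ b # zs" using assms(2) by (meson split_list)
  then have "cyc ((b # zs) @ xs)" using assms(1) cyc_rotate by blast
  then show ?thesis using c by (intro exI[of _ "zs @ xs"]) auto
qed

lemma cyc_ear:
  assumes "cyc (b # y1 @ b' # y2)" "pth us" "set us \<inter> set (b # y1 @ b' # y2) = {}" "adj b (hd us)" "adj (last us) b'"
  shows "cyc (b # us @ b' # y2)"
proof -
  have us: "us \<noteq> []" using assms(2) unfolding pth_def by blast
  have s: "successively adj (b' # y2)" using assms(1) unfolding cyc_def
    by (metis append_Cons successively_append_iff)
  have "successively adj (b # us @ b' # y2)"
    using assms us s unfolding pth_def by (auto simp: successively_append_iff successively_Cons)
  moreover have "distinct (b # us @ b' # y2)" using assms us unfolding pth_def cyc_def by auto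
  moreover have "3 \<le> length (b # us @ b' # y2)" using us by (cases us) auto
  moreover have "adj (last (b # us @ b' # y2)) b" using assms(1) unfolding cyc_def by (cases y2) auto
  ultimately show ?thesis unfolding cyc_def by simp
qed

text \<open>A walk from \<open>x\<close> to \<open>a\<close> that avoids \<open>b\<close> first
  meets the cycle in some \<open>b'\<close> other than \<open>b\<close>. Going from \<open>b\<close>
  through \<open>x\<close> to \<open>b'\<close> replaces the arc between \<open>b\<close> and
  \<open>b'\<close> that does not contain \<open>a\<close>.\<close>

lemma cyc_extend:
  assumes c: "cyc c" "a \<in> set c" "b \<in> set c" "a \<noteq> b" and x: "adj b x" "x \<notin> set c" "reach (U - {b}) x a"
  shows "\<exists>c'. cyc c' \<and> a \<in> set c' \<and> x \<in> set c'"
proof -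
  let ?C = "comp_of (U - {b} - set c) x"
  have xU: "x \<in> U - {b} - set c" using x(2) reach_in[OF x(3)] by simp
  have "x \<in> ?C" by (rule comp_of_self[OF xU])
  moreover have "a \<notin> ?C" using comp_of_sub[of "U - {b} - set c" x] c(2) by blast
  ultimately obtain a' b' where ab: "a' \<in> ?C" "b' \<in> U - {b} - ?C" "adj a' b'"
    using reach_exit[OF x(3)] by blast
  then have b': "b' \<in> set c" "b' \<noteq> b" using comp_of_closed[OF ab(1,3)] by blast+
  obtain us where us: "pth us" "hd us = x" "last us = a'" "set us \<subseteq> U - {b} - set c"
    using ab reach_path unfolding comp_of_def by blast
  have main: "\<exists>c'. cyc c' \<and> a \<in> set c' \<and> x \<in> set c'"
    if d: "cyc (b # y1 @ b' # y2)" "set (b # y1 @ b' # y2) = set c" "a \<in> set (b' # y2)" for y1 y2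
  proof -
    have "set us \<inter> set (b # y1 @ b' # y2) = {}" using us(4) d(2) by blast
    then have "cyc (b # us @ b' # y2)" using cyc_ear[OF d(1) us(1)] us(2,3) ab(3) x(1) by simp
    moreover have "x \<in> set us" using us unfolding pth_def by (metis hd_in_set)
    ultimately show ?thesis using d(3) by (intro exI[of _ "b # us @ b' # y2"]) auto
  qed
  obtain ys where ys: "cyc (b # ys)" "set (b # ys) = set c" using cyc_start c by blast
  then have "b' \<in> set ys" using b' by auto
  then obtain y1 y2 where y: "ys = y1 @ b' # y2" by (meson split_list)
  show ?thesis
  proof (cases "a \<in> set (b' # y2)")
    case True
    then show ?thesis using main[of y1 y2] ys y by simp
  next
    case False
    then have "a \<in> set y1" using ys(2) c(2,4) y by auto
    moreover have "cyc (b # rev y2 @ b' # rev y1)" using cyc_rev_Cons[OF ys(1)] y by simp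
    moreover have "set (b # rev y2 @ b' # rev y1) = set c" using ys(2) y by auto
    ultimately show ?thesis using main[of "rev y2" "rev y1"] by simp
  qed
qed

text \<open>Induction along the path: a cycle through the first node and the last but one is changed
  by \<open>cyc_extend\<close> into one through the first and the last node. The base case closes a
  path of three nodes by a detour around its middle.\<close>

lemma path_ends_on_cycle:
  assumes conn: "\<And>w x y. x \<in> N - {w} \<Longrightarrow> y \<in> N - {w} \<Longrightarrow> reach (N - {w}) x y"
    and P: "pth P" "set P \<subseteq> N" "3 \<le> length P"
  shows "\<exists>c. cyc c \<and> hd P \<in> set c \<and> last P \<in> set c"
  using P
proof (induction P rule: rev_induct)
  case (snoc x P0)
  have P0: "P0 \<noteq> []" using snoc.prems by auto
  define a b where "a = hd P0" and "b = last P0"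
  have p0: "pth P0" and bx: "adj b x" and xP: "x \<notin> set P0"
    using pth_appendD[OF snoc.prems(1)] P0 unfolding b_def by auto
  have ab: "a \<in> set P0" "b \<in> set P0" "a \<noteq> b"
  proof -
    show "a \<in> set P0" "b \<in> set P0" unfolding a_def b_def using P0 by auto
    obtain u v ws where "P0 = u # v # ws" using snoc.prems(3) by (cases P0; cases "tl P0") auto
    then show "a \<noteq> b" using p0 unfolding a_def b_def pth_def by auto
  qed
  have r: "reach (N - {b}) x a" using conn[of x b a] ab xP snoc.prems(2) by auto
  have ends: "hd (P0 @ [x]) = a" "last (P0 @ [x]) = x" using P0 unfolding a_def by auto
  show ?case
  proof (cases "3 \<le> length P0")
    case True
    then obtain c where c: "cyc c" "a \<in> set c" "b \<in> set c"
      using snoc.IH[OF p0] snoc.prems unfolding a_def b_def by auto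
    show ?thesis
    proof (cases "x \<in> set c")
      case True
      then show ?thesis using c ends by auto
    next
      case False
      then show ?thesis using cyc_extend[OF c ab(3) bx _ r] ends by auto
    qed
  next
    case False
    then have "length P0 = 2" using snoc.prems(3) by auto
    then have P0e: "P0 = [a, b]" unfolding a_def b_def by (cases P0; cases "tl P0") auto
    then have "adj a b" using p0 unfolding pth_def by auto
    obtain us where us: "pth us" "hd us = x" "last us = a" "set us \<subseteq> N - {b}" using reach_path[OF r] by blast
    have un: "us \<noteq> []" using us unfolding pth_def by blast
    have "2 \<le> length us" using us un ab xP by (cases us; cases "tl us") auto
    then have "cyc (b # us)" using us un bx \<open>adj a b\<close> unfolding cyc_def pth_def by (auto simp: successively_Cons)
    moreover have "a \<in> set us" "x \<in> set us" using us un by (metis last_in_set, metis hd_in_set)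
    ultimately show ?thesis using ends by (intro exI[of _ "b # us"]) auto
  qed
qed simp

lemma gaps_bound:
  assumes "xs \<noteq> []" "hd xs \<in> C" "last xs \<in> C"
    "\<And>ys u zs v ws. xs = ys @ u # zs @ v # ws \<Longrightarrow> u \<in> C \<Longrightarrow> v \<in> C \<Longrightarrow> set zs \<inter> C = {} \<Longrightarrow> Suc (length zs) \<le> g" "1 \<le> g"
  shows "length xs \<le> g * length (filter (\<lambda>x. x \<in> C) xs)"
  using assms
proof (induction "length xs" arbitrary: xs rule: less_induct)
  case less
  obtain u rest where xs: "xs = u # rest" using less.prems by (cases xs) auto
  define zs where "zs = takeWhile (\<lambda>x. x \<notin> C) rest"
  define ws where "ws = dropWhile (\<lambda>x. x \<notin> C) rest"
  have rest: "rest = zs @ ws" unfolding zs_def ws_def by simp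
  have zC: "set zs \<inter> C = {}" unfolding zs_def by (auto dest: set_takeWhileD)
  then have fz: "filter (\<lambda>x. x \<in> C) zs = []" by (auto simp: filter_empty_conv)
  have u: "u \<in> C" using less.prems xs by simp
  show ?case
  proof (cases ws)
    case Nil
    then have "zs = []"
      using less.prems(3) xs rest zC by (metis IntI append_Nil2 emptyE last_ConsR last_in_set)
    then show ?thesis using xs rest Nil u less.prems(5) by simp
  next
    case (Cons v ws')
    have v: "v \<in> C" using Cons unfolding ws_def by (metis hd_dropWhile list.distinct(1) list.sel(1))
    have "Suc (length zs) \<le> g" using less.prems(4)[of "[]" u zs v ws'] xs rest Cons u v zC by simp
    moreover have "length ws \<le> g * length (filter (\<lambda>x. x \<in> C) ws)"
    proof (rule less.hyps)
      show "length ws < length xs" using xs rest by simp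
      show "ws \<noteq> []" "hd ws \<in> C" using Cons v by auto
      show "last ws \<in> C" using less.prems(3) xs rest Cons by simp
      show "Suc (length zs') \<le> g" if "ws = ys @ u' # zs' @ v' # ws''" "u' \<in> C" "v' \<in> C" "set zs' \<inter> C = {}" for ys u' zs' v' ws''
        using less.prems(4)[of "u # zs @ ys" u' zs' v' ws''] that xs rest by simp
    qed fact
    ultimately show ?thesis using xs rest fz u by simp
  qed
qed

text \<open>A cycle through both ends of \<open>P\<close> has fewer than \<open>2 k\<close> nodes,
  so \<open>P\<close> meets it fewer than \<open>2 k\<close> times. Between two consecutive meetings
  \<open>P\<close> is an ear, which closes with an arc to another cycle and is therefore shorter
  than \<open>2 k\<close> as well. The summand 2 covers paths with fewer than three nodes, for which
  no cycle through the ends is available.\<close>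

lemma path_length_bound:
  assumes conn: "\<And>w x y. x \<in> N - {w} \<Longrightarrow> y \<in> N - {w} \<Longrightarrow> reach (N - {w}) x y"
    and cyc: "\<And>c. cyc c \<Longrightarrow> length c < 2 * k" and P: "pth P" "set P \<subseteq> N"
  shows "length P \<le> 4 * k * k + 2"
proof (cases "3 \<le> length P")
  case True
  obtain c where c: "cyc c" "hd P \<in> set c" "last P \<in> set c" using path_ends_on_cycle[OF conn P True] by blast
  have k: "2 \<le> 2 * k" using cyc[OF c(1)] by simp
  have Pn: "P \<noteq> []" using P unfolding pth_def by blast
  have "length P \<le> (2 * k) * length (filter (\<lambda>x. x \<in> set c) P)"
  proof (rule gaps_bound[OF Pn c(2,3)])
    fix ys u zs v ws assume d: "P = ys @ u # zs @ v # ws" "u \<in> set c" "v \<in> set c" "set zs \<inter> set c = {}"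
    show "Suc (length zs) \<le> 2 * k"
    proof (cases "zs = []")
      case False
      have uv: "u \<noteq> v" using P d unfolding pth_def by auto
      obtain es where es: "cyc (u # es)" "set (u # es) = set c" using cyc_start c d by blast
      then have "v \<in> set es" using d uv by auto
      then obtain e1 e2 where e: "es = e1 @ v # e2" by (meson split_list)
      have "pth zs" "adj u (hd zs)" "adj (last zs) v"
        using P(1) False unfolding d(1) pth_def by (auto simp: successively_append_iff successively_Cons)
      moreover have se: "set (u # e1 @ v # e2) = set c" using es(2) e by simp
      moreover have "set zs \<inter> set (u # e1 @ v # e2) = {}" unfolding se by (rule d(4))
      ultimately have "cyc (u # zs @ v # e2)" using cyc_ear[of u e1 v e2 zs] es(1) e by blast
      then show ?thesis using cyc by fastforce
    qed (use k in simp)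
  qed (use k in simp)
  also have "length (filter (\<lambda>x. x \<in> set c) P) \<le> length c"
  proof -
    have "length (filter (\<lambda>x. x \<in> set c) P) = card (set (filter (\<lambda>x. x \<in> set c) P))"
      using P unfolding pth_def by (metis distinct_card distinct_filter)
    also have "\<dots> \<le> card (set c)" by (intro card_mono) auto
    finally show ?thesis using card_length le_trans by blast
  qed
  also have "length c \<le> 2 * k" using cyc c by fastforce
  finally show ?thesis by (simp add: mult_le_mono)
qed simp

end

text \<open>The recursion is the count behind the pigeonhole: if every component holds fewer than
  the previous value, there must be more than \<open>m\<close> components for each of the
  \<open>2 ^ (L + 1)\<close> possible neighbourhoods in a path of \<open>L + 1\<close> nodes. The
  summand 2 pays for the node added to the path and for strictness.\<close>

fun many_bound :: "nat \<Rightarrow> nat \<Rightarrow> nat \<Rightarrow> nat" where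
  "many_bound L m 0 = 1"
| "many_bound L m (Suc n) = many_bound L m n * (m * 2 ^ (L + 1)) + 2"

section \<open>Many components with the same neighbourhood\<close>

context ugraph
begin

text \<open>Grow a path greedily: either some component beyond its end is still rich in \<open>C\<close>, or there are many
  components, and by pigeonhole many of them have the same neighbourhood in the path.\<close>

lemma many_components_aux:
  assumes fin: "finite N" and L: "\<And>P. pth P \<Longrightarrow> set P \<subseteq> N \<Longrightarrow> length P \<le> L"
    and v: "v \<noteq> [] \<Longrightarrow> pth v \<and> (\<exists>a\<in>Z. adj (last v) a)" "set v \<subseteq> N" "length v + n = L + 1"
    and Z: "conn Z" "Z \<subseteq> N - set v" "nbr Z \<subseteq> set v" "many_bound L m n \<le> card (C \<inter> Z)"
  shows "\<exists>Y \<Q>. card Y \<le> L + 1 \<and> Y \<subseteq> N \<and> finite \<Q> \<and> m \<le> card \<Q> \<and> (\<forall>Q\<in>\<Q>. conn Q \<and> Q \<subseteq> N \<and> C \<inter> Q \<noteq> {} \<and> nbr Q = Y) \<and>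
     (\<forall>Q\<in>\<Q>. \<forall>Q'\<in>\<Q>. Q \<noteq> Q' \<longrightarrow> Q \<inter> Q' = {})"
  using v Z
proof (induction n arbitrary: v Z)
  case 0
  then have "length v = L + 1" by simp
  moreover have "pth v" using 0 \<open>length v = L + 1\<close> by (cases v) auto
  ultimately show ?case using L[of v] 0 by simp
next
  case (Suc n)
  have Zne: "C \<inter> Z \<noteq> {}"
  proof
    assume "C \<inter> Z = {}"
    then show False using Suc.prems(7) by simp
  qed
  obtain a where a: "a \<in> Z" "v \<noteq> [] \<Longrightarrow> adj (last v) a"
    using Suc.prems(1) Zne by (cases "v = []") auto
  have av: "a \<notin> set v" "a \<in> N" using a Suc.prems(5) by auto
  have fZ: "finite Z" using Suc.prems(5) fin by (meson finite_Diff finite_subset)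
  have pv: "pth (v @ [a])"
  proof (cases "v = []")
    case False
    then show ?thesis using Suc.prems(1) a av by (intro pth_append) (auto simp: pth_def)
  qed (simp add: pth_def)
  define \<K> where "\<K> = comp_of (Z - {a}) ` (C \<inter> Z - {a})"
  have fK: "finite \<K>" unfolding \<K>_def using fZ by simp
  have K: "conn Q" "Q \<subseteq> Z - {a}" "nbr Q \<subseteq> set (v @ [a])" "C \<inter> Q \<noteq> {}" "\<exists>b\<in>Q. adj a b" if Q: "Q \<in> \<K>" for Q
  proof -
    obtain x where x: "x \<in> C \<inter> Z - {a}" "Q = comp_of (Z - {a}) x" using Q unfolding \<K>_def by blast
    show "conn Q" using x conn_comp_of by blast
    show sub: "Q \<subseteq> Z - {a}" using x comp_of_sub by blast
    have xQ: "x \<in> Q" using x comp_of_self[of x "Z - {a}"] by blast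
    then show "C \<inter> Q \<noteq> {}" using x by blast
    show "nbr Q \<subseteq> set (v @ [a])"
    proof
      fix b assume "b \<in> nbr Q"
      then obtain a' where a': "a' \<in> Q" "adj a' b" "b \<notin> Q" unfolding nbr_def by blast
      show "b \<in> set (v @ [a])"
      proof (cases "b \<in> Z")
        case True
        then have "b = a" using a' comp_of_closed[of a' "Z - {a}" x b] x by blast
        then show ?thesis by simp
      next
        case False
        then have "b \<in> nbr Z" using a' sub unfolding nbr_def by blast
        then show ?thesis using Suc.prems(6) by auto
      qed
    qed
    have "reach Z x a" using Suc.prems(4) x a unfolding conn_def by blast
    moreover have "a \<notin> Q" using sub by blast
    ultimately obtain b c where bc: "b \<in> Q" "c \<in> Z - Q" "adj b c" using reach_exit xQ by meson
    then have "c = a" using comp_of_closed[of b "Z - {a}" x c] x by blast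
    then show "\<exists>b\<in>Q. adj a b" using bc adj_sym by blast
  qed
  show ?case
  proof (cases "\<exists>Q\<in>\<K>. many_bound L m n \<le> card (C \<inter> Q)")
    case True
    then obtain Q where Q: "Q \<in> \<K>" "many_bound L m n \<le> card (C \<inter> Q)" by blast
    show ?thesis
    proof (rule Suc.IH[of "v @ [a]" Q])
      show "pth (v @ [a]) \<and> (\<exists>b\<in>Q. adj (last (v @ [a])) b)" using pv K(5)[OF Q(1)] by simp
      show "set (v @ [a]) \<subseteq> N" using Suc.prems(2) av by simp
      show "length (v @ [a]) + n = L + 1" using Suc.prems(3) by simp
      show "Q \<subseteq> N - set (v @ [a])" using K(2)[OF Q(1)] Suc.prems(5) by auto
    qed (use K[OF Q(1)] Q in blast)+
  next
    case False
    let ?g = "many_bound L m n"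
    have cov: "C \<inter> Z - {a} \<subseteq> (\<Union>Q\<in>\<K>. C \<inter> Q)"
    proof
      fix x assume x: "x \<in> C \<inter> Z - {a}"
      then have "x \<in> comp_of (Z - {a}) x" using comp_of_self[of x "Z - {a}"] by blast
      then show "x \<in> (\<Union>Q\<in>\<K>. C \<inter> Q)" using x unfolding \<K>_def by blast
    qed
    have fin2: "finite (\<Union>Q\<in>\<K>. C \<inter> Q)" using fK K(2) fZ by (meson finite_Diff finite_Int finite_UN finite_subset)
    have "card (C \<inter> Z) - 1 \<le> card (C \<inter> Z - {a})" using fZ by (simp add: card_Diff_singleton_if)
    also have "\<dots> \<le> card (\<Union>Q\<in>\<K>. C \<inter> Q)" using cov fin2 by (rule card_mono[rotated])
    also have "\<dots> \<le> (\<Sum>Q\<in>\<K>. card (C \<inter> Q))" using fK by (rule card_UN_le)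
    also have "\<dots> \<le> (\<Sum>Q\<in>\<K>. ?g)" using False by (intro sum_mono) (meson linear)
    also have "\<dots> = card \<K> * ?g" by simp
    finally have le: "card (C \<inter> Z) - 1 \<le> card \<K> * ?g" .
    have "?g * (m * 2 ^ (L + 1)) < card \<K> * ?g" using le Suc.prems(7) unfolding many_bound.simps by linarith
    then have "m * 2 ^ (L + 1) < card \<K>" by (simp add: mult.commute)
    moreover have "card (Pow (set (v @ [a]))) \<le> 2 ^ (L + 1)"
    proof -
      have "card (set (v @ [a])) \<le> L + 1" using card_length[of "v @ [a]"] Suc.prems(3) by simp
      then show ?thesis unfolding card_Pow[OF List.finite_set] by (rule power_increasing) simp
    qed
    ultimately have "card (Pow (set (v @ [a]))) * m < card \<K>"
      by (metis (no_types, lifting) le_less_trans mult.commute mult_le_mono2)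
    then obtain Y where Y: "Y \<in> Pow (set (v @ [a]))" "m < card {Q \<in> \<K>. nbr Q = Y}"
      using pigeonhole_fibre[of \<K> "Pow (set (v @ [a]))" nbr m] fK K(3) by (auto simp del: set_append)
    have "card Y \<le> card (set (v @ [a]))" using Y by (intro card_mono) auto
    also have "\<dots> \<le> L + 1" using card_length[of "v @ [a]"] Suc.prems(3) by simp
    finally have "card Y \<le> L + 1" .
    moreover have "Y \<subseteq> N" using Y Suc.prems(2) av by auto
    moreover have "Q \<inter> Q' = {}" if Q: "Q \<in> \<K>" "Q' \<in> \<K>" "Q \<noteq> Q'" for Q Q'
    proof (rule ccontr)
      assume "Q \<inter> Q' \<noteq> {}"
      then obtain y where y: "y \<in> Q" "y \<in> Q'" by blast
      obtain x x' where x: "Q = comp_of (Z - {a}) x" "Q' = comp_of (Z - {a}) x'" using Q unfolding \<K>_def by blast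
      have "reach (Z - {a}) x y" "reach (Z - {a}) x' y" using y x unfolding comp_of_def by auto
      then have "Q = Q'" unfolding x comp_of_def using reach_trans reach_sym by blast
      then show False using Q by blast
    qed
    ultimately show ?thesis
    proof (intro exI[of _ Y] exI[of _ "{Q \<in> \<K>. nbr Q = Y}"] conjI ballI impI)
      show "finite {Q \<in> \<K>. nbr Q = Y}" using fK by simp
      show "m \<le> card {Q \<in> \<K>. nbr Q = Y}" using Y by simp
      fix Q assume Q: "Q \<in> {Q \<in> \<K>. nbr Q = Y}"
      then have QK: "Q \<in> \<K>" by blast
      show "conn Q" "C \<inter> Q \<noteq> {}" by (rule K(1)[OF QK], rule K(4)[OF QK])
      show "Q \<subseteq> N" using K(2)[OF QK] Suc.prems(5) by blast
      show "nbr Q = Y" using Q by blast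
    qed blast+
  qed
qed

lemma many_components:
  assumes fin: "finite N" and L: "\<And>P. pth P \<Longrightarrow> set P \<subseteq> N \<Longrightarrow> length P \<le> L"
    and N: "conn N" "nbr N = {}" "many_bound L m (L + 1) \<le> card (C \<inter> N)"
  shows "\<exists>Y \<Q>. card Y \<le> L + 1 \<and> Y \<subseteq> N \<and> finite \<Q> \<and> m \<le> card \<Q> \<and> (\<forall>Q\<in>\<Q>. conn Q \<and> Q \<subseteq> N \<and> C \<inter> Q \<noteq> {} \<and> nbr Q = Y) \<and>
     (\<forall>Q\<in>\<Q>. \<forall>Q'\<in>\<Q>. Q \<noteq> Q' \<longrightarrow> Q \<inter> Q' = {})"
  by (rule many_components_aux[OF fin L, of "[]" N "L + 1"]) (use N in auto)

text \<open>A closed walk is stored as a list of segments, each a port followed by a path that leads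
  to the port of the next segment. The last path ends next to \<open>z\<close>; with the first port
  as \<open>z\<close> the walk is closed.\<close>

fun linked :: "('n \<times> 'n list) list \<Rightarrow> 'n \<Rightarrow> bool" where
  "linked [] z = True"
| "linked (s # rest) z = (pth (snd s) \<and> adj (fst s) (hd (snd s)) \<and>
     adj (last (snd s)) (if rest = [] then z else fst (hd rest)) \<and> linked rest z)"

definition flat :: "('n \<times> 'n list) list \<Rightarrow> 'n list" where
  "flat segs = concat (map (\<lambda>s. fst s # snd s) segs)"

lemma flat_simps [simp]: "flat [] = []" "flat (s # segs) = fst s # snd s @ flat segs"
  "flat (segs @ segs') = flat segs @ flat segs'"
  unfolding flat_def by auto

lemma set_flat: "set (flat segs) = fst ` set segs \<union> set (concat (map snd segs))"
  by (induction segs) auto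

lemma linked_append:
  "linked (s1 @ s2) z \<longleftrightarrow> linked s1 (if s2 = [] then z else fst (hd s2)) \<and> linked s2 z"
  by (induction s1) auto

lemma linked_flat:
  assumes "linked segs z" "segs \<noteq> []"
  shows "successively adj (flat segs) \<and> adj (last (flat segs)) z \<and> hd (flat segs) = fst (hd segs) \<and> 2 * length segs \<le> length (flat segs)"
  using assms
proof (induction segs)
  case (Cons s rest)
  have p: "snd s \<noteq> []" "successively adj (snd s)" "adj (fst s) (hd (snd s))"
    using Cons.prems by (auto simp: pth_def)
  then have l: "1 \<le> length (snd s)" by (cases "snd s") auto
  have s1: "successively adj (fst s # snd s)" using p by (simp add: successively_Cons)
  show ?case
  proof (cases "rest = []")
    case True
    then show ?thesis using Cons.prems s1 p l by auto
  next
    case False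
    then have IH: "successively adj (flat rest)" "adj (last (flat rest)) z" "hd (flat rest) = fst (hd rest)"
      "2 * length rest \<le> length (flat rest)" using Cons by auto
    have fr: "flat rest \<noteq> []" using IH(4) False by auto
    have "adj (last (snd s)) (hd (flat rest))" using Cons.prems False IH(3) by simp
    then have "successively adj ((fst s # snd s) @ flat rest)"
      using s1 IH(1) p fr by (simp only: successively_append_iff) auto
    then show ?thesis using IH fr p l by auto
  qed
qed simp

lemma linked_cyc:
  assumes "linked segs (fst (hd segs))" "2 \<le> length segs" "distinct (flat segs)"
  shows "cyc (flat segs)"
proof -
  have "segs \<noteq> []" using assms by auto
  then show ?thesis using linked_flat[OF assms(1)] assms unfolding cyc_def by auto
qed

lemma opath_linked: "opath X p q xs \<Longrightarrow> pth xs \<and> adj p (hd xs) \<and> adj (last xs) q \<and> set xs \<subseteq> X \<and> distinct xs \<and> xs \<noteq> []"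
  unfolding opath_def pth_def by blast

end

section \<open>Cycles through a common neighbourhood\<close>

context hgraph
begin

lemma nv_flat: "nv (flat segs) = nv (map fst segs) + nv (concat (map snd segs))"
  by (induction segs) (auto simp: nv_def)

text \<open>Every consecutive pair of ports is joined through a member of the family of its own. A
  relation \<open>R\<close> is allowed instead of mere distinctness, because in the stars of a link
  only certain pairs can be joined.\<close>

lemma fill_rel:
  assumes "finite \<Q>" "length ys \<le> card \<Q>" "\<And>Q Q'. Q \<in> \<Q> \<Longrightarrow> Q' \<in> \<Q> \<Longrightarrow> Q \<noteq> Q' \<Longrightarrow> Q \<inter> Q' = {}"
    and "successively R (ys @ [z])"
    and "\<And>Q y y'. Q \<in> \<Q> \<Longrightarrow> R y y' \<Longrightarrow> \<exists>xs. opath Q y y' xs \<and> 1 \<le> nv xs"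
  shows "\<exists>segs. map fst segs = ys \<and> linked segs z \<and> distinct (concat (map snd segs)) \<and>
     set (concat (map snd segs)) \<subseteq> \<Union>\<Q> \<and> length ys \<le> nv (concat (map snd segs))"
  using assms
proof (induction ys arbitrary: \<Q>)
  case Nil
  then show ?case by (intro exI[of _ "[]"]) auto
next
  case (Cons y ys)
  then obtain Q where Q: "Q \<in> \<Q>" by (metis Suc_le_eq card.empty ex_in_conv length_Cons not_less_zero zero_less_Suc less_le_trans)
  have "\<exists>segs. map fst segs = ys \<and> linked segs z \<and> distinct (concat (map snd segs)) \<and>
     set (concat (map snd segs)) \<subseteq> \<Union>(\<Q> - {Q}) \<and> length ys \<le> nv (concat (map snd segs))"
  proof (rule Cons.IH)
    show "length ys \<le> card (\<Q> - {Q})" using Cons.prems(1,2) Q by simp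
    show "successively R (ys @ [z])" using Cons.prems(4) by (cases ys) auto
  qed (use Cons.prems in auto)
  then obtain segs where s: "map fst segs = ys" "linked segs z" "distinct (concat (map snd segs))"
     "set (concat (map snd segs)) \<subseteq> \<Union>(\<Q> - {Q})" "length ys \<le> nv (concat (map snd segs))" by blast
  define y' where "y' = hd (ys @ [z])"
  have y': "R y y'" using Cons.prems(4) unfolding y'_def by (cases ys) auto
  then obtain xs where xs: "opath Q y y' xs" "1 \<le> nv xs" using Cons.prems(5)[OF Q] by blast
  have "Q \<inter> \<Union>(\<Q> - {Q}) = {}" using Cons.prems(3) Q by blast
  then have dis: "set xs \<inter> set (concat (map snd segs)) = {}" using s(4) xs unfolding opath_def by blast
  have "y' = (if segs = [] then z else fst (hd segs))" unfolding y'_def using s(1) by (cases segs) auto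
  then have "linked ((y, xs) # segs) z" using s(2) opath_linked[OF xs(1)] by simp
  moreover have "distinct (concat (map snd ((y, xs) # segs)))" using s(3) dis opath_linked[OF xs(1)] by auto
  moreover have "set (concat (map snd ((y, xs) # segs))) \<subseteq> \<Union>\<Q>" using s(4) opath_linked[OF xs(1)] Q by auto
  moreover have "length (y # ys) \<le> nv (concat (map snd ((y, xs) # segs)))" using s(5) xs by simp
  ultimately show ?case using s(1) by (intro exI[of _ "(y, xs) # segs"]) auto
qed

lemma fill:
  assumes "finite \<Q>" "length ys \<le> card \<Q>" "\<And>Q Q'. Q \<in> \<Q> \<Longrightarrow> Q' \<in> \<Q> \<Longrightarrow> Q \<noteq> Q' \<Longrightarrow> Q \<inter> Q' = {}"
    and "distinct (ys @ [z])" "set (ys @ [z]) \<subseteq> A"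
    and "\<And>Q y y'. Q \<in> \<Q> \<Longrightarrow> y \<in> A \<Longrightarrow> y' \<in> A \<Longrightarrow> y \<noteq> y' \<Longrightarrow> \<exists>xs. opath Q y y' xs \<and> 1 \<le> nv xs"
  shows "\<exists>segs. map fst segs = ys \<and> linked segs z \<and> distinct (concat (map snd segs)) \<and>
     set (concat (map snd segs)) \<subseteq> \<Union>\<Q> \<and> length ys \<le> nv (concat (map snd segs))"
proof -
  have c: "successively (\<lambda>y y'. y \<in> A \<and> y' \<in> A \<and> y \<noteq> y') (ys @ [z])" using assms(4,5)
  proof (induction ys)
    case (Cons y ys)
    then show ?case by (cases ys) auto
  qed simp
  show ?thesis by (rule fill_rel[OF assms(1-3) c]) (use assms(6) in auto)
qed

lemma nv_Inl: "set ys \<subseteq> range Inl \<Longrightarrow> nv ys = length ys"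
  unfolding nv_def by (metis filter_True isl_def image_iff subsetD)

lemma distinct_flatI:
  assumes "distinct (map fst segs)" "distinct (concat (map snd segs))"
      "fst ` set segs \<inter> set (concat (map snd segs)) = {}"
  shows "distinct (flat segs)"
  using assms
proof (induction segs)
  case (Cons s segs)
  have "fst ` set segs \<inter> set (concat (map snd segs)) = {}" using Cons.prems(3) by (simp; blast)
  then have "distinct (flat segs)" using Cons by simp
  moreover have "fst s \<notin> set (flat segs)" "fst s \<notin> set (snd s)" "set (snd s) \<inter> set (flat segs) = {}"
    unfolding set_flat using Cons.prems by (simp_all; blast)+
  ultimately show ?case using Cons.prems(2) by simp
qed simp

text \<open>The cycle visits all of \<open>A\<close>, uses \<open>xs\<close> for one gap and a
  vertex from a separate family member for each of the other \<open>card A - 1\<close> gaps.\<close>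

lemma one_special:
  assumes A: "finite A" "A \<subseteq> range Inl" "p \<in> A" "q \<in> A" "p \<noteq> q"
    and xs: "opath X p q xs" "X \<inter> A = {}"
    and fam: "finite \<Q>" "card A \<le> card \<Q>" "\<And>Q Q'. Q \<in> \<Q> \<Longrightarrow> Q' \<in> \<Q> \<Longrightarrow> Q \<noteq> Q' \<Longrightarrow> Q \<inter> Q' = {}"
      "\<And>Q y y'. Q \<in> \<Q> \<Longrightarrow> y \<in> A \<Longrightarrow> y' \<in> A \<Longrightarrow> y \<noteq> y' \<Longrightarrow> \<exists>xs. opath Q y y' xs \<and> 1 \<le> nv xs"
      "\<Union>\<Q> \<inter> A = {}" "\<Union>\<Q> \<inter> set xs = {}"
  shows "\<exists>c. cyc c \<and> nv xs + 2 * card A \<le> nv c + 1"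
proof -
  obtain R where R: "distinct R" "set R = A - {p, q}" using A finite_distinct_list[of "A - {p, q}"] by auto
  have cA: "card A = length R + 2"
  proof -
    have "card (A - {p, q}) = card A - 2" using A by (simp add: card_Diff_subset)
    moreover have "2 \<le> card A" using card_mono[of A "{p, q}"] A by simp
    ultimately show ?thesis using R distinct_card[of R] by simp
  qed
  have "\<exists>segs. map fst segs = q # R \<and> linked segs p \<and> distinct (concat (map snd segs)) \<and>
     set (concat (map snd segs)) \<subseteq> \<Union>\<Q> \<and> length (q # R) \<le> nv (concat (map snd segs))"
    by (rule fill[of _ _ p A]) (use fam R A cA in auto)
  then obtain segs where s: "map fst segs = q # R" "linked segs p" "distinct (concat (map snd segs))"
     "set (concat (map snd segs)) \<subseteq> \<Union>\<Q>" "length (q # R) \<le> nv (concat (map snd segs))"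
    by (elim exE conjE) (rule that)
  let ?s = "(p, xs) # segs"
  have sn: "segs \<noteq> []" using s(1) by auto
  have hs: "fst (hd segs) = q" using s(1) sn by (cases segs) auto
  have fs: "fst ` set segs = set (q # R)" using s(1) by (metis image_set)
  have "distinct (flat segs)"
  proof (rule distinct_flatI)
    show "distinct (map fst segs)" using s(1) R by simp
    show "fst ` set segs \<inter> set (concat (map snd segs)) = {}" unfolding fs using s(4) fam(5) R A by auto
  qed (rule s(3))
  moreover have "p \<notin> set xs" using xs A unfolding opath_def by auto
  moreover have "p \<notin> set (flat segs)" unfolding set_flat fs using R s(4) fam(5) A by auto
  moreover have "set xs \<inter> set (flat segs) = {}" unfolding set_flat fs using R s(4) fam(6) A xs unfolding opath_def by auto
  ultimately have d: "distinct (flat ?s)" using opath_linked[OF xs(1)] by auto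
  have "cyc (flat ?s)"
  proof (rule linked_cyc)
    show "linked ?s (fst (hd ?s))" using s(2) sn hs opath_linked[OF xs(1)] by simp
    show "2 \<le> length ?s" using sn by (cases segs) auto
  qed (rule d)
  moreover have "nv (flat ?s) = 1 + nv xs + nv (q # R) + nv (concat (map snd segs))"
  proof -
    obtain p0 where "p = Inl p0" using A by blast
    then show ?thesis by (simp add: nv_flat s(1))
  qed
  moreover have "nv (q # R) = length (q # R)" using A R by (intro nv_Inl) auto
  ultimately show ?thesis using s(5) cA by (intro exI[of _ "flat ?s"]) auto
qed

text \<open>The two special paths are consecutive on the cycle; the remaining
  \<open>card A - 2\<close> gaps each contribute a vertex.\<close>

lemma two_special_shared:
  assumes A: "finite A" "A \<subseteq> range Inl" "p \<in> A" "q \<in> A" "p \<noteq> q" "q' \<in> A" "q' \<noteq> q" "q' \<noteq> p"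
    and xs: "opath X p q xs" "X \<inter> A = {}" and ys: "opath Y q q' ys" "Y \<inter> A = {}" "X \<inter> Y = {}"
    and fam: "finite \<Q>" "card A \<le> card \<Q>" "\<And>Q Q'. Q \<in> \<Q> \<Longrightarrow> Q' \<in> \<Q> \<Longrightarrow> Q \<noteq> Q' \<Longrightarrow> Q \<inter> Q' = {}"
      "\<And>Q y y'. Q \<in> \<Q> \<Longrightarrow> y \<in> A \<Longrightarrow> y' \<in> A \<Longrightarrow> y \<noteq> y' \<Longrightarrow> \<exists>xs. opath Q y y' xs \<and> 1 \<le> nv xs"
      "\<Union>\<Q> \<inter> A = {}" "\<Union>\<Q> \<inter> (set xs \<union> set ys) = {}"
  shows "\<exists>c. cyc c \<and> nv xs + nv ys + 2 * card A \<le> nv c + 2"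
proof -
  obtain R where R: "distinct R" "set R = A - {p, q, q'}" using A finite_distinct_list[of "A - {p, q, q'}"] by auto
  have cA: "card A = length R + 3"
  proof -
    have "card (A - {p, q, q'}) = card A - 3" using A by (simp add: card_Diff_subset)
    moreover have "3 \<le> card A" using card_mono[of A "{p, q, q'}"] A by auto
    ultimately show ?thesis using R distinct_card[of R] by simp
  qed
  have "\<exists>segs. map fst segs = q' # R \<and> linked segs p \<and> distinct (concat (map snd segs)) \<and>
     set (concat (map snd segs)) \<subseteq> \<Union>\<Q> \<and> length (q' # R) \<le> nv (concat (map snd segs))"
    by (rule fill[of _ _ p A]) (use fam R A cA in auto)
  then obtain segs where s: "map fst segs = q' # R" "linked segs p" "distinct (concat (map snd segs))"
     "set (concat (map snd segs)) \<subseteq> \<Union>\<Q>" "length (q' # R) \<le> nv (concat (map snd segs))"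
    by (elim exE conjE) (rule that)
  let ?s = "(p, xs) # (q, ys) # segs"
  have sn: "segs \<noteq> []" using s(1) by auto
  have hs: "fst (hd segs) = q'" using s(1) sn by (cases segs) auto
  have fs: "fst ` set segs = set (q' # R)" using s(1) by (metis image_set)
  have X: "set xs \<subseteq> X" "set ys \<subseteq> Y" using xs ys unfolding opath_def by auto
  have "distinct (flat ?s)"
  proof (rule distinct_flatI)
    show "distinct (map fst ?s)" using s(1) R A by auto
    show "distinct (concat (map snd ?s))" using s(3,4) opath_linked[OF xs(1)] opath_linked[OF ys(1)] ys(3) fam(6) X
      by (auto; blast)
    have "fst ` set ?s \<subseteq> A" using fs R A by auto
    moreover have "set (concat (map snd ?s)) \<subseteq> X \<union> Y \<union> \<Union>\<Q>" using s(4) X by auto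
    ultimately show "fst ` set ?s \<inter> set (concat (map snd ?s)) = {}" using xs ys fam(5) by blast
  qed
  then have "cyc (flat ?s)"
  proof (rule linked_cyc[rotated 2])
    show "linked ?s (fst (hd ?s))" using s(2) sn hs opath_linked[OF xs(1)] opath_linked[OF ys(1)] by simp
  qed simp
  moreover have "nv (flat ?s) = 2 + nv xs + nv ys + nv (q' # R) + nv (concat (map snd segs))"
  proof -
    obtain p0 q0 where "p = Inl p0" "q = Inl q0" using A by blast
    then show ?thesis by (simp add: nv_flat s(1))
  qed
  moreover have "nv (q' # R) = length (q' # R)" using A R by (intro nv_Inl) auto
  ultimately show ?thesis using s(5) cA by (intro exI[of _ "flat ?s"]) auto
qed

text \<open>With four different ends one family member \<open>Q0\<close> is reserved for the gap
  between the two special paths, while the rest of \<open>A\<close> is placed in the other gap. The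
  count is the same as with a shared end.\<close>

lemma two_special_disjoint:
  assumes A: "finite A" "A \<subseteq> range Inl" "{p, q, p', q'} \<subseteq> A" "distinct [p, q, p', q']"
    and xs: "opath X p q xs" "X \<inter> A = {}" and ys: "opath Y p' q' ys" "Y \<inter> A = {}" "X \<inter> Y = {}"
    and fam: "finite \<Q>" "card A \<le> card \<Q>" "\<And>Q Q'. Q \<in> \<Q> \<Longrightarrow> Q' \<in> \<Q> \<Longrightarrow> Q \<noteq> Q' \<Longrightarrow> Q \<inter> Q' = {}"
      "\<And>Q y y'. Q \<in> \<Q> \<Longrightarrow> y \<in> A \<Longrightarrow> y' \<in> A \<Longrightarrow> y \<noteq> y' \<Longrightarrow> \<exists>xs. opath Q y y' xs \<and> 1 \<le> nv xs"
      "\<Union>\<Q> \<inter> A = {}" "\<Union>\<Q> \<inter> (set xs \<union> set ys) = {}"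
  shows "\<exists>c. cyc c \<and> nv xs + nv ys + 2 * card A \<le> nv c + 2"
proof -
  obtain R where R: "distinct R" "set R = A - {p, q, p', q'}"
    using A finite_distinct_list[of "A - {p, q, p', q'}"] by auto
  have cA: "card A = length R + 4"
  proof -
    have c4: "card {p, q, p', q'} = 4" using A(4) by simp
    have "card (A - {p, q, p', q'}) = card A - 4" using card_Diff_subset[of "{p, q, p', q'}" A] A(3) c4 by simp
    moreover have "4 \<le> card A" using card_mono[OF A(1,3)] c4 by simp
    ultimately show ?thesis using R distinct_card[of R] by simp
  qed
  obtain Q0 where Q0: "Q0 \<in> \<Q>" using fam(2) cA by (metis add_is_0 card.empty ex_in_conv le_zero_eq zero_neq_numeral)
  obtain zs where zs: "opath Q0 q' p zs" "1 \<le> nv zs" using fam(4)[OF Q0, of q' p] A by auto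
  have "\<exists>segs. map fst segs = q # R \<and> linked segs p' \<and> distinct (concat (map snd segs)) \<and>
     set (concat (map snd segs)) \<subseteq> \<Union>(\<Q> - {Q0}) \<and> length (q # R) \<le> nv (concat (map snd segs))"
    by (rule fill[of _ _ p' A]) (use fam R A cA Q0 in auto)
  then obtain segs where s: "map fst segs = q # R" "linked segs p'" "distinct (concat (map snd segs))"
     "set (concat (map snd segs)) \<subseteq> \<Union>(\<Q> - {Q0})" "length (q # R) \<le> nv (concat (map snd segs))"
    by (elim exE conjE) (rule that)
  let ?s = "(p, xs) # segs @ [(p', ys), (q', zs)]"
  have sn: "segs \<noteq> []" using s(1) by auto
  have hs: "fst (hd segs) = q" using s(1) sn by (cases segs) auto
  have fs: "fst ` set segs = set (q # R)" using s(1) by (metis image_set)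
  have X: "set xs \<subseteq> X" "set ys \<subseteq> Y" "set zs \<subseteq> Q0" using xs ys zs unfolding opath_def by auto
  have Q0d: "Q0 \<inter> \<Union>(\<Q> - {Q0}) = {}" using fam(3) Q0 by blast
  have "distinct (flat ?s)"
  proof (rule distinct_flatI)
    show "distinct (map fst ?s)" using s(1) R A by auto
    define G where "G = set (concat (map snd segs))"
    have G: "G \<subseteq> \<Union>(\<Q> - {Q0})" using s(4) unfolding G_def .
    have G1: "G \<subseteq> \<Union>\<Q>" "Q0 \<subseteq> \<Union>\<Q>" using G Q0 by blast+
    have "set xs \<inter> G = {}" using fam(6) G1(1) by blast
    moreover have "set ys \<inter> G = {}" using fam(6) G1(1) by blast
    moreover have "set zs \<inter> G = {}" using Q0d G X(3) by blast
    moreover have "set xs \<inter> set ys = {}" using X ys(3) by blast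
    moreover have "set xs \<inter> set zs = {}" using fam(6) G1(2) X(3) by blast
    moreover have "set ys \<inter> set zs = {}" using fam(6) G1(2) X(3) by blast
    ultimately show "distinct (concat (map snd ?s))"
      using s(3) opath_linked[OF xs(1)] opath_linked[OF ys(1)] opath_linked[OF zs(1)] unfolding G_def by auto
    have "fst ` set ?s \<subseteq> A" using fs R A by auto
    moreover have "set (concat (map snd ?s)) \<subseteq> X \<union> Y \<union> \<Union>\<Q>" using s(4) X Q0 by auto
    ultimately show "fst ` set ?s \<inter> set (concat (map snd ?s)) = {}" using xs ys fam(5) by blast
  qed
  then have "cyc (flat ?s)"
  proof (rule linked_cyc[rotated 2])
    show "linked ?s (fst (hd ?s))"
      using s(2) sn hs opath_linked[OF xs(1)] opath_linked[OF ys(1)] opath_linked[OF zs(1)]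
      by (simp add: linked_append)
  qed simp
  moreover have "nv (flat ?s) = 3 + nv xs + nv ys + nv zs + nv (q # R) + nv (concat (map snd segs))"
  proof -
    have "p \<in> range Inl" "p' \<in> range Inl" "q' \<in> range Inl" using A(2,3) by auto
    then obtain p0 p1 q1 where "p = Inl p0" "p' = Inl p1" "q' = Inl q1" by (elim rangeE)
    then show ?thesis by (simp add: nv_flat s(1))
  qed
  moreover have "nv (q # R) = length (q # R)" using A R by (intro nv_Inl) auto
  ultimately show ?thesis using s(5) cA zs(2) by (intro exI[of _ "flat ?s"]) auto
qed

lemma two_special:
  assumes A: "finite A" "A \<subseteq> range Inl" "p \<in> A" "q \<in> A" "p \<noteq> q" "p' \<in> A" "q' \<in> A" "p' \<noteq> q'" "{p, q} \<noteq> {p', q'}"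
    and xs: "opath X p q xs" "X \<inter> A = {}" and ys: "opath Y p' q' ys" "Y \<inter> A = {}" "X \<inter> Y = {}"
    and fam: "finite \<Q>" "card A \<le> card \<Q>" "\<And>Q Q'. Q \<in> \<Q> \<Longrightarrow> Q' \<in> \<Q> \<Longrightarrow> Q \<noteq> Q' \<Longrightarrow> Q \<inter> Q' = {}"
      "\<And>Q y y'. Q \<in> \<Q> \<Longrightarrow> y \<in> A \<Longrightarrow> y' \<in> A \<Longrightarrow> y \<noteq> y' \<Longrightarrow> \<exists>xs. opath Q y y' xs \<and> 1 \<le> nv xs"
      "\<Union>\<Q> \<inter> A = {}" "\<Union>\<Q> \<inter> (set xs \<union> set ys) = {}"
  shows "\<exists>c. cyc c \<and> nv xs + nv ys + 2 * card A \<le> nv c + 2"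
proof -
  have r: "opath X q p (rev xs)" "opath Y q' p' (rev ys)" using xs ys opath_rev by blast+
  have d: "\<Union>\<Q> \<inter> (set (rev xs) \<union> set ys) = {}" "\<Union>\<Q> \<inter> (set xs \<union> set (rev ys)) = {}"
    "\<Union>\<Q> \<inter> (set (rev xs) \<union> set (rev ys)) = {}" using fam(6) by auto
  consider "q = p'" | "q = q'" | "p = p'" | "p = q'" | "distinct [p, q, p', q']" using A by auto
  then show ?thesis
  proof cases
    case 1
    then show ?thesis using two_special_shared[OF A(1,2,3,4,5,7) _ _ xs _ ys(2,3) fam] A ys(1) by auto
  next
    case 2
    then show ?thesis using two_special_shared[OF A(1,2,3,4,5,6) _ _ xs _ ys(2,3) fam(1-5) d(2)] A r(2) by auto
  next
    case 3
    then show ?thesis using two_special_shared[OF A(1,2,4,3) _ A(7) _ _ r(1) xs(2) _ ys(2,3) fam(1-5) d(1)] A ys(1) by auto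
  next
    case 4
    then show ?thesis using two_special_shared[OF A(1,2,4,3) _ A(6) _ _ r(1) xs(2) _ ys(2,3) fam(1-5) d(3)] A r(2) by auto
  next
    case 5
    then show ?thesis using two_special_disjoint[OF A(1,2) _ 5 xs ys fam] A by auto
  qed
qed

end

section \<open>Two-connected hypergraphs without long Berge cycles\<close>

locale twoconn = hgraph E for E :: "'a set set" +
  fixes V :: "'a set" and r k :: nat
  assumes finV: "finite V" and edge: "\<And>e. e \<in> E \<Longrightarrow> e \<subseteq> V \<and> card e = r" and r3: "3 \<le> r"
    and tc: "two_connected V E" and nobc: "\<not> (\<exists>vs es. berge_cycle V E vs es \<and> k \<le> length vs)"
begin

definition N :: "('a + 'a set) set" where
  "N = Inl ` V \<union> Inr ` E"

lemma finE: "finite E"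
  by (rule finite_subset[of _ "Pow V"]) (use edge finV in auto)

lemma finN: "finite N"
  unfolding N_def using finV finE by simp

lemma N_simps [simp]: "Inl v \<in> N \<longleftrightarrow> v \<in> V" "Inr e \<in> N \<longleftrightarrow> e \<in> E"
  unfolding N_def by auto

lemma edgeV: "e \<in> E \<Longrightarrow> v \<in> e \<Longrightarrow> v \<in> V"
  using edge by blast

lemma inc_N: "inc E x y \<Longrightarrow> x \<in> N \<and> y \<in> N"
  unfolding inc_def using edgeV by auto

lemma nbr_N: "nbr Q \<subseteq> N" "nbr N = {}"
  unfolding nbr_def using inc_N by blast+

lemma edge_vertex:
  assumes "e \<in> E"
  shows "\<exists>v\<in>e. v \<in> V \<and> Inl v \<noteq> w"
proof -
  have "card e = r" "e \<subseteq> V" using assms edge by auto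
  have "\<not> e \<subseteq> {u. Inl u = w}"
  proof
    assume s: "e \<subseteq> {u. Inl u = w}"
    then have "card e \<le> card {u. Inl u = w}" by (intro card_mono) (cases w; auto)+
    moreover have "card {u. Inl u = w} \<le> 1" by (cases w) auto
    ultimately show False using \<open>card e = r\<close> r3 by simp
  qed
  then show ?thesis using \<open>e \<subseteq> V\<close> by blast
qed

text \<open>The vertices in the component of \<open>x\<close> and the remaining vertices other than
  \<open>w\<close> would be the two sides of a forbidden separation. The three conditions of
  2-connectedness correspond to \<open>w\<close> outside \<open>N\<close>, \<open>w\<close> a vertex
  and \<open>w\<close> a hyperedge. Hyperedges need no separate treatment, as each has a vertex
  different from \<open>w\<close>.\<close>

lemma conn_minus:
  assumes x: "x \<in> N - {w}" and y: "y \<in> N - {w}"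
  shows "reach (N - {w}) x y"
proof -
  define C where "C = comp_of (N - {w}) x"
  define V1 where "V1 = {v \<in> V. Inl v \<in> C}"
  define V2 where "V2 = {v \<in> V. Inl v \<notin> C \<and> Inl v \<noteq> w}"
  have xC: "x \<in> C" unfolding C_def using x by (rule comp_of_self)
  have cl: "b \<in> C" if "a \<in> C" "inc E a b" "b \<noteq> w" for a b
    using comp_of_closed[of a "N - {w}" x b] that inc_N unfolding C_def by blast
  have C: "Inr e \<in> C \<longleftrightarrow> Inl v \<in> C" if "e \<in> E" "v \<in> e" "Inr e \<noteq> w" "Inl v \<noteq> w" for e v
    using cl[of "Inr e" "Inl v"] cl[of "Inl v" "Inr e"] that by auto
  have V1: "V1 \<noteq> {}"
  proof (cases x)
    case (Inl v)
    then show ?thesis using xC x unfolding V1_def by auto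
  next
    case (Inr e)
    then have e: "e \<in> E" "Inr e \<noteq> w" using x by auto
    then obtain v where "v \<in> e" "v \<in> V" "Inl v \<noteq> w" using edge_vertex by metis
    then show ?thesis using C[OF e(1) _ e(2)] xC Inr unfolding V1_def by blast
  qed
  have part: "e \<inter> V2 = {} \<or> e \<inter> V1 = {}" if "e \<in> E" "Inr e \<noteq> w" for e
    using C[OF that(1) _ that(2)] comp_of_sub[of "N - {w}" x] unfolding V1_def V2_def C_def[symmetric] by blast
  have V2: "V2 = {}"
  proof (rule ccontr)
    assume V2: "V2 \<noteq> {}"
    have disj: "V1 \<inter> V2 = {}" unfolding V1_def V2_def by blast
    have wC: "w \<notin> C" using comp_of_sub[of "N - {w}" x] unfolding C_def by blast
    show False
    proof (cases "w \<in> N")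
      case False
      have "V = V1 \<union> V2" unfolding V1_def V2_def using False by force
      moreover have "\<not> (\<exists>e\<in>E. e \<inter> V1 \<noteq> {} \<and> e \<inter> V2 \<noteq> {})" using part False by force
      ultimately show False using tc V1 V2 disj unfolding two_connected_def hconnected_def by blast
    next
      case True
      show False
      proof (cases w)
        case (Inl v)
        have Ve: "V = {v} \<union> V1 \<union> V2" unfolding V1_def V2_def using True Inl by auto
        have "v \<notin> V1" "v \<notin> V2" using wC Inl unfolding V1_def V2_def by auto
        moreover have "e \<subseteq> {v} \<union> V1 \<or> e \<subseteq> {v} \<union> V2" if "e \<in> E" for e
          using part[OF that] edge[OF that] Ve Inl by blast
        ultimately have "cut_vertex V E v" unfolding cut_vertex_def using Ve V1 V2 disj by blast
        then show False using tc unfolding two_connected_def by blast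
      next
        case (Inr e)
        have Ve: "V = V1 \<union> V2" unfolding V1_def V2_def using Inr by auto
        have "f \<subseteq> V1 \<or> f \<subseteq> V2" if "f \<in> E" "f \<noteq> e" for f
          using part[OF that(1)] that edge[OF that(1)] Ve Inr by blast
        moreover have "e \<in> E" using True Inr by simp
        ultimately have "cut_hyperedge V E e" unfolding cut_hyperedge_def using Ve V1 V2 disj by blast
        then show False using tc unfolding two_connected_def by blast
      qed
    qed
  qed
  have "y \<in> C"
  proof (cases y)
    case (Inl v)
    then show ?thesis using y V2 unfolding V2_def by auto
  next
    case (Inr e)
    then have e: "e \<in> E" "Inr e \<noteq> w" using y by auto
    then obtain v where v: "v \<in> e" "v \<in> V" "Inl v \<noteq> w" using edge_vertex by metis
    then have "Inl v \<in> C" using V2 unfolding V2_def by blast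
    then show ?thesis using C[OF e(1) v(1) e(2) v(3)] Inr by blast
  qed
  then show ?thesis unfolding C_def comp_of_def by simp
qed

lemma conn_N: "conn N"
  unfolding conn_def
proof (intro ballI)
  fix x y assume xy: "x \<in> N" "y \<in> N"
  show "reach N x y"
  proof (cases "x = y")
    case True
    then show ?thesis using xy reach_refl by simp
  next
    case False
    show ?thesis
    proof (cases "\<exists>w. w \<in> N \<and> w \<noteq> x \<and> w \<noteq> y")
      case True
      then obtain w where "w \<in> N" "w \<noteq> x" "w \<noteq> y" by blast
      then have "reach (N - {w}) x y" using conn_minus[of x w y] xy by simp
      then show ?thesis using reach_mono by blast
    next
      case no: False
      have "\<not> (\<exists>e. e \<in> E)"
      proof
        assume "\<exists>e. e \<in> E"
        then obtain e where e: "e \<in> E" by blast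
        obtain u where u: "u \<in> e" "u \<in> V" "Inl u \<noteq> x" using edge_vertex[OF e, of x] by blast
        obtain v where v: "v \<in> e" "v \<in> V" "Inl v \<noteq> y" using edge_vertex[OF e, of y] by blast
        have "Inl u = y" "Inl v = x" "Inr e = x \<or> Inr e = y" using no u v e by (metis N_simps)+
        then show False by auto
      qed
      then have E: "E = {}" by blast
      then obtain a b where ab: "x = Inl a" "y = Inl b" "a \<in> V" "b \<in> V" "a \<noteq> b" using xy False unfolding N_def by auto
      have "V = {a} \<union> {b}"
      proof
        show "V \<subseteq> {a} \<union> {b}"
        proof
          fix c assume "c \<in> V"
          then have "Inl c = x \<or> Inl c = y" using no by auto
          then show "c \<in> {a} \<union> {b}" using ab by auto
        qed
      qed (use ab in auto)
      moreover have "\<not> (\<exists>e\<in>E. e \<inter> {a} \<noteq> {} \<and> e \<inter> {b} \<noteq> {})" using E by simp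
      moreover have "{a} \<inter> {b} = {}" using ab by simp
      ultimately have "\<not> hconnected V E" unfolding hconnected_def by blast
      then show ?thesis using tc unfolding two_connected_def by blast
    qed
  qed
qed

text \<open>A walk that avoids \<open>w\<close> and leads from \<open>x\<close> out of
  \<open>Q\<close> leaves \<open>Q\<close> through a port different from \<open>w\<close>.\<close>

lemma port_tch:
  assumes "Q \<subseteq> N" "x \<in> Q" "x \<noteq> w" "\<exists>y\<in>N - Q. y \<noteq> w"
  shows "tch (Q - {w}) x (nbr Q - {w})"
proof -
  obtain y where y: "y \<in> N - Q" "y \<noteq> w" using assms by blast
  have "reach (N - {w}) x y" using conn_minus[of x w y] assms y by blast
  then have "tch (Q \<inter> (N - {w})) x (nbr Q \<inter> (N - {w}))" using tch_nbr[OF assms(2)] y by blast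
  moreover have "Q \<inter> (N - {w}) = Q - {w}" using assms by blast
  moreover have "nbr Q \<inter> (N - {w}) = nbr Q - {w}" using nbr_N by blast
  ultimately show ?thesis by simp
qed

lemma two_ports:
  assumes "Q \<subseteq> N" "Q \<noteq> {}" "p \<notin> Q" "\<exists>y\<in>N - Q. y \<noteq> p"
  shows "\<exists>q\<in>nbr Q. q \<noteq> p"
proof -
  obtain x where x: "x \<in> Q" using assms by blast
  then have "tch (Q - {p}) x (nbr Q - {p})" using port_tch[OF assms(1) x _ assms(4)] assms(3) by blast
  then show ?thesis unfolding tch_def by blast
qed

lemma cyc_berge:
  assumes c: "cyc c" "isl (hd c)"
  shows "\<exists>vs es. berge_cycle V E vs es \<and> length c = 2 * length vs"
proof -
  have len: "3 \<le> length c" and d: "distinct c" and s: "successively (inc E) c" and lh: "inc E (last c) (hd c)"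
    using c unfolding cyc_def by auto
  have adj: "inc E (c ! i) (c ! Suc i)" if "Suc i < length c" for i using successively_nth[OF s that] .
  have par: "isl (c ! i) \<longleftrightarrow> even i" if "i < length c" for i
    using that
  proof (induction i)
    case 0
    then show ?case using c(2) by (simp add: hd_conv_nth)
  next
    case (Suc i)
    then show ?case using inc_isl[OF adj[OF Suc.prems]] by simp
  qed
  have l1: "last c = c ! (length c - 1)" "hd c = c ! 0" using len by (simp_all add: last_conv_nth hd_conv_nth flip: length_greater_0_conv)
  have "\<not> isl (last c)" using inc_isl[OF lh] c(2) by simp
  then have "odd (length c - 1)" using par[of "length c - 1"] l1 len by simp
  then have ev: "even (length c)" using len by simp
  define n where "n = length c div 2"
  have n: "length c = 2 * n" using ev unfolding n_def by simp
  define vs where "vs = map (\<lambda>i. projl (c ! (2 * i))) [0..<n]"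
  define es where "es = map (\<lambda>i. projr (c ! (2 * i + 1))) [0..<n]"
  have v: "c ! (2 * i) = Inl (vs ! i)" if "i < n" for i
    using par[of "2 * i"] that n unfolding vs_def by simp
  have e: "c ! (2 * i + 1) = Inr (es ! i)" if "i < n" for i
    using par[of "2 * i + 1"] that n unfolding es_def by simp
  have lv: "length vs = n" "length es = n" unfolding vs_def es_def by simp_all
  have dv: "distinct vs" unfolding distinct_conv_nth lv
  proof (intro allI impI)
    fix i j assume "i < n" "j < n" "i \<noteq> j"
    then show "vs ! i \<noteq> vs ! j" using d v[of i] v[of j] n nth_eq_iff_index_eq[OF d, of "2 * i" "2 * j"] by auto
  qed
  have de: "distinct es" unfolding distinct_conv_nth lv
  proof (intro allI impI)
    fix i j assume "i < n" "j < n" "i \<noteq> j"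
    then show "es ! i \<noteq> es ! j" using d e[of i] e[of j] n nth_eq_iff_index_eq[OF d, of "2 * i + 1" "2 * j + 1"] by auto
  qed
  have a1: "es ! i \<in> E \<and> vs ! i \<in> es ! i" if "i < n" for i
    using adj[of "2 * i"] v[OF that] e[OF that] that n by simp
  have a2: "vs ! (Suc i mod n) \<in> es ! i" if "i < n" for i
  proof (cases "Suc i = n")
    case True
    then have "length c - 1 = 2 * i + 1" using n by simp
    then have "inc E (c ! (2 * i + 1)) (c ! (2 * 0))" using lh l1 by simp
    moreover have "0 < n" using that by simp
    ultimately show ?thesis using True e[OF that] v[of 0] by simp
  next
    case False
    then have "Suc i < n" using that by simp
    then have "inc E (c ! (2 * i + 1)) (c ! (2 * Suc i))" using adj[of "2 * i + 1"] n by simp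
    then show ?thesis using e[OF that] v[OF \<open>Suc i < n\<close>] \<open>Suc i < n\<close> by simp
  qed
  have "vs ! i \<in> V" if "i < n" for i using a1[OF that] edgeV by blast
  then have "set vs \<subseteq> V" "set es \<subseteq> E" using a1 lv by (auto simp: in_set_conv_nth)
  then have "berge_cycle V E vs es" unfolding berge_cycle_def using lv dv de a1 a2 by auto
  then show ?thesis using n lv by auto
qed

lemma cyc_short:
  assumes "cyc c"
  shows "length c < 2 * k" "nv c < k"
proof -
  have "\<exists>c'. cyc c' \<and> length c' = length c \<and> isl (hd c')"
  proof (cases "isl (hd c)")
    case False
    obtain x xs where c: "c = x # xs" using assms unfolding cyc_def by (cases c) auto
    have "xs \<noteq> []" using assms c unfolding cyc_def by auto
    then have "inc E x (hd xs)" using assms c unfolding cyc_def by (simp add: successively_Cons)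
    then have "isl (hd xs)" using False c inc_isl by auto
    moreover have "cyc (xs @ [x])" using cyc_rotate[of "[x]" xs] assms c by simp
    ultimately show ?thesis using c \<open>xs \<noteq> []\<close> by (intro exI[of _ "xs @ [x]"]) simp
  qed (use assms in blast)
  then obtain vs es where "berge_cycle V E vs es" "length c = 2 * length vs" using cyc_berge by metis
  then have l: "length c = 2 * length vs" "length vs < k" using nobc by (metis not_le)+
  then show "length c < 2 * k" by simp
  show "nv c < k" using nv_length(2)[of E c] assms l unfolding cyc_def by auto
qed

lemma path_bound:
  assumes "pth P" "set P \<subseteq> N"
  shows "length P \<le> 4 * k * k + 2"
  using path_length_bound[OF conn_minus cyc_short(1) assms] .

end

text \<open>With \<open>L = 4 * k * k + 2\<close>, the power of two bounds the number of profiles of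
  a component, that is, of sets of triples of two ports and a number up to \<open>t\<close>. The
  factor \<open>L + 3\<close> provides two special components and \<open>L + 1\<close> fillers with
  the same profile. The summand \<open>r + 4\<close> makes a hyperedge in the common neighbourhood
  impossible.\<close>

definition copies :: "nat \<Rightarrow> nat \<Rightarrow> nat \<Rightarrow> nat" where
  "copies k r t = 2 ^ ((4 * k * k + 2 + 1) * (4 * k * k + 2 + 1) * (t + 1)) * (4 * k * k + 2 + 3) + r + 4"

definition core_bound :: "nat \<Rightarrow> nat \<Rightarrow> nat \<Rightarrow> nat" where
  "core_bound k r t = many_bound (4 * k * k + 2) (copies k r t) (4 * k * k + 2 + 1)"

section \<open>Vertex sets of large minimum degree are bounded\<close>

context twoconn
begin

lemma port_count:
  assumes B: "B \<subseteq> N" "B \<noteq> {}" and out: "\<And>w. \<exists>y\<in>N - B. y \<noteq> w"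
  shows "card {v. Inl v \<in> nbr B} + card {e. Inr e \<in> nbr B} \<le> card (nbr B)" "2 \<le> card (nbr B)"
proof -
  have fN: "finite (nbr B)" using nbr_N finN finite_subset by blast
  have two: "\<exists>q\<in>nbr B. q \<noteq> p" if "p \<notin> B" for p using two_ports[OF B that out] .
  obtain p where p: "p \<in> N - B" using out by blast
  then obtain q where q: "q \<in> nbr B" using two by blast
  then have "q \<notin> B" unfolding nbr_def by blast
  then obtain q' where q': "q' \<in> nbr B" "q' \<noteq> q" using two by blast
  have "card {q, q'} \<le> card (nbr B)" using q q' fN by (intro card_mono) auto
  then show "2 \<le> card (nbr B)" using q' by simp
  have fin: "finite {v. Inl v \<in> nbr B}" "finite {e. Inr e \<in> nbr B}"
  proof -
    have "Inl ` {v. Inl v \<in> nbr B} \<subseteq> nbr B" "Inr ` {e. Inr e \<in> nbr B} \<subseteq> nbr B" by blast+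
    then have "finite (Inl ` {v. Inl v \<in> nbr B} :: ('a + 'a set) set)" "finite (Inr ` {e. Inr e \<in> nbr B} :: ('a + 'a set) set)"
      using fN finite_subset by blast+
    then show "finite {v. Inl v \<in> nbr B}" "finite {e. Inr e \<in> nbr B}"
      by (auto dest: finite_imageD simp: inj_on_def)
  qed
  have "card {v. Inl v \<in> nbr B} + card {e. Inr e \<in> nbr B}
     = card (Inl ` {v. Inl v \<in> nbr B} :: ('a + 'a set) set) + card (Inr ` {e. Inr e \<in> nbr B} :: ('a + 'a set) set)"
    by (simp add: card_image)
  also have "\<dots> = card ((Inl ` {v. Inl v \<in> nbr B} :: ('a + 'a set) set) \<union> Inr ` {e. Inr e \<in> nbr B})"
    using fin by (intro card_Un_disjoint[symmetric]) auto
  also have "\<dots> \<le> card (nbr B)" using fN by (intro card_mono) auto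
  finally show "card {v. Inl v \<in> nbr B} + card {e. Inr e \<in> nbr B} \<le> card (nbr B)" .
qed

text \<open>Only hyperedges inside \<open>C\<close> are counted, so those in \<open>B\<close>
  consist of core vertices in \<open>B\<close> and core vertices among the ports.\<close>

lemma ports_of:
  assumes B: "B \<subseteq> N" "conn B" and S: "c \<in> C" "Inl c \<in> B" and rt: "r \<le> t"
    and deg: "\<And>v. v \<in> C \<Longrightarrow> Inl v \<in> B \<Longrightarrow> t choose (r - 1) < card {e \<in> E. e \<subseteq> C \<and> v \<in> e}"
    and out: "\<And>w. \<exists>y\<in>N - B. y \<noteq> w"
    and M: "card {v \<in> C. Inl v \<in> nbr B} + card {e. Inr e \<in> nbr B} \<le> M" "2 \<le> M"
  shows "ports E B {c \<in> C. Inl c \<in> B} {v \<in> C. Inl v \<in> nbr B} {e \<in> E. e \<subseteq> C} r t M"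
proof
  show "finite B" using B finN finite_subset by blast
  show "finite (nbr B)" using nbr_N finN finite_subset by blast
  show "{c \<in> C. Inl c \<in> B} \<noteq> {}" using S by blast
  show "t choose (r - 1) < card {e \<in> {e \<in> E. e \<subseteq> C}. s \<in> e}" if "s \<in> {c \<in> C. Inl c \<in> B}" for s
    using deg[of s] that by simp
  show "e \<subseteq> {c \<in> C. Inl c \<in> B} \<union> {v \<in> C. Inl v \<in> nbr B}" if "e \<in> {e \<in> E. e \<subseteq> C}" "Inr e \<in> B" for e
  proof
    fix v assume v: "v \<in> e"
    then have "inc E (Inr e) (Inl v)" using that by simp
    then have "Inl v \<in> B \<or> Inl v \<in> nbr B" using that(2) unfolding nbr_def by blast
    then show "v \<in> {c \<in> C. Inl c \<in> B} \<union> {v \<in> C. Inl v \<in> nbr B}" using v that by blast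
  qed
  show "tch (B - {w}) (Inl s) (nbr B)" if "s \<in> {c \<in> C. Inl c \<in> B}" "Inl s \<noteq> w" for w s
    using port_tch[OF B(1) _ that(2) out] that tch_monoT by blast
  have "B \<noteq> {}" using S by blast
  then show "\<exists>q\<in>nbr B. q \<noteq> p" if "p \<in> nbr B" for p using two_ports[OF B(1) _ _ out] that unfolding nbr_def by blast
qed (use B r3 rt edge M in auto)

text \<open>\<open>B\<close> has as few ports as possible. A port that is a hyperedge is represented by one of its
  vertices in \<open>Y\<close>; minimality makes any two ports joined through a vertex of \<open>B\<close>, because a hyperedge
  through which two vertex ports are both forced to pass could replace them.\<close>

lemma good_ports:
  assumes Q: "Q \<subseteq> N" "conn Q" "nbr Q = Y" "Y \<subseteq> Inl ` V" and S: "c0 \<in> C" "Inl c0 \<in> Q" and C: "C \<subseteq> V"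
    and rt: "r \<le> t" and deg: "\<And>v. v \<in> C \<Longrightarrow> t choose (r - 1) < card {e \<in> E. e \<subseteq> C \<and> v \<in> e}"
    and out: "\<And>w. \<exists>y\<in>N - Q. y \<noteq> w"
  shows "\<exists>A\<subseteq>Y. 2 \<le> card A \<and> (\<forall>y\<in>A. \<forall>y'\<in>A. y \<noteq> y' \<longrightarrow> (\<exists>xs. opath Q y y' xs \<and> 1 \<le> nv xs)) \<and>
    ((\<exists>y\<in>A. \<exists>y'\<in>A - {y}. \<exists>xs. opath Q y y' xs \<and> t \<le> nv xs) \<or>
     (\<forall>y\<in>A. \<exists>y'\<in>A - {y}. \<exists>xs. opath Q y y' xs \<and> 1 \<le> nv xs \<and> t + 2 \<le> nv xs + card A))"
proof -
  define fam where "fam B rep \<longleftrightarrow> B \<subseteq> Q \<and> conn B \<and> Inl ` C \<inter> B \<noteq> {} \<and> inj_on rep (nbr B) \<and> rep ` nbr B \<subseteq> Y \<and>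
     (\<forall>b\<in>nbr B. rep b = b \<or> \<not> isl b \<and> inc E b (rep b))" for B rep
  have "fam Q id" unfolding fam_def using Q S by auto
  then have "\<exists>B. \<exists>rep. fam B rep" by blast
  then obtain B where "\<exists>rep. fam B rep" and Bmin: "\<And>B' rep. fam B' rep \<Longrightarrow> card (nbr B) \<le> card (nbr B')"
    using ex_has_least_nat[of "\<lambda>B. \<exists>rep. fam B rep" _ "\<lambda>B. card (nbr B)"] by blast
  then obtain rep where fam: "fam B rep" by blast
  have BQ: "B \<subseteq> Q" and cB: "conn B" and SB: "Inl ` C \<inter> B \<noteq> {}" and inj: "inj_on rep (nbr B)"
    and repY: "\<And>b. b \<in> nbr B \<Longrightarrow> rep b \<in> Y" and rep: "\<And>b. b \<in> nbr B \<Longrightarrow> rep b = b \<or> \<not> isl b \<and> inc E b (rep b)"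
    using fam unfolding fam_def by blast+
  obtain c where c: "c \<in> C" "Inl c \<in> B" using SB by blast
  have BN: "B \<subseteq> N" using BQ Q by blast
  have outB: "\<exists>y\<in>N - B. y \<noteq> w" for w using out[of w] BQ by blast
  have fN: "finite (nbr B)" using nbr_N finN finite_subset by blast
  have B0: "B \<noteq> {}" using c by blast
  note pc = port_count[OF BN B0 outB]
  define A where "A = rep ` nbr B"
  have cA: "card A = card (nbr B)" unfolding A_def by (rule card_image[OF inj])
  have A: "A \<subseteq> Y" unfolding A_def using repY by blast
  have portQ: "b \<in> Q" if "b \<in> nbr B" "\<not> isl b" for b
  proof (rule ccontr)
    assume "b \<notin> Q"
    then have "b \<in> nbr Q" using that(1) BQ unfolding nbr_def by blast
    then show False using Q that by auto
  qed
  have bB: "b \<notin> B" if "b \<in> nbr B" for b using that unfolding nbr_def by blast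
  \<comment> \<open>A hyperedge port is inserted between the path and its representing vertex. It
    adds no vertex to the path, and it lies in \<open>Q\<close>, since all neighbours of
    \<open>Q\<close> are vertices.\<close>
  have transfer: "\<exists>ys. opath Q (rep b) (rep b') ys \<and> nv ys = nv xs"
    if b: "b \<in> nbr B" "b' \<in> nbr B" "b \<noteq> b'" and xs: "opath B b b' xs" for b b' xs
  proof -
    define us where "us = (if rep b = b then [] else [b])"
    define ws where "ws = (if rep b' = b' then [] else [b'])"
    have x: "pth xs" "set xs \<subseteq> B" "inc E b (hd xs)" "inc E (last xs) b'" "xs \<noteq> []"
      using xs unfolding opath_def pth_def by auto
    have d: "b \<notin> set xs" "b' \<notin> set xs" using x(2) bB b by blast+
    have "distinct (us @ xs @ ws)" using x(1) d b(3) unfolding us_def ws_def pth_def by auto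
    moreover have "successively (inc E) (us @ xs @ ws)" using x unfolding us_def ws_def pth_def
      by (auto simp: successively_append_iff successively_Cons)
    moreover have "set (us @ xs @ ws) \<subseteq> Q" using x(2) BQ portQ rep b unfolding us_def ws_def by auto
    moreover have "inc E (rep b) (hd (us @ xs @ ws))"
    proof (cases "rep b = b")
      case False
      then show ?thesis using rep[OF b(1)] adj_sym unfolding us_def by auto
    qed (use x in \<open>simp add: us_def\<close>)
    moreover have "inc E (last (us @ xs @ ws)) (rep b')"
    proof (cases "rep b' = b'")
      case False
      then show ?thesis using rep[OF b(2)] unfolding ws_def by auto
    qed (use x in \<open>simp add: ws_def\<close>)
    ultimately have "opath Q (rep b) (rep b') (us @ xs @ ws)" using x unfolding opath_def pth_def by simp
    moreover have "nv us = 0" "nv ws = 0" using rep b unfolding us_def ws_def nv_def by auto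
    ultimately show ?thesis by (intro exI[of _ "us @ xs @ ws"]) simp
  qed
  have link: "\<exists>xs. opath B b b' xs \<and> 1 \<le> nv xs" if b: "b \<in> nbr B" "b' \<in> nbr B" "b \<noteq> b'" for b b'
  proof (rule ccontr)
    assume no: "\<not> (\<exists>xs. opath B b b' xs \<and> 1 \<le> nv xs)"
    \<comment> \<open>Between contacts of \<open>b\<close> and of \<open>b'\<close> there is a path
      inside \<open>B\<close>. Without a vertex on it, it is a single hyperedge, so both ports touch
      \<open>B\<close> in one common hyperedge only.\<close>
    have sing: "a = a' \<and> \<not> isl a" if a: "a \<in> B" "inc E a b" "a' \<in> B" "inc E a' b'" for a a'
    proof -
      have "reach B a a'" using cB a unfolding conn_def by blast
      then obtain xs where xs: "pth xs" "hd xs = a" "last xs = a'" "set xs \<subseteq> B" using reach_path by blast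
      have xn: "xs \<noteq> []" using xs unfolding pth_def by blast
      have "opath B b b' xs" using xs a adj_sym unfolding opath_def by blast
      then have "\<not> 1 \<le> nv xs" using no by blast
      then have n0: "nv xs = 0" by simp
      have "length xs \<le> 1" using nv_length(1)[of E xs] xs n0 unfolding pth_def by auto
      then obtain x where "xs = [x]" using xn by (cases xs) auto
      then show ?thesis using xs n0 by (auto simp: nv_def split: if_splits)
    qed
    obtain a where a: "a \<in> B" "inc E a b" using b(1) unfolding nbr_def by blast
    obtain a' where a': "a' \<in> B" "inc E a' b'" using b(2) unfolding nbr_def by blast
    have nl: "\<not> isl a" "a = a'" using sing[OF a a'] by auto
    have isb: "isl b" "isl b'" using inc_isl[OF a(2)] inc_isl[OF a'(2)] nl by auto
    have only: "x = a" if "x \<in> B" "inc E x b \<or> inc E x b'" for x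
      using sing[OF that(1) _ a'] sing[OF a that(1)] nl(2) that(2) by metis
    have rb: "rep b = b" using rep[OF b(1)] isb by blast
    \<comment> \<open>Removing the common hyperedge \<open>a\<close> from \<open>B\<close> turns it
      into a port represented by \<open>b\<close>, while \<open>b\<close> and \<open>b'\<close>
      cease to be ports. The number of ports drops, against minimality.\<close>
    define B' where "B' = comp_of (B - {a}) (Inl c)"
    have ca: "Inl c \<in> B - {a}" using c nl by auto
    have B'B: "B' \<subseteq> B - {a}" unfolding B'_def by (rule comp_of_sub)
    have nB': "nbr B' \<subseteq> insert a (nbr B - {b, b'})"
    proof
      fix x assume "x \<in> nbr B'"
      then obtain y where y: "y \<in> B'" "inc E y x" "x \<notin> B'" unfolding nbr_def by blast
      show "x \<in> insert a (nbr B - {b, b'})"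
      proof (cases "x \<in> B")
        case True
        then show ?thesis using comp_of_closed[of y "B - {a}" "Inl c" x] y unfolding B'_def by blast
      next
        case False
        then have "x \<in> nbr B" using y B'B unfolding nbr_def by blast
        moreover have "x \<noteq> b" "x \<noteq> b'" using only[of y] y B'B by blast+
        ultimately show ?thesis by blast
      qed
    qed
    define rep' where "rep' = rep(a := b)"
    have aN: "a \<notin> nbr B" using a(1) unfolding nbr_def by blast
    have "fam B' rep'" unfolding fam_def
    proof (intro conjI ballI)
      show "B' \<subseteq> Q" using B'B BQ by blast
      show "conn B'" unfolding B'_def by (rule conn_comp_of)
      show "Inl ` C \<inter> B' \<noteq> {}" using comp_of_self[OF ca] c unfolding B'_def by blast
      have i1: "inj_on rep' (nbr B - {b, b'})" using inj aN unfolding rep'_def inj_on_def by auto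
      have "b \<notin> rep' ` (nbr B - {b, b'})"
      proof
        assume "b \<in> rep' ` (nbr B - {b, b'})"
        then obtain x where x: "x \<in> nbr B" "x \<noteq> b" "rep x = b" using aN unfolding rep'_def by auto
        then show False using inj b(1) rb unfolding inj_on_def by metis
      qed
      then have "inj_on rep' (insert a (nbr B - {b, b'}))" using i1 unfolding inj_on_insert by (auto simp: rep'_def)
      then show "inj_on rep' (nbr B')" using nB' inj_on_subset by blast
      show "rep' ` nbr B' \<subseteq> Y" using nB' repY b(1) rb unfolding rep'_def by force
      show "rep' x = x \<or> \<not> isl x \<and> inc E x (rep' x)" if "x \<in> nbr B'" for x
      proof (cases "x = a")
        case True
        then show ?thesis using nl a unfolding rep'_def by simp
      next
        case False
        then show ?thesis using nB' that rep[of x] unfolding rep'_def by auto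
      qed
    qed
    then have "card (nbr B) \<le> card (nbr B')" by (rule Bmin)
    also have "\<dots> \<le> card (insert a (nbr B - {b, b'}))" using fN nB' by (intro card_mono) auto
    also have "\<dots> \<le> Suc (card (nbr B - {b, b'}))" using fN by (simp add: card_insert_if)
    also have "card (nbr B - {b, b'}) = card (nbr B) - 2" using b by (auto simp: card_Diff_subset card_insert_if)
    finally show False using pc(2) by simp
  qed
  have pairs: "\<forall>y\<in>A. \<forall>y'\<in>A. y \<noteq> y' \<longrightarrow> (\<exists>xs. opath Q y y' xs \<and> 1 \<le> nv xs)"
  proof (intro ballI impI)
    fix y y' assume yy: "y \<in> A" "y' \<in> A" "y \<noteq> y'"
    then obtain b b' where b: "b \<in> nbr B" "b' \<in> nbr B" "y = rep b" "y' = rep b'" unfolding A_def by blast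
    then have "b \<noteq> b'" using yy by blast
    then obtain xs where "opath B b b' xs" "1 \<le> nv xs" using link b by blast
    then show "\<exists>xs. opath Q y y' xs \<and> 1 \<le> nv xs" using transfer[OF b(1,2) \<open>b \<noteq> b'\<close>] b by metis
  qed
  have "{v. Inl v \<in> nbr B} \<subseteq> V" using nbr_N by fastforce
  then have "card {v \<in> C. Inl v \<in> nbr B} \<le> card {v. Inl v \<in> nbr B}" using finV finite_subset by (intro card_mono) auto
  then have "card {v \<in> C. Inl v \<in> nbr B} + card {e. Inr e \<in> nbr B} \<le> card (nbr B)" using pc(1) by linarith
  then interpret p: ports E B "{c \<in> C. Inl c \<in> B}" "{v \<in> C. Inl v \<in> nbr B}" "{e \<in> E. e \<subseteq> C}" r t "card (nbr B)"
    using deg pc(2) by (intro ports_of[OF BN cB c rt _ outB]) auto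
  have "(\<exists>y\<in>A. \<exists>y'\<in>A - {y}. \<exists>xs. opath Q y y' xs \<and> t \<le> nv xs) \<or>
     (\<forall>y\<in>A. \<exists>y'\<in>A - {y}. \<exists>xs. opath Q y y' xs \<and> 1 \<le> nv xs \<and> t + 2 \<le> nv xs + card A)"
    using p.long_port_path
  proof
    assume "\<exists>p\<in>nbr B. \<exists>q\<in>nbr B - {p}. \<exists>xs. opath B p q xs \<and> t \<le> nv xs"
    then obtain b b' xs where b: "b \<in> nbr B" "b' \<in> nbr B" "b \<noteq> b'" "opath B b b' xs" "t \<le> nv xs" by blast
    then obtain ys where "opath Q (rep b) (rep b') ys" "t \<le> nv ys" using transfer by metis
    moreover have "rep b \<noteq> rep b'" using inj b unfolding inj_on_def by blast
    moreover have "rep b \<in> A" "rep b' \<in> A" unfolding A_def using b by blast+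
    ultimately show ?thesis by - (rule disjI1, rule bexI[of _ "rep b"], rule bexI[of _ "rep b'"], rule exI[of _ ys], auto)
  next
    assume a: "\<forall>p\<in>nbr B. \<exists>q\<in>nbr B - {p}. \<exists>xs. opath B p q xs \<and> 1 \<le> nv xs \<and> t + 2 \<le> nv xs + card (nbr B)"
    have "\<exists>y'\<in>A - {y}. \<exists>xs. opath Q y y' xs \<and> 1 \<le> nv xs \<and> t + 2 \<le> nv xs + card A" if yA: "y \<in> A" for y
    proof -
      obtain b where b: "b \<in> nbr B" "y = rep b" using yA unfolding A_def by blast
      then obtain b' xs where b': "b' \<in> nbr B" "b' \<noteq> b" "opath B b b' xs" "1 \<le> nv xs" "t + 2 \<le> nv xs + card (nbr B)"
        using a by blast
      then obtain ys where "opath Q y (rep b') ys" "nv ys = nv xs" using transfer[OF b(1) b'(1) _ b'(3)] b by metis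
      moreover have "rep b' \<noteq> y" using inj b b' unfolding inj_on_def by blast
      ultimately show ?thesis using b' cA unfolding A_def by (intro bexI[of _ "rep b'"] exI[of _ ys]) auto
    qed
    then show ?thesis by blast
  qed
  then show ?thesis using A pairs pc(2) cA by (intro exI[of _ A]) auto
qed

text \<open>Long port paths are found in one component only. A second pigeonhole, over the profiles
  of the components, transfers them to another one and supplies the fillers. The final count is
  \<open>2 (t + 2 - card A) + 2 card A - 2 = 2 t + 2 \<ge> k\<close>.\<close>

lemma core_bounded:
  assumes C: "C \<subseteq> V" and rt: "r \<le> t" and kt: "k \<le> 2 * t + 2"
    and deg: "\<And>v. v \<in> C \<Longrightarrow> t choose (r - 1) < card {e \<in> E. e \<subseteq> C \<and> v \<in> e}"
  shows "card C < core_bound k r t"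
proof (rule ccontr)
  let ?L = "4 * k * k + 2"
  assume "\<not> card C < core_bound k r t"
  moreover have "card (Inl ` C \<inter> N) = card C"
  proof -
    have "Inl ` C \<inter> N = Inl ` C" using C by auto
    then show ?thesis by (simp add: card_image)
  qed
  ultimately have big: "many_bound ?L (copies k r t) (?L + 1) \<le> card (Inl ` C \<inter> N)"
    unfolding core_bound_def by linarith
  obtain Y \<Q> where Y: "card Y \<le> ?L + 1" "Y \<subseteq> N" and fQ: "finite \<Q>" and cQ: "copies k r t \<le> card \<Q>"
    and Q: "\<And>Q. Q \<in> \<Q> \<Longrightarrow> conn Q \<and> Q \<subseteq> N \<and> Inl ` C \<inter> Q \<noteq> {} \<and> nbr Q = Y"
    and disj: "\<And>Q Q'. Q \<in> \<Q> \<Longrightarrow> Q' \<in> \<Q> \<Longrightarrow> Q \<noteq> Q' \<Longrightarrow> Q \<inter> Q' = {}"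
    using many_components[OF finN path_bound conn_N nbr_N(2) big] by metis
  have fY: "finite Y" using Y finN finite_subset by blast
  have big4: "r + 4 \<le> card \<Q>" using cQ unfolding copies_def by linarith
  \<comment> \<open>A hyperedge in the common neighbourhood would contain a vertex from each of the
    disjoint components, more than \<open>r\<close> vertices.\<close>
  have YV: "Y \<subseteq> Inl ` V"
  proof
    fix y assume y: "y \<in> Y"
    show "y \<in> Inl ` V"
    proof (cases y)
      case (Inr e)
      then have e: "e \<in> E" using y Y by auto
      have "\<exists>v\<in>e. Inl v \<in> Q" if "Q \<in> \<Q>" for Q
      proof -
        have "y \<in> nbr Q" using Q[OF that] y by simp
        then obtain a where "a \<in> Q" "inc E a (Inr e)" unfolding nbr_def Inr by blast
        then show ?thesis using inc_InrD2 by metis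
      qed
      then obtain f where f: "\<And>Q. Q \<in> \<Q> \<Longrightarrow> f Q \<in> e \<and> Inl (f Q) \<in> Q" by metis
      have "inj_on f \<Q>"
      proof (rule inj_onI)
        fix Q Q' assume q: "Q \<in> \<Q>" "Q' \<in> \<Q>" "f Q = f Q'"
        then have "Inl (f Q) \<in> Q \<inter> Q'" using f[of Q] f[of Q'] by simp
        then show "Q = Q'" using disj[OF q(1,2)] by blast
      qed
      moreover have "finite e" using edge[OF e] finV finite_subset by blast
      ultimately have "card \<Q> \<le> card e" using f by (intro card_inj_on_le[of f]) auto
      then show ?thesis using edge[OF e] big4 by simp
    qed (use y Y in auto)
  qed
  \<comment> \<open>Recording lengths only up to \<open>t\<close> keeps the number of profiles
    finite and independent of the hypergraph; longer paths are never asked for.\<close>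
  define prof where "prof Q = {(y, y', i) \<in> Y \<times> Y \<times> {..t}. \<exists>xs. opath Q y y' xs \<and> i \<le> nv xs}" for Q
  have fP: "finite (Y \<times> Y \<times> {..t})" using fY by simp
  have "card (Pow (Y \<times> Y \<times> {..t})) * (?L + 3) < card \<Q>"
  proof -
    have "card Y * (card Y * (t + 1)) \<le> (?L + 1) * ((?L + 1) * (t + 1))"
      by (intro mult_le_mono Y(1) order_refl)
    then have "card (Y \<times> Y \<times> {..t}) \<le> (?L + 1) * (?L + 1) * (t + 1)"
      by (simp only: card_cartesian_product card_atMost Suc_eq_plus1 mult.assoc)
    then have "card (Pow (Y \<times> Y \<times> {..t})) \<le> 2 ^ ((?L + 1) * (?L + 1) * (t + 1))"
      unfolding card_Pow[OF fP] by (rule power_increasing) simp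
    then have "card (Pow (Y \<times> Y \<times> {..t})) * (?L + 3) \<le> 2 ^ ((?L + 1) * (?L + 1) * (t + 1)) * (?L + 3)" by (rule mult_le_mono1)
    also have "\<dots> < copies k r t" unfolding copies_def by linarith
    finally show ?thesis using cQ by linarith
  qed
  moreover have "prof ` \<Q> \<subseteq> Pow (Y \<times> Y \<times> {..t})" unfolding prof_def by blast
  ultimately obtain B where "?L + 3 < card {Q \<in> \<Q>. prof Q = B}"
    using pigeonhole_fibre[OF fQ _ _, of "Pow (Y \<times> Y \<times> {..t})" prof "?L + 3"] fP by auto
  moreover define \<R> where "\<R> = {Q \<in> \<Q>. prof Q = B}"
  ultimately have cR: "?L + 3 < card \<R>" by simp
  have RQ: "\<R> \<subseteq> \<Q>" and fR: "finite \<R>" unfolding \<R>_def using fQ by auto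
  have same: "\<exists>xs. opath Q' y y' xs \<and> i \<le> nv xs"
    if "opath Q y y' xs" "i \<le> nv xs" "Q \<in> \<R>" "Q' \<in> \<R>" "y \<in> Y" "y' \<in> Y" "i \<le> t" for Q Q' y y' i xs
  proof -
    have "(y, y', i) \<in> prof Q" using that unfolding prof_def by blast
    then have "(y, y', i) \<in> prof Q'" using that unfolding \<R>_def by simp
    then show ?thesis unfolding prof_def by blast
  qed
  have QY: "Q \<inter> Y = {}" if "Q \<in> \<Q>" for Q using Q[OF that] unfolding nbr_def by blast
  obtain Q0 where Q0: "Q0 \<in> \<R>" using cR by (metis card.empty ex_in_conv not_less_zero)
  obtain Q1 where Q1: "Q1 \<in> \<R> - {Q0}"
  proof -
    have "card (\<R> - {Q0}) \<noteq> 0" using cR Q0 fR by simp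
    then show ?thesis using that by (metis card.empty ex_in_conv)
  qed
  have d01: "Q0 \<inter> Q1 = {}" using disj Q0 Q1 RQ by blast
  have Q0': "Q0 \<in> \<Q>" "Q1 \<in> \<Q>" using Q0 Q1 RQ by auto
  \<comment> \<open>Two copies of a path with \<open>t\<close> vertices and their two ports form a
    cycle with at least \<open>2 t + 2\<close> vertices.\<close>
  have twice: False if y: "y \<in> Y" "y' \<in> Y" "y \<noteq> y'" and xs: "opath Q0 y y' xs" "t \<le> nv xs" for y y' xs
  proof -
    obtain ys where ys: "opath Q1 y y' ys" "t \<le> nv ys" using same[OF xs Q0 _ y(1,2)] Q1 by blast
    let ?s = "[(y, xs), (y', rev ys)]"
    have r: "opath Q1 y' y (rev ys)" using ys opath_rev by blast
    have X: "set xs \<subseteq> Q0" "set ys \<subseteq> Q1" using xs ys unfolding opath_def by auto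
    have "distinct (flat ?s)"
      using opath_linked[OF xs(1)] opath_linked[OF r] X y QY[OF Q0'(1)] QY[OF Q0'(2)] d01 by auto
    then have "cyc (flat ?s)" using opath_linked[OF xs(1)] opath_linked[OF r] by (intro linked_cyc) auto
    then have "nv (flat ?s) < k" by (rule cyc_short)
    moreover have "isl y" "isl y'" using y YV by auto
    ultimately show False using xs ys kt by (auto simp: nv_def rev_filter[symmetric])
  qed
  obtain c0 where c0: "c0 \<in> C" "Inl c0 \<in> Q0" using Q[OF Q0'(1)] by blast
  have out: "\<exists>y\<in>N - Q0. y \<noteq> w" for w
  proof -
    have "card (\<R> - {Q0, Q1}) \<noteq> 0" using cR Q0 Q1 fR by (auto simp: card_Diff_subset card_insert_if)
    then obtain Q2 where Q2: "Q2 \<in> \<R> - {Q0, Q1}" by (metis card.empty ex_in_conv)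
    then have Q2': "Q2 \<in> \<Q>" "Q2 \<noteq> Q0" "Q2 \<noteq> Q1" using RQ by auto
    obtain c1 c2 where c: "c1 \<in> Q1" "c2 \<in> Q2" using Q[OF Q0'(2)] Q[OF Q2'(1)] by blast
    have "c1 \<noteq> c2" using disj[OF Q0'(2) Q2'(1)] Q2' c by blast
    moreover have "c1 \<in> N - Q0" using c d01 Q[OF Q0'(2)] by blast
    moreover have "c2 \<in> N - Q0" using c disj[OF Q0'(1) Q2'(1)] Q2' Q[OF Q2'(1)] by blast
    ultimately show ?thesis by metis
  qed
  obtain A where A: "A \<subseteq> Y" "2 \<le> card A"
    and pairs: "\<And>y y'. y \<in> A \<Longrightarrow> y' \<in> A \<Longrightarrow> y \<noteq> y' \<Longrightarrow> \<exists>xs. opath Q0 y y' xs \<and> 1 \<le> nv xs"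
    and alt: "(\<exists>y\<in>A. \<exists>y'\<in>A - {y}. \<exists>xs. opath Q0 y y' xs \<and> t \<le> nv xs) \<or>
     (\<forall>y\<in>A. \<exists>y'\<in>A - {y}. \<exists>xs. opath Q0 y y' xs \<and> 1 \<le> nv xs \<and> t + 2 \<le> nv xs + card A)"
  proof -
    have q: "Q0 \<subseteq> N" "conn Q0" "nbr Q0 = Y" using Q[OF Q0'(1)] by simp_all
    have "\<exists>A\<subseteq>Y. 2 \<le> card A \<and> (\<forall>y\<in>A. \<forall>y'\<in>A. y \<noteq> y' \<longrightarrow> (\<exists>xs. opath Q0 y y' xs \<and> 1 \<le> nv xs)) \<and>
    ((\<exists>y\<in>A. \<exists>y'\<in>A - {y}. \<exists>xs. opath Q0 y y' xs \<and> t \<le> nv xs) \<or>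
     (\<forall>y\<in>A. \<exists>y'\<in>A - {y}. \<exists>xs. opath Q0 y y' xs \<and> 1 \<le> nv xs \<and> t + 2 \<le> nv xs + card A))"
      by (rule good_ports[OF q YV c0 C rt deg out])
    then show ?thesis by (elim exE conjE) (rule that, auto)
  qed
  have t1: "1 \<le> t" using rt r3 by simp
  from alt show False
  proof
    assume "\<exists>y\<in>A. \<exists>y'\<in>A - {y}. \<exists>xs. opath Q0 y y' xs \<and> t \<le> nv xs"
    then show False using twice A by blast
  next
    assume a: "\<forall>y\<in>A. \<exists>y'\<in>A - {y}. \<exists>xs. opath Q0 y y' xs \<and> 1 \<le> nv xs \<and> t + 2 \<le> nv xs + card A"
    have fA: "finite A" using A fY finite_subset by blast
    obtain y1 where y1: "y1 \<in> A" using A by fastforce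
    obtain y2 xs where y2: "y2 \<in> A" "y2 \<noteq> y1" "opath Q0 y1 y2 xs" "1 \<le> nv xs" "t + 2 \<le> nv xs + card A" using a y1 by blast
    show False
    proof (cases "card A = 2")
      case True
      then show False using twice[of y1 y2 xs] y1 y2 A by auto
    next
      case False
      have "card (A - {y1, y2}) \<noteq> 0" using False A y1 y2 fA by (auto simp: card_Diff_subset card_insert_if)
      then obtain y3 where y3: "y3 \<in> A" "y3 \<noteq> y1" "y3 \<noteq> y2" by (metis DiffE card.empty ex_in_conv insertCI)
      then obtain y4 ys where y4: "y4 \<in> A" "y4 \<noteq> y3" "opath Q0 y3 y4 ys" "1 \<le> nv ys" "t + 2 \<le> nv ys + card A" using a by blast
      \<comment> \<open>The length that both special paths have in common. It is at most
        \<open>t\<close> because \<open>card A\<close> is at least 2, so the profile carries it over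
        to \<open>Q1\<close>.\<close>
      define i where "i = max 1 (t + 2 - card A)"
      have i: "i \<le> nv xs" "i \<le> nv ys" "i \<le> t" unfolding i_def using y2 y4 A t1 by auto
      obtain zs where zs: "opath Q1 y3 y4 zs" "i \<le> nv zs"
        using same[OF y4(3) i(2) Q0 _ _ _ i(3)] Q1 y3 y4 A by blast
      let ?F = "\<R> - {Q0, Q1}"
      have "\<exists>c. cyc c \<and> nv xs + nv zs + 2 * card A \<le> nv c + 2"
      proof (rule two_special[where X = Q0 and Y = Q1 and \<Q> = ?F])
        show "A \<subseteq> range Inl" using A YV by auto
        show "{y1, y2} \<noteq> {y3, y4}" using y3 by auto
        show "card A \<le> card ?F"
        proof -
          have "card A \<le> card Y" using A fY by (intro card_mono)
          moreover have "card ?F = card \<R> - 2" using Q0 Q1 fR by (auto simp: card_Diff_subset card_insert_if)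
          ultimately show ?thesis using cR Y(1) by linarith
        qed
        show "Q0 \<inter> A = {}" "Q1 \<inter> A = {}" using QY Q0' A by blast+
        show "\<Union>?F \<inter> A = {}" using QY RQ A by blast
        show "\<Union>?F \<inter> (set xs \<union> set zs) = {}"
        proof -
          have "set xs \<subseteq> Q0" "set zs \<subseteq> Q1" using y2 zs unfolding opath_def by auto
          moreover have "Q \<inter> Q0 = {}" "Q \<inter> Q1 = {}" if "Q \<in> ?F" for Q
            using disj[of Q Q0] disj[of Q Q1] that Q0' RQ by auto
          ultimately show ?thesis by blast
        qed
        show "\<exists>xs. opath Q y y' xs \<and> 1 \<le> nv xs" if q: "Q \<in> ?F" and yy: "y \<in> A" "y' \<in> A" "y \<noteq> y'" for Q y y'
        proof -
          obtain us where "opath Q0 y y' us" "1 \<le> nv us" using pairs[OF yy] by blast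
          then show ?thesis using same[of Q0 y y' us 1 Q] Q0 q yy A t1 by blast
        qed
        show "Q \<inter> Q' = {}" if "Q \<in> ?F" "Q' \<in> ?F" "Q \<noteq> Q'" for Q Q' using disj that RQ by blast
      qed (use fA y1 y2 y3 y4 zs d01 fR in auto)
      then obtain c where c: "cyc c" "nv xs + nv zs + 2 * card A \<le> nv c + 2" by blast
      have "2 * i + 2 * card A \<ge> 2 * t + 4" unfolding i_def using A by auto
      then show False using cyc_short(2)[OF c(1)] c(2) i zs kt by linarith
    qed
  qed
qed

end

section \<open>A large set of vertices with a common link\<close>

text \<open>Vertices outside the protected set \<open>A\<close> are removed while their degree is at
  most \<open>d\<close>; \<open>\<rho>\<close> is the time of removal. The hyperedges lost with
  \<open>v\<close> are then those at \<open>v\<close> in which every vertex outside \<open>C\<close>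
  has rank at least that of \<open>v\<close>.\<close>

lemma peel:
  fixes E :: "'a set set"
  assumes "finite V" "finite E" "\<forall>e\<in>E. e \<subseteq> V" "A \<subseteq> V"
  shows "\<exists>C (\<rho> :: 'a \<Rightarrow> nat). A \<subseteq> C \<and> C \<subseteq> V \<and> inj_on \<rho> (V - C) \<and>
    (\<forall>v\<in>C - A. d < card {e \<in> E. e \<subseteq> C \<and> v \<in> e}) \<and>
    (\<forall>v\<in>V - C. card {e \<in> E. v \<in> e \<and> (\<forall>u\<in>e - C. \<rho> v \<le> \<rho> u)} \<le> d)"
  using assms
proof (induction "card V" arbitrary: V E rule: less_induct)
  case less
  show ?case
  proof (cases "\<exists>v\<in>V - A. card {e \<in> E. v \<in> e} \<le> d")
    case False
    have "{e \<in> E. e \<subseteq> V \<and> v \<in> e} = {e \<in> E. v \<in> e}" for v using less.prems(3) by blast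
    then have "\<forall>v\<in>V - A. d < card {e \<in> E. e \<subseteq> V \<and> v \<in> e}" using False by (simp add: not_le)
    then show ?thesis using less.prems(4) by (intro exI[of _ V] exI[of _ "\<lambda>_. 0"]) auto
  next
    case True
    then obtain v where v: "v \<in> V" "v \<notin> A" "card {e \<in> E. v \<in> e} \<le> d" by blast
    let ?E = "{e \<in> E. v \<notin> e}"
    have "card (V - {v}) < card V" using v less.prems(1) by (intro card_Diff1_less)
    then have "\<exists>C (\<rho> :: 'a \<Rightarrow> nat). A \<subseteq> C \<and> C \<subseteq> V - {v} \<and> inj_on \<rho> (V - {v} - C) \<and>
      (\<forall>v\<in>C - A. d < card {e \<in> ?E. e \<subseteq> C \<and> v \<in> e}) \<and>
      (\<forall>u\<in>V - {v} - C. card {e \<in> ?E. u \<in> e \<and> (\<forall>x\<in>e - C. \<rho> u \<le> \<rho> x)} \<le> d)"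
      using less.prems v by (intro less.hyps) auto
    then obtain C and \<rho> :: "'a \<Rightarrow> nat" where C: "A \<subseteq> C" "C \<subseteq> V - {v}" "inj_on \<rho> (V - {v} - C)"
      "\<And>v'. v' \<in> C - A \<Longrightarrow> d < card {e \<in> ?E. e \<subseteq> C \<and> v' \<in> e}"
      "\<And>u. u \<in> V - {v} - C \<Longrightarrow> card {e \<in> ?E. u \<in> e \<and> (\<forall>x\<in>e - C. \<rho> u \<le> \<rho> x)} \<le> d"
      by (elim exE conjE) (rule that, auto)
    define \<rho>' where "\<rho>' u = (if u = v then 0 else Suc (\<rho> u))" for u
    have "inj_on \<rho>' (V - C)" using C(3) unfolding \<rho>'_def inj_on_def by auto
    moreover have "d < card {e \<in> E. e \<subseteq> C \<and> v' \<in> e}" if "v' \<in> C - A" for v'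
    proof -
      have "{e \<in> ?E. e \<subseteq> C \<and> v' \<in> e} = {e \<in> E. e \<subseteq> C \<and> v' \<in> e}" using C(2) by blast
      then show ?thesis using C(4)[OF that] by simp
    qed
    moreover have "card {e \<in> E. u \<in> e \<and> (\<forall>x\<in>e - C. \<rho>' u \<le> \<rho>' x)} \<le> d" if u: "u \<in> V - C" for u
    proof (cases "u = v")
      case True
      have "card {e \<in> E. u \<in> e \<and> (\<forall>x\<in>e - C. \<rho>' u \<le> \<rho>' x)} \<le> card {e \<in> E. v \<in> e}"
        using less.prems(2) True by (intro card_mono) auto
      then show ?thesis using v by simp
    next
      case False
      have "v \<notin> C" using C(2) by blast
      then have "{e \<in> E. u \<in> e \<and> (\<forall>x\<in>e - C. \<rho>' u \<le> \<rho>' x)} \<subseteq> {e \<in> ?E. u \<in> e \<and> (\<forall>x\<in>e - C. \<rho> u \<le> \<rho> x)}"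
        using False unfolding \<rho>'_def by (auto split: if_splits)
      then have "card {e \<in> E. u \<in> e \<and> (\<forall>x\<in>e - C. \<rho>' u \<le> \<rho>' x)} \<le> card {e \<in> ?E. u \<in> e \<and> (\<forall>x\<in>e - C. \<rho> u \<le> \<rho> x)}"
        using less.prems(2) by (intro card_mono) auto
      then show ?thesis using C(5)[of u] u False by simp
    qed
    moreover have "C \<subseteq> V" using C(2) by blast
    ultimately show ?thesis using C(1) by (intro exI[of _ C] exI[of _ \<rho>']) simp
  qed
qed

text \<open>A hyperedge not contained in \<open>C\<close> is charged to its vertex of least rank
  outside \<open>C\<close>.\<close>

lemma peel_card:
  fixes \<rho> :: "'a \<Rightarrow> nat"
  assumes "finite V" "finite E" "\<forall>e\<in>E. e \<subseteq> V"
  shows "card E \<le> card {e \<in> E. e \<subseteq> C} + (\<Sum>v\<in>V - C. card {e \<in> E. v \<in> e \<and> (\<forall>u\<in>e - C. \<rho> v \<le> \<rho> u)})"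
proof -
  let ?Ev = "\<lambda>v. {e \<in> E. v \<in> e \<and> (\<forall>u\<in>e - C. \<rho> v \<le> \<rho> u)}"
  have "E \<subseteq> {e \<in> E. e \<subseteq> C} \<union> (\<Union>v\<in>V - C. ?Ev v)"
  proof
    fix e assume e: "e \<in> E"
    show "e \<in> {e \<in> E. e \<subseteq> C} \<union> (\<Union>v\<in>V - C. ?Ev v)"
    proof (cases "e \<subseteq> C")
      case False
      then obtain v where v: "v \<in> e - C" by blast
      obtain u where "u \<in> e - C" "\<And>x. x \<in> e - C \<Longrightarrow> \<rho> u \<le> \<rho> x"
        using ex_has_least_nat[of "\<lambda>u. u \<in> e - C" v \<rho>] v by blast
      then have "u \<in> V - C" "e \<in> ?Ev u" using e assms(3) by blast+
      then show ?thesis by blast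
    qed (use e in blast)
  qed
  then have "card E \<le> card ({e \<in> E. e \<subseteq> C} \<union> (\<Union>v\<in>V - C. ?Ev v))"
    using assms(1,2) by (intro card_mono) auto
  also have "\<dots> \<le> card {e \<in> E. e \<subseteq> C} + card (\<Union>v\<in>V - C. ?Ev v)" by (rule card_Un_le)
  also have "card (\<Union>v\<in>V - C. ?Ev v) \<le> (\<Sum>v\<in>V - C. card (?Ev v))" using assms(1) by (intro card_UN_le) simp
  finally show ?thesis by simp
qed

text \<open>A vertex that enters a level has all its peeled hyperedges, apart from itself, inside
  the previous level. If that level has size \<open>b\<close>, there are at most
  \<open>2 ^ (2 ^ b)\<close> such links and, in the absence of a frequent one, at most
  \<open>M\<close> vertices for each.\<close>

fun level_bound :: "nat \<Rightarrow> nat \<Rightarrow> nat \<Rightarrow> nat" where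
  "level_bound M b 0 = b"
| "level_bound M b (Suc i) = level_bound M b i + 2 ^ (2 ^ level_bound M b i) * M"

text \<open>A vertex outside level \<open>2 * k * k + 1\<close> starts a path with
  \<open>2 * (2 * k * k + 1) + 1\<close> nodes, one more than any path can have. The base counts the
  core and the vertices that are removed with fewer than \<open>d\<close> hyperedges.\<close>

definition link_bound :: "nat \<Rightarrow> nat \<Rightarrow> nat \<Rightarrow> nat \<Rightarrow> nat \<Rightarrow> nat" where
  "link_bound k r t c M = level_bound M (core_bound k r t + 2 ^ core_bound k r t + c) (2 * k * k + 1)"

context twoconn
begin

text \<open>Peel off vertices of degree at most \<open>d\<close>. Only boundedly many of them lose fewer than \<open>d\<close> hyperedges.
  If every link were rare, the levels \<open>B i\<close> of vertices whose hyperedges lie in the previous level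
  would be small, and a vertex outside many levels would start a long path of increasing rank.\<close>

lemma common_link:
  assumes rt: "r \<le> t" and kt: "k \<le> 2 * t + 2" and big: "(t choose (r - 1)) * card V < card E + c"
    and n: "link_bound k r t c M < card V"
  shows "\<exists>F W. card F = t choose (r - 1) \<and> (\<forall>f\<in>F. f \<subseteq> V \<and> card f = r - 1) \<and> W \<subseteq> V \<and> M < card W \<and>
    W \<inter> \<Union>F = {} \<and> (\<forall>w\<in>W. \<forall>f\<in>F. insert w f \<in> E)"
proof (rule ccontr)
  assume no: "\<not> ?thesis"
  define d where "d = t choose (r - 1)"
  have EV: "\<forall>e\<in>E. e \<subseteq> V" using edge by blast
  obtain C and \<rho> :: "'a \<Rightarrow> nat" where C: "C \<subseteq> V" "inj_on \<rho> (V - C)"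
      "\<And>v. v \<in> C \<Longrightarrow> d < card {e \<in> E. e \<subseteq> C \<and> v \<in> e}"
      "\<And>v. v \<in> V - C \<Longrightarrow> card {e \<in> E. v \<in> e \<and> (\<forall>u\<in>e - C. \<rho> v \<le> \<rho> u)} \<le> d"
    using peel[OF finV finE EV empty_subsetI, of d] by (elim exE conjE) (rule that, auto)
  define Ev where "Ev v = {e \<in> E. v \<in> e \<and> (\<forall>u\<in>e - C. \<rho> v \<le> \<rho> u)}" for v
  define Df where "Df = {v \<in> V - C. card (Ev v) < d}"
  have cC: "card C < core_bound k r t" using core_bounded[OF C(1) rt kt] C(3) unfolding d_def by simp
  have fC: "finite C" using C(1) finV finite_subset by blast
  have "card {e \<in> E. e \<subseteq> C} \<le> card (Pow C)" using fC by (intro card_mono) auto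
  also have "\<dots> \<le> 2 ^ core_bound k r t" unfolding card_Pow[OF fC] using cC by (intro power_increasing) auto
  finally have eC: "card {e \<in> E. e \<subseteq> C} \<le> 2 ^ core_bound k r t" .
  \<comment> \<open>Every removed vertex accounts for at most \<open>d\<close> hyperedges, and a
    deficient one for fewer. As the total misses \<open>d * card V\<close> by less than
    \<open>c\<close>, and the core contributes a bounded number, there are few deficient
    vertices.\<close>
  have cDf: "card Df \<le> 2 ^ core_bound k r t + c"
  proof -
    have "(\<Sum>v\<in>V - C. card (Ev v)) + card Df = (\<Sum>v\<in>V - C. card (Ev v) + (if card (Ev v) < d then 1 else 0))"
      unfolding Df_def sum.distrib using finV by (simp add: sum.inter_filter[symmetric])
    also have "\<dots> \<le> (\<Sum>v\<in>V - C. d)" using C(4) unfolding Ev_def by (intro sum_mono) auto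
    also have "\<dots> \<le> d * card V" using card_mono[of V "V - C"] finV by simp
    finally have "(\<Sum>v\<in>V - C. card (Ev v)) + card Df \<le> d * card V" .
    moreover have "card E \<le> card {e \<in> E. e \<subseteq> C} + (\<Sum>v\<in>V - C. card (Ev v))"
      unfolding Ev_def by (rule peel_card[OF finV finE EV])
    ultimately show ?thesis using big eC unfolding d_def by linarith
  qed
  define B where "B i = ((\<lambda>X. X \<union> {v \<in> V. \<Union>(Ev v) \<subseteq> insert v X}) ^^ i) (C \<union> Df)" for i
  have BS: "B (Suc i) = B i \<union> {v \<in> V. \<Union>(Ev v) \<subseteq> insert v (B i)}" for i unfolding B_def by simp
  have B0: "B 0 = C \<union> Df" unfolding B_def by simp
  have BV: "B i \<subseteq> V" for i
  proof (induction i)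
    case 0
    then show ?case unfolding B0 Df_def using C(1) by blast
  next
    case (Suc i)
    then show ?case unfolding BS by blast
  qed
  have CB: "C \<union> Df \<subseteq> B i" for i by (induction i) (simp add: B0, use BS in blast)
  have fB: "finite (B i)" for i using BV finV finite_subset by blast
  have step: "card (B (Suc i)) \<le> card (B i) + 2 ^ (2 ^ card (B i)) * M" for i
  proof -
    define D where "D = {v \<in> V - B i. \<Union>(Ev v) \<subseteq> insert v (B i)}"
    have fD: "finite D" unfolding D_def using finV by simp
    have "card D \<le> 2 ^ (2 ^ card (B i)) * M"
    proof (rule ccontr)
      assume "\<not> ?thesis"
      then have "card (Pow (Pow (B i))) * M < card D" using fB by (simp add: card_Pow)
      moreover define g where "g v = (\<lambda>e. e - {v}) ` Ev v" for v
      have "g ` D \<subseteq> Pow (Pow (B i))"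
      proof
        fix G assume "G \<in> g ` D"
        then obtain v where v: "v \<in> D" "G = g v" by blast
        have "e - {v} \<subseteq> B i" if "e \<in> Ev v" for e using v(1) that unfolding D_def by blast
        then show "G \<in> Pow (Pow (B i))" unfolding v(2) g_def by blast
      qed
      ultimately obtain F where F: "F \<in> Pow (Pow (B i))" "M < card {v \<in> D. g v = F}"
        using pigeonhole_fibre[of D "Pow (Pow (B i))" g M] fD fB by auto
      define W where "W = {v \<in> D. g v = F}"
      have W: "M < card W" "W \<subseteq> D" using F unfolding W_def by auto
      then obtain w where w: "w \<in> W" by (metis card.empty ex_in_conv not_less_zero)
      have gF: "g v = F" "v \<in> V" "v \<notin> B i" if "v \<in> W" for v using that unfolding W_def D_def by auto
      have we: "w' \<in> e" "e \<in> E" if "e \<in> Ev w'" for w' e using that unfolding Ev_def by auto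
      have "inj_on (\<lambda>e. e - {w}) (Ev w)"
      proof (rule inj_onI)
        fix e e' assume "e \<in> Ev w" "e' \<in> Ev w" "e - {w} = e' - {w}"
        then show "e = e'" using we by blast
      qed
      then have "card F = card (Ev w)" using gF(1)[OF w] unfolding g_def by (metis card_image)
      moreover have wC: "w \<in> V - C" "w \<notin> Df" using gF(2,3)[OF w] CB[of i] by auto
      moreover have "card (Ev w) \<le> d" using C(4)[OF wC(1)] unfolding Ev_def .
      ultimately have cF: "card F = t choose (r - 1)" unfolding Df_def d_def by simp
      have F1: "f \<subseteq> V \<and> card f = r - 1" if fF: "f \<in> F" for f
      proof -
        obtain e where e: "e \<in> Ev w" "f = e - {w}" using fF gF(1)[OF w] unfolding g_def by blast
        then have "w \<in> e" "e \<subseteq> V" "card e = r" using we edge by blast+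
        then show ?thesis using e(2) by auto
      qed
      have F2: "insert w' f \<in> E" if fF: "f \<in> F" and w': "w' \<in> W" for f w'
      proof -
        obtain e where e: "e \<in> Ev w'" "f = e - {w'}" using fF gF(1)[OF w'] unfolding g_def by blast
        then have "insert w' f = e" using we by blast
        then show ?thesis using we(2)[OF e(1)] by simp
      qed
      have "\<Union>F \<subseteq> B i" using F(1) by blast
      then have "W \<inter> \<Union>F = {}" using gF(3) by blast
      moreover have "W \<subseteq> V" using gF(2) by blast
      ultimately show False using no cF F1 F2 W(1) by blast
    qed
    moreover have "B (Suc i) = B i \<union> D" unfolding BS D_def by blast
    ultimately show ?thesis using card_Un_le[of "B i" D] by simp
  qed
  let ?b = "core_bound k r t + 2 ^ core_bound k r t + c"
  have Bb: "card (B i) \<le> level_bound M ?b i" for i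
  proof (induction i)
    case 0
    have "card (B 0) \<le> card C + card Df" unfolding B0 by (rule card_Un_le)
    then show ?case using cC cDf by simp
  next
    case (Suc i)
    have "(2::nat) ^ (2 ^ card (B i)) * M \<le> 2 ^ (2 ^ level_bound M ?b i) * M"
      using Suc by (intro mult_le_mono1 power_increasing) auto
    then show ?case using step[of i] Suc unfolding level_bound.simps by linarith
  qed
  \<comment> \<open>The condition on ranks makes the extended list distinct: \<open>v\<close> has
    smaller rank than everything on the path from \<open>u\<close>, and \<open>e\<close> contains
    \<open>v\<close>, whereas the hyperedges of that path have no vertex of so small a rank outside
    \<open>C\<close>.\<close>
  have path: "\<exists>P. pth P \<and> hd P = Inl v \<and> set P \<subseteq> N \<and> length P = 2 * i + 1 \<and> (\<forall>u. Inl u \<in> set P \<longrightarrow> \<rho> v \<le> \<rho> u) \<and>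
     (\<forall>e. Inr e \<in> set P \<longrightarrow> (\<forall>x\<in>e - C. \<rho> v \<le> \<rho> x))" if "v \<in> V - B i" for i v
    using that
  proof (induction i arbitrary: v)
    case 0
    then show ?case by (intro exI[of _ "[Inl v]"]) (auto simp: pth_def)
  next
    case (Suc i)
    have vC: "v \<in> V" "v \<notin> C" using Suc.prems CB[of "Suc i"] by auto
    have "\<not> \<Union>(Ev v) \<subseteq> insert v (B i)" using Suc.prems unfolding BS by blast
    then obtain e u where e: "e \<in> Ev v" "u \<in> e" "u \<noteq> v" "u \<notin> B i" by blast
    then have eE: "e \<in> E" "v \<in> e" "\<And>x. x \<in> e - C \<Longrightarrow> \<rho> v \<le> \<rho> x" unfolding Ev_def by auto
    have u: "u \<in> V - B i" "u \<notin> C" using e eE(1) edgeV CB[of i] by auto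
    have "\<rho> v \<noteq> \<rho> u" using C(2) vC u e(3) unfolding inj_on_def by blast
    then have less: "\<rho> v < \<rho> u" using eE(3)[of u] e u by simp
    obtain P where P: "pth P" "hd P = Inl u" "set P \<subseteq> N" "length P = 2 * i + 1"
      "\<And>x. Inl x \<in> set P \<Longrightarrow> \<rho> u \<le> \<rho> x" "\<And>e x. Inr e \<in> set P \<Longrightarrow> x \<in> e - C \<Longrightarrow> \<rho> u \<le> \<rho> x"
      using Suc.IH[OF u(1)] by (elim exE conjE) (rule that, auto)
    have "Inl v \<notin> set P" using P(5)[of v] less by auto
    moreover have "Inr e \<notin> set P" using P(6)[of e v] less eE(2) vC by auto
    ultimately have "pth (Inl v # Inr e # P)" using P(1,2) eE(1,2) e(2) unfolding pth_def by (auto simp: successively_Cons)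
    moreover have "set (Inl v # Inr e # P) \<subseteq> N" using P(3) vC eE by auto
    moreover have "\<rho> v \<le> \<rho> x" if "Inl x \<in> set (Inl v # Inr e # P)" for x using P(5)[of x] less that by auto
    moreover have "\<rho> v \<le> \<rho> x" if "Inr e' \<in> set (Inl v # Inr e # P)" "x \<in> e' - C" for e' x
      using P(6)[of e' x] less that eE(3)[of x] by auto
    ultimately show ?case using P(4) by (intro exI[of _ "Inl v # Inr e # P"]) simp
  qed
  have "card (B (2 * k * k + 1)) < card V" using Bb[of "2 * k * k + 1"] n unfolding link_bound_def by linarith
  then obtain v where "v \<in> V - B (2 * k * k + 1)" using fB card_mono[of "B (2 * k * k + 1)" V] by (metis DiffI not_le subsetI)
  then obtain P where "pth P" "set P \<subseteq> N" "length P = 2 * (2 * k * k + 1) + 1" using path by metis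
  then show False using path_bound[of P] by simp
qed

end

section \<open>A common link lives on exactly t vertices\<close>

lemma successively_closed:
  assumes "distinct ys" "2 \<le> length ys" "\<And>a b. a \<in> set ys \<Longrightarrow> b \<in> set ys \<Longrightarrow> a \<noteq> b \<Longrightarrow> R a b"
  shows "successively R (ys @ [hd ys])"
proof -
  have s: "successively R zs" if "distinct zs" "set zs \<subseteq> set ys" for zs
    using that
  proof (induction zs)
    case (Cons z zs)
    then show ?case using assms(3)[of z "hd zs"] by (cases zs) (auto simp: successively_Cons)
  qed simp
  have "hd ys \<noteq> last ys"
  proof -
    obtain a b zs where y: "ys = a # b # zs" using assms(2) by (metis Suc_le_length_iff numeral_2_eq_2)
    have "last (b # zs) \<in> set (b # zs)" by (rule last_in_set) simp
    then show ?thesis using assms(1) y by auto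
  qed
  moreover have "ys \<noteq> []" using assms(2) by auto
  ultimately show ?thesis using s[OF assms(1)] assms(3)[of "last ys" "hd ys"] by (auto simp: successively_append_iff)
qed

text \<open>For \<open>e\<close> below \<open>t\<close>, each of the \<open>e\<close> units
  exchanged for a smaller upper index loses: Pascal's rule gives at least \<open>m = t - e\<close>
  for the first step and at least 1 for each later one, and \<open>m \<ge> 2\<close>.\<close>

lemma choose_private:
  fixes t r e :: nat
  assumes "3 \<le> r" "r \<le> t" "1 \<le> e" "e \<le> t" "t choose (r - 1) \<le> e + ((t - e) choose (r - 1))"
  shows "e = t"
proof (rule ccontr)
  assume "e \<noteq> t"
  then have e: "e < t" using assms by simp
  show False
  proof (cases "r - 1 \<le> t - e")
    case True
    define m s where "m = t - e" and "s = r - 2"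
    have r: "r - 1 = Suc s" and s: "1 \<le> s" "s < m" and t: "t = Suc m + (e - 1)"
      using True assms e unfolding m_def s_def by auto
    have "m + ((m) choose Suc s) \<le> Suc m choose Suc s" using choose_ge_self[OF s] by simp
    moreover have "(Suc m choose Suc s) + (e - 1) \<le> t choose Suc s"
      unfolding t by (rule choose_add_le) (use s in simp)
    moreover have "2 \<le> m" using s by simp
    ultimately show False using assms(3,5) unfolding r m_def[symmetric] by linarith
  next
    case False
    then have "(t - e) choose (r - 1) = 0" by (simp add: binomial_eq_0)
    then show False using pascal_t(5)[OF assms(1,2)] assms(5) e by linarith
  qed
qed

text \<open>Two vertices of the union fail to lie in two different members of \<open>F\<close> only
  if both are private to the same member. Taking the non-private vertices and one private vertex
  from each member that has any gives a set in which all pairs are admissible. If this set is too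
  small, counting forces \<open>F\<close> to consist of \<open>t\<close> disjoint sets, and a second
  vertex of one of them is added.\<close>

lemma good_order:
  fixes F :: "'a set set"
  assumes rt: "3 \<le> r" "r \<le> t" and F: "finite F" "card F = t choose (r - 1)" "\<And>f. f \<in> F \<Longrightarrow> finite f \<and> card f = r - 1"
    and A: "t < card (\<Union>F)"
  shows "\<exists>ys. distinct ys \<and> set ys \<subseteq> \<Union>F \<and> t < length ys \<and>
    successively (\<lambda>a b. \<exists>f\<in>F. \<exists>f'\<in>F. f \<noteq> f' \<and> a \<in> f \<and> b \<in> f') (ys @ [hd ys])"
proof -
  define R where "R a b \<longleftrightarrow> (\<exists>f\<in>F. \<exists>f'\<in>F. f \<noteq> f' \<and> a \<in> f \<and> b \<in> f')" for a b
  define priv where "priv a f \<longleftrightarrow> f \<in> F \<and> a \<in> f \<and> (\<forall>g\<in>F. a \<in> g \<longrightarrow> g = f)" for a f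
  have fA: "finite (\<Union>F)" using F by blast
  have R: "R a b" if ab: "a \<in> \<Union>F" "b \<in> \<Union>F" "\<not> (\<exists>f. priv a f \<and> priv b f)" for a b
  proof -
    obtain f g where f: "f \<in> F" "a \<in> f" "g \<in> F" "b \<in> g" using ab(1,2) by blast
    show ?thesis
    proof (cases "f = g")
      case False
      then show ?thesis unfolding R_def using f by blast
    next
      case True
      have "\<not> priv a f \<or> \<not> priv b f" using ab(3) by blast
      then obtain h where "h \<in> F" "h \<noteq> f" "a \<in> h \<or> b \<in> h" unfolding priv_def using f True by metis
      then show ?thesis unfolding R_def using f True by metis
    qed
  qed
  define U where "U = {a \<in> \<Union>F. \<not> (\<exists>f. priv a f)}"
  define G where "G = {f \<in> F. \<exists>a. priv a f}"
  define rep where "rep f = (SOME a. priv a f)" for f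
  have rep: "priv (rep f) f" if "f \<in> G" for f
    unfolding rep_def using that unfolding G_def by (auto intro: someI)
  have uniq: "f = g" if "priv a f" "priv a g" for a f g using that unfolding priv_def by blast
  have inj: "inj_on rep G"
  proof (rule inj_onI)
    fix f g assume fg: "f \<in> G" "g \<in> G" "rep f = rep g"
    show "f = g" using rep[OF fg(1)] rep[OF fg(2)] unfolding fg(3) by (rule uniq)
  qed
  define Y where "Y = U \<union> rep ` G"
  have repA: "rep f \<in> \<Union>F" if "f \<in> G" for f using rep[OF that] unfolding priv_def by blast
  have YA: "Y \<subseteq> \<Union>F" unfolding Y_def U_def using repA by blast
  have fG: "finite G" unfolding G_def using F(1) by simp
  have fU: "finite U" by (rule finite_subset[OF _ fA]) (auto simp: U_def)
  have "U \<inter> rep ` G = {}" unfolding U_def using rep by blast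
  then have cY: "card Y = card U + card G" unfolding Y_def using fG fU inj by (simp add: card_Un_disjoint card_image)
  have YR: "R a b" if ab: "a \<in> Y" "b \<in> Y" "a \<noteq> b" for a b
  proof (rule R)
    show "a \<in> \<Union>F" "b \<in> \<Union>F" using ab YA by auto
    show "\<not> (\<exists>f. priv a f \<and> priv b f)"
    proof
      assume "\<exists>f. priv a f \<and> priv b f"
      then obtain f where f: "priv a f" "priv b f" by blast
      then obtain g h where gh: "g \<in> G" "h \<in> G" "a = rep g" "b = rep h" using ab(1,2) unfolding Y_def U_def by blast
      then have "g = f" "h = f" using uniq f rep by metis+
      then show False using gh ab(3) by simp
    qed
  qed
  have goal: ?thesis if "distinct ys" "set ys \<subseteq> \<Union>F" "t < length ys" "successively R (ys @ [hd ys])" for ys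
    using that unfolding R_def by blast
  show ?thesis
  proof (cases "t < card Y")
    case True
    have "finite Y" using YA fA finite_subset by blast
    then obtain ys where ys: "set ys = Y" "distinct ys" using finite_distinct_list by metis
    then have l: "t < length ys" using True distinct_card[of ys] by simp
    show ?thesis using successively_closed[OF ys(2) _ YR] ys YA l rt by (intro goal) auto
  next
    case False
    have "G \<noteq> {}"
    proof
      assume "G = {}"
      then have "Y = \<Union>F" unfolding Y_def U_def G_def priv_def by blast
      then show False using False A by simp
    qed
    then have g1: "1 \<le> card G" using fG by (simp add: Suc_le_eq card_gt_0_iff)
    \<comment> \<open>A member without a private vertex is a set of non-private vertices, and at
      most \<open>t - card G\<close> of these exist. So \<open>choose_private\<close> applies with
      \<open>e = card G\<close>.\<close>
    have "F - G \<subseteq> {f. f \<subseteq> U \<and> card f = r - 1}"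
    proof
      fix f assume f: "f \<in> F - G"
      have "a \<in> U" if "a \<in> f" for a
        using that f unfolding U_def G_def priv_def by blast
      then show "f \<in> {f. f \<subseteq> U \<and> card f = r - 1}" using F(3)[of f] f by blast
    qed
    then have "card (F - G) \<le> card {f. f \<subseteq> U \<and> card f = r - 1}" using fU by (intro card_mono) auto
    also have "\<dots> = card U choose (r - 1)" by (rule n_subsets[OF fU])
    also have "\<dots> \<le> (t - card G) choose (r - 1)" using cY False by (intro choose_mono1) simp
    finally have FG: "card (F - G) \<le> (t - card G) choose (r - 1)" .
    have GF: "G \<subseteq> F" unfolding G_def by blast
    then have "card F = card G + card (F - G)" using F(1) fG by (metis card_Diff_subset card_mono le_add_diff_inverse)
    then have eq: "card G = t" using choose_private[OF rt g1] False cY FG F(2) by simp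
    then have "card (F - G) = 0" using FG rt by (simp add: binomial_eq_0)
    then have FG': "F = G" using F(1) GF by auto
    have "U = {}" using eq False cY fU by simp
    then have pr: "priv a f" if "a \<in> f" "f \<in> F" for a f
      using that uniq unfolding U_def priv_def by blast
    have RR: "R a b" if "a \<in> f" "f \<in> F" "b \<in> g" "g \<in> F" "f \<noteq> g" for a b f g using that unfolding R_def by blast
    obtain f1 where f1: "f1 \<in> F" using \<open>G \<noteq> {}\<close> FG' by blast
    have "1 < card f1" using F(3)[OF f1] rt by simp
    then obtain a a' where a: "a \<in> f1" "a' \<in> f1" "a \<noteq> a'"
      by (metis One_nat_def card_le_Suc0_iff_eq F(3) f1 not_le)
    obtain gs where gs: "set gs = F - {f1}" "distinct gs" using F(1) finite_distinct_list by (metis finite_Diff)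
    have "length gs = t - 1" using gs f1 F(1) eq FG' distinct_card[of gs] by simp
    then obtain g2 hs where hs: "gs = g2 # hs" "hs \<noteq> []" "length hs = t - 2" using rt
      by (cases gs; cases "tl gs") auto
    have re: "rep f \<in> f" if "f \<in> F" for f using rep[of f] that FG' unfolding priv_def by blast
    have chain: "successively R (x # map rep ks @ [a])"
      if "ks \<noteq> []" "distinct (f # ks)" "set ks \<subseteq> F - {f1}" "x \<in> f" "f \<in> F" for ks x f
      using that
    proof (induction ks arbitrary: x f)
      case (Cons k ks)
      have k: "k \<in> F" "k \<noteq> f1" "f \<noteq> k" using Cons.prems by auto
      have "R x (rep k)" using RR[of x f "rep k" k] re[OF k(1)] Cons.prems k by blast
      moreover have "successively R (rep k # map rep ks @ [a])"
      proof (cases "ks = []")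
        case True
        then show ?thesis using RR[of "rep k" k a f1] re[OF k(1)] k f1 a by simp
      next
        case False
        then show ?thesis using Cons.IH[OF False, of k "rep k"] Cons.prems re[OF k(1)] k(1) by simp
      qed
      ultimately show ?case by simp
    qed simp
    have g2: "g2 \<in> F" "g2 \<noteq> f1" using gs hs by auto
    have hsF: "set hs \<subseteq> F - {f1}" "distinct (f1 # hs)" "g2 \<notin> set hs" using gs hs by auto
    \<comment> \<open>The two vertices of \<open>f1\<close> are separated by representatives on both
      sides, which makes \<open>t + 1\<close> vertices in admissible order; \<open>hs\<close> is
      nonempty because \<open>t\<close> is at least 3.\<close>
    let ?ys = "a # rep g2 # a' # map rep hs"
    have "successively R (a' # map rep hs @ [a])" using chain[OF hs(2) hsF(2,1) a(2) f1] .
    moreover have "R a (rep g2)" "R (rep g2) a'" using RR re[OF g2(1)] g2 a f1 by blast+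
    ultimately have s: "successively R (?ys @ [hd ?ys])" by simp
    have ne: "a0 \<noteq> rep g" if "a0 \<in> f1" "g \<in> F" "g \<noteq> f1" for a0 g
      using pr[OF that(1) f1] re[OF that(2)] that unfolding priv_def by blast
    have "a \<notin> rep ` set hs" "a' \<notin> rep ` set hs" using ne a hsF(1) by blast+
    moreover have "distinct (map rep (g2 # hs))"
      unfolding distinct_map using inj FG' gs hs hsF by (auto intro: inj_on_subset)
    moreover have "a \<noteq> rep g2" "a' \<noteq> rep g2" using ne g2 a by blast+
    ultimately have d: "distinct ?ys" using a by auto
    have "set ?ys \<subseteq> \<Union>F" using a f1 re g2 hsF(1) by auto
    then show ?thesis using goal[OF d _ _ s] hs(3) rt by simp
  qed
qed

context hgraph
begin

text \<open>The nodes used to pass from one vertex of the link to another through \<open>w\<close>.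
  Two different hyperedges at \<open>w\<close> are required, whence the condition
  \<open>f \<noteq> f'\<close> on pairs.\<close>

definition star :: "'a set set \<Rightarrow> 'a \<Rightarrow> ('a + 'a set) set" where
  "star F w = insert (Inl w) (Inr ` insert w ` F)"

lemma star_opath:
  assumes "\<And>f. f \<in> F \<Longrightarrow> insert w f \<in> E" "w \<notin> \<Union>F" "f \<in> F" "f' \<in> F" "f \<noteq> f'" "a \<in> f" "b \<in> f'"
  shows "\<exists>xs. opath (star F w) (Inl a) (Inl b) xs \<and> 1 \<le> nv xs"
proof -
  have "insert w f \<noteq> insert w f'"
  proof
    assume "insert w f = insert w f'"
    moreover have "w \<notin> f" "w \<notin> f'" using assms by auto
    ultimately show False using assms(5) by (metis insert_ident)
  qed
  then have "opath (star F w) (Inl a) (Inl b) [Inr (insert w f), Inl w, Inr (insert w f')]"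
    unfolding opath_def pth_def star_def using assms by auto
  moreover have "1 \<le> nv [Inr (insert w f), Inl w, Inr (insert w f')]" by simp
  ultimately show ?thesis by blast
qed

lemma star_disjoint:
  assumes "w \<noteq> w'" "w \<notin> \<Union>F" "w' \<notin> \<Union>F"
  shows "star F w \<inter> star F w' = {}"
proof -
  have "insert w f \<noteq> insert w' f'" if "f \<in> F" "f' \<in> F" for f f'
  proof -
    have "w \<notin> insert w' f'" using assms that by auto
    then show ?thesis by blast
  qed
  then show ?thesis using assms(1) unfolding star_def by auto
qed

end

context twoconn
begin

text \<open>Fewer than \<open>t\<close> vertices do not carry \<open>C(t, r - 1)\<close> sets. With
  more than \<open>t\<close>, the order from \<open>good_order\<close> and one star per gap give a
  cycle with at least \<open>2 (t + 1) \<ge> k\<close> vertices. The lower bound on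
  \<open>card W\<close> guarantees enough stars, because the union of \<open>F\<close> has at most
  \<open>C(t, r - 1) (r - 1)\<close> vertices.\<close>

lemma common_link_size:
  assumes rt: "r \<le> t" and kt: "k \<le> 2 * t + 2" and F: "card F = t choose (r - 1)" "\<And>f. f \<in> F \<Longrightarrow> f \<subseteq> V \<and> card f = r - 1"
    and W: "W \<subseteq> V" "(t choose (r - 1)) * r \<le> card W" "W \<inter> \<Union>F = {}" "\<And>w f. w \<in> W \<Longrightarrow> f \<in> F \<Longrightarrow> insert w f \<in> E"
  shows "card (\<Union>F) = t" "F = {f. f \<subseteq> \<Union>F \<and> card f = r - 1}"
proof -
  have fin: "finite F" "finite (\<Union>F)" "finite W"
  proof -
    have "F \<subseteq> Pow V" "\<Union>F \<subseteq> V" using F(2) by blast+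
    then show "finite F" "finite (\<Union>F)" "finite W" using finV W(1) finite_subset finite_Pow_iff by metis+
  qed
  have ff: "finite f \<and> card f = r - 1" if "f \<in> F" for f using F(2)[OF that] finV finite_subset by blast
  have sub: "F \<subseteq> {f. f \<subseteq> \<Union>F \<and> card f = r - 1}" using F(2) by blast
  have fS: "finite {f. f \<subseteq> \<Union>F \<and> card f = r - 1}" using fin(2) by simp
  have le: "t choose (r - 1) \<le> card (\<Union>F) choose (r - 1)"
    using card_mono[OF fS sub] n_subsets[OF fin(2)] F(1) by simp
  have "t \<le> card (\<Union>F)"
  proof (rule ccontr)
    assume "\<not> t \<le> card (\<Union>F)"
    then have "card (\<Union>F) choose (r - 1) \<le> (t - 1) choose (r - 1)" by (intro choose_mono1) simp
    then show False using le pascal_t(1,2)[OF r3 rt] rt r3 by linarith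
  qed
  moreover have "card (\<Union>F) \<le> t"
  proof (rule ccontr)
    assume "\<not> card (\<Union>F) \<le> t"
    then have lt: "t < card (\<Union>F)" by simp
    let ?R = "\<lambda>a b. \<exists>f\<in>F. \<exists>f'\<in>F. f \<noteq> f' \<and> a \<in> f \<and> b \<in> f'"
    obtain ys where ys0: "distinct ys" "set ys \<subseteq> \<Union>F" "t < length ys" "successively ?R (ys @ [hd ys])"
      using good_order[OF r3 rt fin(1) F(1) ff lt] by blast
    have "card (\<Union>F) \<le> (\<Sum>f\<in>F. card f)" using card_Union_le_sum_card[of F] by simp
    also have "\<dots> = (t choose (r - 1)) * (r - 1)" using ff F(1) by simp
    also have "\<dots> \<le> (t choose (r - 1)) * r" by simp
    finally have "card (\<Union>F) \<le> card W" using W(2) by linarith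
    then have lW: "length ys \<le> card W" using card_mono[OF fin(2) ys0(2)] ys0(1) by (simp add: distinct_card)
    have wF: "w \<notin> \<Union>F" if "w \<in> W" for w using W(3) that by blast
    have inj: "inj_on (star F) W"
    proof (rule inj_onI)
      fix w w' assume w: "w \<in> W" "w' \<in> W" "star F w = star F w'"
      have "star F w \<noteq> {}" unfolding star_def by simp
      then show "w = w'" using star_disjoint[OF _ wF[OF w(1)] wF[OF w(2)]] w(3) by auto
    qed
    let ?ys = "map Inl ys :: ('a + 'a set) list"
    let ?S = "\<lambda>x y. \<exists>a b. x = Inl a \<and> y = Inl b \<and> ?R a b"
    have hd: "?ys @ [Inl (hd ys)] = map Inl (ys @ [hd ys])" by simp
    have "\<exists>segs. map fst segs = ?ys \<and> linked segs (Inl (hd ys)) \<and> distinct (concat (map snd segs)) \<and>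
     set (concat (map snd segs)) \<subseteq> \<Union>(star F ` W) \<and> length ?ys \<le> nv (concat (map snd segs))"
    proof (rule fill_rel[where R = ?S])
      show "finite (star F ` W)" using fin by simp
      show "length ?ys \<le> card (star F ` W)" using lW by (simp add: card_image[OF inj])
      show "Q \<inter> Q' = {}" if "Q \<in> star F ` W" "Q' \<in> star F ` W" "Q \<noteq> Q'" for Q Q'
        using that star_disjoint wF by (metis imageE)
      show "successively ?S (?ys @ [Inl (hd ys)])" unfolding hd successively_map
        using ys0(4) by (rule successively_mono) blast
      show "\<exists>xs. opath Q y y' xs \<and> 1 \<le> nv xs" if Q: "Q \<in> star F ` W" and S: "?S y y'" for Q y y'
      proof -
        obtain w where w: "w \<in> W" "Q = star F w" using Q by blast
        obtain a b f f' where f: "f \<in> F" "f' \<in> F" "f \<noteq> f'" "a \<in> f" "b \<in> f'" "y = Inl a" "y' = Inl b" using S by blast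
        show ?thesis unfolding w(2) f(6,7) by (rule star_opath[OF W(4)[OF w(1)] wF[OF w(1)] f(1-5)])
      qed
    qed
    then obtain segs where s: "map fst segs = ?ys" "linked segs (Inl (hd ys))" "distinct (concat (map snd segs))"
      "set (concat (map snd segs)) \<subseteq> \<Union>(star F ` W)" "length ?ys \<le> nv (concat (map snd segs))"
      by (elim exE conjE) (rule that)
    have len: "length segs = length ys" using s(1) by (metis length_map)
    have fs: "fst ` set segs = Inl ` set ys" using s(1) by (metis image_set)
    have "cyc (flat segs)"
    proof (rule linked_cyc)
      have "segs \<noteq> []" "ys \<noteq> []" using len ys0(3) by auto
      then have "fst (hd segs) = Inl (hd ys)" using s(1) by (metis hd_map)
      then show "linked segs (fst (hd segs))" using s(2) by simp
      show "2 \<le> length segs" using len ys0(3) rt r3 by simp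
      show "distinct (flat segs)"
      proof (rule distinct_flatI)
        show "distinct (map fst segs)" unfolding s(1) using ys0(1) by (simp add: distinct_map)
        have "Inl a \<notin> star F w" if "a \<in> \<Union>F" "w \<in> W" for a w using that wF unfolding star_def by auto
        then have "Inl ` set ys \<inter> \<Union>(star F ` W) = {}" using ys0(2) by blast
        then show "fst ` set segs \<inter> set (concat (map snd segs)) = {}" unfolding fs using s(4) by blast
      qed (rule s(3))
    qed
    then have "nv (flat segs) < k" by (rule cyc_short)
    moreover have "nv ?ys = length ys" using nv_Inl[of ?ys] by auto
    ultimately show False using s(1,5) ys0(3) kt by (simp add: nv_flat)
  qed
  ultimately show ct: "card (\<Union>F) = t" by simp
  show "F = {f. f \<subseteq> \<Union>F \<and> card f = r - 1}"
    using card_subset_eq[OF fS sub] n_subsets[OF fin(2)] F(1) ct by simp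
qed

end

section \<open>Components outside a complete common link\<close>

text \<open>The bound on \<open>card W\<close> leaves \<open>t\<close> stars after all those meeting
  two given paths are discarded, each path having at most \<open>4 * k * k + 2\<close>
  nodes.\<close>

locale anchored = twoconn E V r k for E :: "'a set set" and V r k +
  fixes A W :: "'a set" and t :: nat
  assumes rt: "r \<le> t" and kt: "k \<le> 2 * t + 2" and A: "A \<subseteq> V" "card A = t" and WA: "W \<inter> A = {}"
    and full: "\<And>w f. w \<in> W \<Longrightarrow> f \<subseteq> A \<Longrightarrow> card f = r - 1 \<Longrightarrow> insert w f \<in> E"
    and Wbig: "8 * k * k + 4 + t \<le> card W"
begin

abbreviation AN :: "('a + 'a set) set" where
  "AN \<equiv> Inl ` A"

abbreviation link :: "'a set set" where
  "link \<equiv> {f. f \<subseteq> A \<and> card f = r - 1}"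

lemma finA: "finite A"
  using A finV finite_subset by blast

lemma finW: "finite W"
  using Wbig by (metis add_eq_0_iff_both_eq_0 card.infinite le_zero_eq zero_neq_numeral)

lemma cardAN: "finite AN" "card AN = t" "AN \<subseteq> range Inl" "AN \<subseteq> N"
  using A finA by (auto simp: card_image)

lemma good_pair:
  assumes "a \<in> A" "b \<in> A" "a \<noteq> b"
  shows "\<exists>f\<in>link. \<exists>f'\<in>link. f \<noteq> f' \<and> a \<in> f \<and> b \<in> f'"
proof -
  have "card (A - {a, b}) = t - 2" using assms A finA by (simp add: card_Diff_subset)
  then have "r - 2 \<le> card (A - {a, b})" using rt by simp
  then obtain g where g: "g \<subseteq> A - {a, b}" "card g = r - 2" by (rule obtain_subset_with_card_n)
  have fg: "finite g" using g(1) finA finite_subset by blast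
  have ng: "a \<notin> g" "b \<notin> g" using g by auto
  have "card (insert a g) = r - 1" "card (insert b g) = r - 1" using fg ng g(2) r3 by auto
  then have l: "insert a g \<in> link" "insert b g \<in> link" using g(1) assms by auto
  have "insert a g \<noteq> insert b g" using ng(1) assms(3) by blast
  then show ?thesis by (intro bexI[OF _ l(1)] bexI[OF _ l(2)]) simp
qed

text \<open>The stars are disjoint, so \<open>X\<close> meets at most \<open>card X\<close> of them,
  and the others form the family.\<close>

lemma family:
  assumes X: "finite X" "card X \<le> 8 * k * k + 4"
  shows "\<exists>\<Q>. finite \<Q> \<and> t \<le> card \<Q> \<and> (\<forall>Q\<in>\<Q>. \<forall>Q'\<in>\<Q>. Q \<noteq> Q' \<longrightarrow> Q \<inter> Q' = {}) \<and>
    (\<forall>Q\<in>\<Q>. \<forall>y\<in>AN. \<forall>y'\<in>AN. y \<noteq> y' \<longrightarrow> (\<exists>xs. opath Q y y' xs \<and> 1 \<le> nv xs)) \<and> \<Union>\<Q> \<inter> AN = {} \<and> \<Union>\<Q> \<inter> X = {}"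
proof -
  define st where "st = star link"
  have wF: "w \<notin> \<Union>link" if "w \<in> W" for w using WA that by blast
  have dis: "st w \<inter> st w' = {}" if "w \<in> W" "w' \<in> W" "w \<noteq> w'" for w w'
    unfolding st_def using star_disjoint[OF that(3) wF[OF that(1)] wF[OF that(2)]] .
  define Bad where "Bad = {w \<in> W. st w \<inter> X \<noteq> {}}"
  have "\<exists>x. x \<in> st w \<and> x \<in> X" if "w \<in> Bad" for w using that unfolding Bad_def by auto
  then obtain h where h: "\<And>w. w \<in> Bad \<Longrightarrow> h w \<in> st w \<and> h w \<in> X" by metis
  have "inj_on h Bad"
  proof (rule inj_onI)
    fix w w' assume w: "w \<in> Bad" "w' \<in> Bad" "h w = h w'"
    then have "h w \<in> st w \<inter> st w'" using h[OF w(1)] h[OF w(2)] by simp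
    then show "w = w'" using dis[of w w'] w unfolding Bad_def by blast
  qed
  then have "card Bad \<le> card X" using h X by (intro card_inj_on_le[of h]) auto
  moreover have "card (W - Bad) = card W - card Bad" using finW unfolding Bad_def by (intro card_Diff_subset) auto
  ultimately have cW: "t \<le> card (W - Bad)" using Wbig X by linarith
  have ne: "st w \<noteq> {}" for w unfolding st_def star_def by simp
  have inj: "inj_on st (W - Bad)"
  proof (rule inj_onI)
    fix w w' assume w: "w \<in> W - Bad" "w' \<in> W - Bad" "st w = st w'"
    show "w = w'"
    proof (rule ccontr)
      assume "w \<noteq> w'"
      then have "st w \<inter> st w' = {}" using dis w by blast
      then show False using ne[of w] w(3) by simp
    qed
  qed
  have lk: "\<exists>xs. opath (st w) y y' xs \<and> 1 \<le> nv xs" if w: "w \<in> W" and y: "y \<in> AN" "y' \<in> AN" "y \<noteq> y'" for w y y'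
  proof -
    obtain a b where ab: "y = Inl a" "y' = Inl b" "a \<in> A" "b \<in> A" "a \<noteq> b" using y by blast
    obtain f f' where f: "f \<in> link" "f' \<in> link" "f \<noteq> f'" "a \<in> f" "b \<in> f'" using good_pair[OF ab(3-5)] by blast
    have "insert w g \<in> E" if "g \<in> link" for g using full[OF w] that by blast
    then show ?thesis unfolding st_def ab(1,2) using star_opath[OF _ wF[OF w] f] by blast
  qed
  have sA: "st w \<inter> AN = {}" if "w \<in> W" for w using WA that unfolding st_def star_def by auto
  have sX: "st w \<inter> X = {}" if "w \<in> W - Bad" for w using that unfolding Bad_def by blast
  let ?Q = "st ` (W - Bad)"
  have "finite ?Q" using finW by simp
  moreover have "t \<le> card ?Q" using cW by (simp add: card_image[OF inj])
  moreover have "\<forall>Q\<in>?Q. \<forall>Q'\<in>?Q. Q \<noteq> Q' \<longrightarrow> Q \<inter> Q' = {}"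
    using dis by (metis DiffD1 imageE)
  moreover have "\<forall>Q\<in>?Q. \<forall>y\<in>AN. \<forall>y'\<in>AN. y \<noteq> y' \<longrightarrow> (\<exists>xs. opath Q y y' xs \<and> 1 \<le> nv xs)"
  proof (intro ballI impI)
    fix Q y y' assume "Q \<in> ?Q" and y: "y \<in> AN" "y' \<in> AN" "y \<noteq> y'"
    then obtain w where w: "w \<in> W" "Q = st w" by blast
    show "\<exists>xs. opath Q y y' xs \<and> 1 \<le> nv xs" unfolding w(2) by (rule lk[OF w(1) y])
  qed
  moreover have "\<Union>?Q \<inter> AN = {}"
  proof -
    have "Q \<inter> AN = {}" if "Q \<in> ?Q" for Q using that sA by (metis DiffD1 imageE)
    then show ?thesis by blast
  qed
  moreover have "\<Union>?Q \<inter> X = {}"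
  proof -
    have "Q \<inter> X = {}" if "Q \<in> ?Q" for Q using that sX by (metis imageE)
    then show ?thesis by blast
  qed
  ultimately show ?thesis by (intro exI[of _ ?Q] conjI)
qed

lemma opath_card:
  assumes "opath X p q xs" "X \<subseteq> N"
  shows "finite (set xs)" "card (set xs) \<le> 4 * k * k + 2"
proof -
  have "pth xs" "set xs \<subseteq> N" using assms unfolding opath_def by auto
  then have "length xs \<le> 4 * k * k + 2" by (rule path_bound)
  then show "card (set xs) \<le> 4 * k * k + 2" using card_length[of xs] by linarith
qed simp

text \<open>The cycle closed through the stars has at least \<open>nv xs + 2 t - 1\<close> vertices.
  Hence only one interior vertex is allowed for \<open>k = 2 t + 1\<close>, and two for
  \<open>k = 2 t + 2\<close>.\<close>

lemma single_path:
  assumes xs: "opath X p q xs" "X \<subseteq> N - AN" and p: "p \<in> AN" "q \<in> AN" "p \<noteq> q"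
  shows "nv xs + 2 * t \<le> k"
proof -
  have "X \<subseteq> N" "X \<inter> AN = {}" using xs(2) by blast+
  have c: "card (set xs) \<le> 8 * k * k + 4" using opath_card[OF xs(1) \<open>X \<subseteq> N\<close>] by simp
  obtain \<Q> where Q: "finite \<Q>" "t \<le> card \<Q>" "\<forall>Q\<in>\<Q>. \<forall>Q'\<in>\<Q>. Q \<noteq> Q' \<longrightarrow> Q \<inter> Q' = {}"
    "\<forall>Q\<in>\<Q>. \<forall>y\<in>AN. \<forall>y'\<in>AN. y \<noteq> y' \<longrightarrow> (\<exists>xs. opath Q y y' xs \<and> 1 \<le> nv xs)" "\<Union>\<Q> \<inter> AN = {}" "\<Union>\<Q> \<inter> set xs = {}"
    using family[OF finite_set c] by (elim exE conjE) (rule that)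
  have m: "\<And>Q Q'. Q \<in> \<Q> \<Longrightarrow> Q' \<in> \<Q> \<Longrightarrow> Q \<noteq> Q' \<Longrightarrow> Q \<inter> Q' = {}"
    "\<And>Q y y'. Q \<in> \<Q> \<Longrightarrow> y \<in> AN \<Longrightarrow> y' \<in> AN \<Longrightarrow> y \<noteq> y' \<Longrightarrow> \<exists>xs. opath Q y y' xs \<and> 1 \<le> nv xs"
    by (rule Q(3)[rule_format], assumption+) (rule Q(4)[rule_format])
  have cQ: "card AN \<le> card \<Q>" using Q(2) cardAN(2) by simp
  have "\<exists>c. cyc c \<and> nv xs + 2 * card AN \<le> nv c + 1"
    by (rule one_special[OF cardAN(1,3) p xs(1) \<open>X \<inter> AN = {}\<close> Q(1) cQ m Q(5,6)])
  then obtain c where "cyc c" "nv xs + 2 * card AN \<le> nv c + 1" by blast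
  then show ?thesis using cyc_short(2)[of c] cardAN(2) by simp
qed

lemma two_paths:
  assumes xs: "opath X p q xs" "X \<subseteq> N - AN" and p: "p \<in> AN" "q \<in> AN" "p \<noteq> q"
    and ys: "opath Y p' q' ys" "Y \<subseteq> N - AN" "X \<inter> Y = {}" and p': "p' \<in> AN" "q' \<in> AN" "p' \<noteq> q'" "{p, q} \<noteq> {p', q'}"
  shows "nv xs + nv ys + 2 * t \<le> k + 1"
proof -
  have X: "X \<subseteq> N" "X \<inter> AN = {}" and Y: "Y \<subseteq> N" "Y \<inter> AN = {}" using xs(2) ys(2) by blast+
  have "card (set xs \<union> set ys) \<le> card (set xs) + card (set ys)" by (rule card_Un_le)
  also have "\<dots> \<le> 8 * k * k + 4" using opath_card(2)[OF xs(1) X(1)] opath_card(2)[OF ys(1) Y(1)] by simp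
  finally have c: "card (set xs \<union> set ys) \<le> 8 * k * k + 4" .
  obtain \<Q> where Q: "finite \<Q>" "t \<le> card \<Q>" "\<forall>Q\<in>\<Q>. \<forall>Q'\<in>\<Q>. Q \<noteq> Q' \<longrightarrow> Q \<inter> Q' = {}"
    "\<forall>Q\<in>\<Q>. \<forall>y\<in>AN. \<forall>y'\<in>AN. y \<noteq> y' \<longrightarrow> (\<exists>xs. opath Q y y' xs \<and> 1 \<le> nv xs)" "\<Union>\<Q> \<inter> AN = {}"
    "\<Union>\<Q> \<inter> (set xs \<union> set ys) = {}"
    using family[OF finite_UnI[OF finite_set finite_set] c] by (elim exE conjE) (rule that)
  have m: "\<And>Q Q'. Q \<in> \<Q> \<Longrightarrow> Q' \<in> \<Q> \<Longrightarrow> Q \<noteq> Q' \<Longrightarrow> Q \<inter> Q' = {}"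
    "\<And>Q y y'. Q \<in> \<Q> \<Longrightarrow> y \<in> AN \<Longrightarrow> y' \<in> AN \<Longrightarrow> y \<noteq> y' \<Longrightarrow> \<exists>xs. opath Q y y' xs \<and> 1 \<le> nv xs"
    by (rule Q(3)[rule_format], assumption+) (rule Q(4)[rule_format])
  have cQ: "card AN \<le> card \<Q>" using Q(2) cardAN(2) by simp
  have "\<exists>c. cyc c \<and> nv xs + nv ys + 2 * card AN \<le> nv c + 2"
    by (rule two_special[OF cardAN(1,3) p p' xs(1) X(2) ys(1) Y(2) ys(3) Q(1) cQ m Q(5,6)])
  then obtain c where "cyc c" "nv xs + nv ys + 2 * card AN \<le> nv c + 2" by blast
  then show ?thesis using cyc_short(2)[of c] cardAN(2) by simp
qed

section \<open>Components of the incidence graph outside the anchor set\<close>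

definition piece :: "('a + 'a set) set \<Rightarrow> bool" where
  "piece Q \<longleftrightarrow> conn Q \<and> Q \<subseteq> N - AN \<and> nbr Q \<subseteq> AN"

lemma piece_comp: "piece (comp_of (N - AN) x)"
proof -
  have "nbr (comp_of (N - AN) x) \<subseteq> N - (N - AN)" using comp_of_nbr[of "N - AN" x] nbr_N(1) by fast
  then show ?thesis unfolding piece_def using conn_comp_of comp_of_sub[of "N - AN" x] by blast
qed

lemma piece_edge:
  assumes "piece Q" "Inl v \<in> Q" "e \<in> E" "v \<in> e"
  shows "Inr e \<in> Q"
proof (rule ccontr)
  assume "Inr e \<notin> Q"
  then have "Inr e \<in> nbr Q" using assms unfolding nbr_def by force
  then show False using assms(1) unfolding piece_def by blast
qed

lemma outside_two:
  assumes "a \<in> N - B" "b \<in> N - B" "a \<noteq> b"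
  shows "\<exists>y\<in>N - B. y \<noteq> w"
  using assms by metis

lemma two_anchors: "\<exists>a b. a \<in> A \<and> b \<in> A \<and> a \<noteq> b"
proof -
  have "2 \<le> card A" using A rt r3 by simp
  then show ?thesis by (metis One_nat_def Suc_1 card_le_Suc0_iff_eq finA not_less_eq_eq)
qed

lemma piece_out:
  assumes "piece Q"
  shows "\<exists>y\<in>N - Q. y \<noteq> w"
proof -
  obtain a b where ab: "a \<in> A" "b \<in> A" "a \<noteq> b" using two_anchors by blast
  have "Inl a \<in> N - Q" "Inl b \<in> N - Q" using ab(1,2) assms cardAN(4) unfolding piece_def by blast+
  then show ?thesis using ab(3) by (intro outside_two[of "Inl a" _ "Inl b"]) auto
qed

lemma piece_ports:
  assumes Q: "piece Q" and c: "c \<in> C" "Inl c \<in> Q" and AC: "A \<subseteq> C"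
    and deg: "\<And>v. v \<in> C \<Longrightarrow> Inl v \<in> Q \<Longrightarrow> t choose (r - 1) < card {e \<in> E. e \<subseteq> C \<and> v \<in> e}"
  shows "ports E Q {c \<in> C. Inl c \<in> Q} {v \<in> C. Inl v \<in> nbr Q} {e \<in> E. e \<subseteq> C} r t (card (nbr Q))"
    "card (nbr Q) \<le> t" "2 \<le> card (nbr Q)"
proof -
  have QN: "Q \<subseteq> N" "conn Q" "nbr Q \<subseteq> AN" "Q \<noteq> {}" using Q c unfolding piece_def by blast+
  note pc = port_count[OF QN(1,4) piece_out[OF Q]]
  show "2 \<le> card (nbr Q)" by (rule pc(2))
  show "card (nbr Q) \<le> t" using card_mono[OF cardAN(1) QN(3)] cardAN(2) by simp
  have "{v \<in> C. Inl v \<in> nbr Q} = {v. Inl v \<in> nbr Q}" using QN(3) AC by blast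
  then have "card {v \<in> C. Inl v \<in> nbr Q} + card {e. Inr e \<in> nbr Q} \<le> card (nbr Q)" using pc(1) by simp
  then show "ports E Q {c \<in> C. Inl c \<in> Q} {v \<in> C. Inl v \<in> nbr Q} {e \<in> E. e \<subseteq> C} r t (card (nbr Q))"
    by (intro ports_of[OF QN(1,2) c rt deg piece_out[OF Q]] pc(2))
qed

text \<open>A path with \<open>t \<ge> 3\<close> interior vertices is too long, so the second
  alternative of \<open>long_port_path\<close> holds. Its length \<open>t + 2 - M\<close> with
  \<open>M \<le> t\<close> is at least 2, which \<open>single_path\<close> allows only for
  \<open>k = 2 t + 2\<close>, and then only if every vertex of \<open>A\<close> is a port.\<close>

lemma piece_path:
  assumes Q: "piece Q" and c: "c \<in> C" "Inl c \<in> Q" and AC: "A \<subseteq> C"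
    and deg: "\<And>v. v \<in> C \<Longrightarrow> Inl v \<in> Q \<Longrightarrow> t choose (r - 1) < card {e \<in> E. e \<subseteq> C \<and> v \<in> e}"
  shows "k = 2 * t + 2" "\<And>p. p \<in> AN \<Longrightarrow> \<exists>q\<in>AN - {p}. \<exists>xs. opath Q p q xs \<and> 2 \<le> nv xs"
proof -
  interpret p: ports E Q "{c \<in> C. Inl c \<in> Q}" "{v \<in> C. Inl v \<in> nbr Q}" "{e \<in> E. e \<subseteq> C}" r t "card (nbr Q)"
    by (rule piece_ports(1)[OF Q c AC deg])
  have M: "card (nbr Q) \<le> t" by (rule piece_ports(2)[OF Q c AC deg])
  have M2: "2 \<le> card (nbr Q)" by (rule piece_ports(3)[OF Q c AC deg])
  have QA: "Q \<subseteq> N - AN" "nbr Q \<subseteq> AN" using Q unfolding piece_def by blast+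
  have lim: "nv xs + 2 * t \<le> k" if "opath Q p q xs" "p \<in> nbr Q" "q \<in> nbr Q" "p \<noteq> q" for p q xs
    using single_path[OF that(1) QA(1)] that QA(2) by blast
  have no: "\<not> (\<exists>p\<in>nbr Q. \<exists>q\<in>nbr Q - {p}. \<exists>xs. opath Q p q xs \<and> t \<le> nv xs)"
  proof
    assume "\<exists>p\<in>nbr Q. \<exists>q\<in>nbr Q - {p}. \<exists>xs. opath Q p q xs \<and> t \<le> nv xs"
    then obtain p q xs where "p \<in> nbr Q" "q \<in> nbr Q" "p \<noteq> q" "opath Q p q xs" "t \<le> nv xs" by blast
    then show False using lim[of p q xs] kt rt r3 by simp
  qed
  then have II: "\<forall>p\<in>nbr Q. \<exists>q\<in>nbr Q - {p}. \<exists>xs. opath Q p q xs \<and> 1 \<le> nv xs \<and> t + 2 \<le> nv xs + card (nbr Q)"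
    using p.long_port_path by blast
  obtain p where p: "p \<in> nbr Q" using M2 by fastforce
  then obtain q xs where q: "q \<in> nbr Q" "q \<noteq> p" "opath Q p q xs" "t + 2 \<le> nv xs + card (nbr Q)" using II by blast
  have l: "nv xs + 2 * t \<le> k" using lim[OF q(3) p q(1)] q(2) by blast
  then show k: "k = 2 * t + 2" using q(4) M kt by linarith
  have "card (nbr Q) = card AN" using l q(4) M kt cardAN(2) by linarith
  then have "nbr Q = AN" using card_subset_eq[OF cardAN(1) QA(2)] by blast
  then show "\<exists>q\<in>AN - {p}. \<exists>xs. opath Q p q xs \<and> 2 \<le> nv xs" if pA: "p \<in> AN" for p
  proof -
    assume nA: "nbr Q = AN"
    obtain q xs where "q \<in> AN - {p}" "opath Q p q xs" "t + 2 \<le> nv xs + card AN" using II pA unfolding nA by blast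
    moreover have "2 \<le> nv xs" using calculation(3) cardAN(2) by linarith
    ultimately show ?thesis by blast
  qed
qed

text \<open>Two pieces with core vertices would each supply a path with two interior vertices, and
  the second can start at an anchor different from both ends of the first, because \<open>t\<close>
  is at least 3. Together they exceed the bound of \<open>two_paths\<close>.\<close>

lemma one_piece:
  assumes Q: "piece Q" "piece Q'" "Q \<inter> Q' = {}" and c: "c \<in> C" "Inl c \<in> Q" "c' \<in> C" "Inl c' \<in> Q'" and AC: "A \<subseteq> C"
    and deg: "\<And>v. v \<in> C - A \<Longrightarrow> t choose (r - 1) < card {e \<in> E. e \<subseteq> C \<and> v \<in> e}"
  shows False
proof -
  have QA: "Q \<subseteq> N - AN" "Q' \<subseteq> N - AN" using Q unfolding piece_def by blast+
  have "v \<notin> A" if "Inl v \<in> Q \<or> Inl v \<in> Q'" for v using that QA by blast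
  then have deg': "t choose (r - 1) < card {e \<in> E. e \<subseteq> C \<and> v \<in> e}" if "v \<in> C" "Inl v \<in> Q \<or> Inl v \<in> Q'" for v
    using deg that by blast
  have d1: "\<And>v. v \<in> C \<Longrightarrow> Inl v \<in> Q \<Longrightarrow> t choose (r - 1) < card {e \<in> E. e \<subseteq> C \<and> v \<in> e}"
    and d2: "\<And>v. v \<in> C \<Longrightarrow> Inl v \<in> Q' \<Longrightarrow> t choose (r - 1) < card {e \<in> E. e \<subseteq> C \<and> v \<in> e}" using deg' by blast+
  obtain p where p: "p \<in> AN" using two_anchors by blast
  obtain q xs where q: "q \<in> AN - {p}" "opath Q p q xs" "2 \<le> nv xs" using piece_path(2)[OF Q(1) c(1,2) AC d1 p] by blast
  have "card {p, q} < card AN" using q p cardAN(2) rt r3 by (auto simp: card_insert_if)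
  then have "\<not> AN \<subseteq> {p, q}" using card_mono[of "{p, q}" AN] by auto
  then obtain p' where p': "p' \<in> AN" "p' \<noteq> p" "p' \<noteq> q" by blast
  obtain q' ys where q': "q' \<in> AN - {p'}" "opath Q' p' q' ys" "2 \<le> nv ys"
    using piece_path(2)[OF Q(2) c(3,4) AC d2 p'(1)] by blast
  have "nv xs + nv ys + 2 * t \<le> k + 1"
    using q q' p p' by (intro two_paths[OF q(2) QA(1) _ _ _ q'(2) QA(2) Q(3)]) auto
  then show False using q(3) q'(3) kt by linarith
qed

section \<open>The single component with core vertices\<close>

lemma no_long:
  assumes "piece Q" "opath Q p q zs" "p \<in> AN" "q \<in> AN" "p \<noteq> q"
  shows "nv zs \<le> 2"
proof -
  have "Q \<subseteq> N - AN" using assms(1) unfolding piece_def by blast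
  then show ?thesis using single_path[OF assms(2) _ assms(3-5)] kt by linarith
qed

lemma sub_piece:
  assumes Q: "piece Q" and X: "X \<subseteq> Q" "X \<noteq> {}" and y: "Inl y \<in> Q - X"
  defines "K \<equiv> comp_of (Q - X) (Inl y)"
  shows "K \<subseteq> Q - X" "conn K" "Inl y \<in> K" "nbr K \<subseteq> X \<union> AN" "nbr K \<inter> X \<noteq> {}"
    "\<And>e. e \<in> E \<Longrightarrow> (\<And>v. v \<in> e \<Longrightarrow> Inl v \<notin> Q - X) \<Longrightarrow> Inr e \<notin> K"
proof -
  show KQ: "K \<subseteq> Q - X" unfolding K_def by (rule comp_of_sub)
  show cK: "conn K" unfolding K_def by (rule conn_comp_of)
  show yK: "Inl y \<in> K" unfolding K_def using y by (rule comp_of_self)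
  have cl: "b \<in> K" if "a \<in> K" "inc E a b" "b \<in> Q - X" for a b
    using comp_of_closed[of a "Q - X" "Inl y" b] that unfolding K_def by blast
  show "nbr K \<subseteq> X \<union> AN"
  proof
    fix b assume "b \<in> nbr K"
    then obtain a where a: "a \<in> K" "inc E a b" "b \<notin> K" unfolding nbr_def by blast
    show "b \<in> X \<union> AN"
    proof (cases "b \<in> Q")
      case True
      then show ?thesis using cl[OF a(1,2)] a(3) by blast
    next
      case False
      then have "b \<in> nbr Q" using a KQ unfolding nbr_def by blast
      then show ?thesis using Q unfolding piece_def by blast
    qed
  qed
  show "nbr K \<inter> X \<noteq> {}"
  proof -
    obtain x where x: "x \<in> X" using X(2) by blast
    then have "reach Q (Inl y) x" using Q X(1) y unfolding piece_def conn_def by blast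
    moreover have "x \<notin> K" using KQ x by blast
    ultimately obtain a b where ab: "a \<in> K" "b \<in> Q - K" "inc E a b" using reach_exit[OF _ yK] by blast
    then have "b \<in> X" using cl[OF ab(1,3)] by blast
    moreover have "b \<in> nbr K" using ab unfolding nbr_def by blast
    ultimately show ?thesis by blast
  qed
  show "Inr e \<notin> K" if e: "e \<in> E" "\<And>v. v \<in> e \<Longrightarrow> Inl v \<notin> Q - X" for e
  proof
    assume eK: "Inr e \<in> K"
    then have "reach K (Inr e) (Inl y)" using cK yK unfolding conn_def by blast
    then obtain b where b: "b \<in> K" "inc E (Inr e) b" using reach_exit[of K "Inr e" "Inl y" "{Inr e}"] by auto
    then obtain v where "v \<in> e" "b = Inl v" using inc_InrD by metis
    then show False using e(2) b(1) KQ by blast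
  qed
qed

text \<open>Both hyperedges contain \<open>s\<close> and \<open>x\<close>, so they differ in their
  traces on \<open>A\<close>, which have the same size \<open>r - 2 \<ge> 1\<close>. A vertex in one
  trace only and any vertex of the other are different.\<close>

lemma distinct_anchors:
  assumes e: "e \<in> E" "f \<in> E" "e \<noteq> f" and sub: "e \<subseteq> insert s (insert x A)" "f \<subseteq> insert s (insert x A)"
    and in': "s \<in> e" "x \<in> e" "s \<in> f" "x \<in> f" and sx: "s \<noteq> x" "s \<notin> A" "x \<notin> A"
  shows "\<exists>a b. a \<in> e \<inter> A \<and> b \<in> f \<inter> A \<and> a \<noteq> b"
proof -
  have card: "card (g \<inter> A) = r - 2" "finite (g \<inter> A)" if g: "g \<in> E" "g \<subseteq> insert s (insert x A)" "s \<in> g" "x \<in> g" for g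
  proof -
    have "g \<inter> A = g - {s, x}" using g sx by auto
    moreover have "card (g - {s, x}) = r - 2" using g sx edge[OF g(1)] by (simp add: card_Diff_subset)
    ultimately show "card (g \<inter> A) = r - 2" by simp
    show "finite (g \<inter> A)" using finA by simp
  qed
  have "\<not> e \<inter> A \<subseteq> f \<inter> A"
  proof
    assume "e \<inter> A \<subseteq> f \<inter> A"
    then have "e \<inter> A = f \<inter> A" using card[OF e(1) sub(1) in'(1,2)] card[OF e(2) sub(2) in'(3,4)] by (intro card_subset_eq) auto
    then have "e = f" using sub in' by blast
    then show False using e by blast
  qed
  then obtain a where a: "a \<in> e \<inter> A" "a \<notin> f" by blast
  have "card (f \<inter> A) \<noteq> 0" using card(1)[OF e(2) sub(2) in'(3,4)] r3 by simp
  then obtain b where b: "b \<in> f \<inter> A" by (metis card.empty ex_in_conv)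
  show ?thesis using a b by blast
qed

text \<open>A path that leaves the component of \<open>y\<close> in \<open>Q - {s, x}\<close> at \<open>s\<close> or \<open>x\<close> is continued through \<open>e\<close> and \<open>f\<close>.\<close>

lemma no_double_edge:
  assumes Q: "piece Q" and s: "Inl s \<in> Q" "Inl x \<in> Q" "s \<noteq> x" and y: "y \<in> C" "Inl y \<in> Q" "y \<noteq> s" "y \<noteq> x"
    and e: "e \<in> E" "f \<in> E" "e \<noteq> f" and sub: "e \<subseteq> insert s (insert x A)" "f \<subseteq> insert s (insert x A)"
    and in': "s \<in> e" "x \<in> e" "s \<in> f" "x \<in> f"
    and deg: "\<And>v. v \<in> C \<Longrightarrow> Inl v \<in> Q \<Longrightarrow> t choose (r - 1) < card {e \<in> E. e \<subseteq> C \<and> v \<in> e}"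
  shows False
proof -
  define X where "X = {Inl s, Inl x :: 'a + 'a set}"
  define K where "K = comp_of (Q - X) (Inl y)"
  have X: "X \<subseteq> Q" "X \<noteq> {}" and yX: "Inl y \<in> Q - X" using s y unfolding X_def by auto
  note K = sub_piece[OF Q X yX, folded K_def]
  have QN: "Q \<subseteq> N - AN" using Q unfolding piece_def by blast
  have sxA: "s \<notin> A" "x \<notin> A" using s QN by blast+
  have eK: "Inr g \<notin> K" if "g \<in> E" "g \<subseteq> insert s (insert x A)" for g
    by (rule K(6)[OF that(1)]) (use that(2) QN in \<open>auto simp: X_def\<close>)
  have KN: "K \<subseteq> N" using K(1) QN by blast
  have "Inl s \<in> N - K" "Inl x \<in> N - K" "Inl s \<noteq> (Inl x :: 'a + 'a set)" using s QN K(1) unfolding X_def by blast+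
  note out = outside_two[OF this]
  have K0: "K \<noteq> {}" using K(3) by blast
  note pc = port_count[OF KN K0 out]
  have "{v. Inl v \<in> nbr K} \<subseteq> V" using nbr_N by fastforce
  then have "card {v \<in> C. Inl v \<in> nbr K} \<le> card {v. Inl v \<in> nbr K}" using finV finite_subset by (intro card_mono) auto
  then have M: "card {v \<in> C. Inl v \<in> nbr K} + card {e. Inr e \<in> nbr K} \<le> card (nbr K)" using pc(1) by linarith
  have dK: "\<And>v. v \<in> C \<Longrightarrow> Inl v \<in> K \<Longrightarrow> t choose (r - 1) < card {e \<in> E. e \<subseteq> C \<and> v \<in> e}" using deg K(1) by blast
  interpret p: ports E K "{c \<in> C. Inl c \<in> K}" "{v \<in> C. Inl v \<in> nbr K}" "{e \<in> E. e \<subseteq> C}" r t "card (nbr K)"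
    by (rule ports_of[OF KN K(2) y(1) K(3) rt dK out M pc(2)])
  obtain a b where ab: "a \<in> e \<inter> A" "b \<in> f \<inter> A" "a \<noteq> b" using distinct_anchors[OF e sub in' s(3) sxA] by blast
  have EQ: "Inr e \<in> Q" "Inr f \<in> Q" using piece_edge[OF Q s(1)] e in' by blast+
  have fin: False
    if u: "opath K (Inl u) q xs" "1 \<le> nv xs" "q \<in> nbr K" "q \<noteq> Inl u" and uv: "(u = s \<and> v = x) \<or> (u = x \<and> v = s)"
    for u v q xs
  proof -
    have uv': "u \<noteq> v" "Inl u \<in> Q" "Inl v \<in> Q" "Inl u \<notin> K" "Inl v \<notin> K" using uv s K(1) unfolding X_def by auto
    have ue: "u \<in> e" "v \<in> e" "u \<in> f" "v \<in> f" using uv in' by blast+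
    have x: "pth xs" "set xs \<subseteq> K" "inc E (Inl u) (hd xs)" "inc E (last xs) q" "xs \<noteq> []" using u(1) unfolding opath_def pth_def by auto
    have xQ: "set xs \<subseteq> Q" using x(2) K(1) by blast
    have nin: "Inr e \<notin> set xs" "Inr f \<notin> set xs" "Inl u \<notin> set xs" "Inl v \<notin> set xs"
      using eK[OF e(1) sub(1)] eK[OF e(2) sub(2)] uv' x(2) by blast+
    \<comment> \<open>In both cases the prolonged path runs between two anchors and contains
      \<open>s\<close>, \<open>x\<close> and a vertex of \<open>xs\<close>, three vertices where
      \<open>no_long\<close> allows two.\<close>
    consider "q = Inl v" | c where "q = Inl c" "c \<in> A" using u(3,4) K(4) uv unfolding X_def by auto
    then show False
    proof cases
      case 1
      have "opath Q (Inl a) (Inl b) ([Inr e, Inl u] @ xs @ [Inl v, Inr f])"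
        unfolding opath_def pth_def
        using x uv' nin ue e ab EQ xQ 1 by (auto simp: pth_def successively_append_iff successively_Cons)
      then have "nv ([Inr e, Inl u] @ xs @ [Inl v, Inr f]) \<le> 2" using no_long[OF Q] ab by blast
      then show False using u(2) by simp
    next
      case 2
      have *: False if g: "g \<in> E" "g' \<in> E" "g \<noteq> g'" "Inr g \<in> Q" "Inr g' \<in> Q" "Inr g \<notin> set xs" "Inr g' \<notin> set xs"
        "u \<in> g'" "v \<in> g" "v \<in> g'" "a' \<in> g" "a' \<in> A" "a' \<noteq> c" for g g' a'
      proof -
        have "opath Q (Inl a') (Inl c) ([Inr g, Inl v, Inr g', Inl u] @ xs)"
          unfolding opath_def pth_def
          using x uv' nin g xQ 2 by (auto simp: pth_def successively_append_iff successively_Cons)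
        then have "nv ([Inr g, Inl v, Inr g', Inl u] @ xs) \<le> 2" using no_long[OF Q] g 2 by blast
        then show False using u(2) by simp
      qed
      show False
      proof (cases "a = c")
        case False
        then show False using *[of e f a] e EQ nin ue ab by blast
      next
        case True
        then show False using *[of f e b] e EQ nin ue ab by blast
      qed
    qed
  qed
  have fin': False if q: "opath K p q xs" "1 \<le> nv xs" "q \<in> nbr K" "q \<noteq> p" "p \<in> X" for p q xs
  proof -
    from q(5) consider "p = Inl s" | "p = Inl x" unfolding X_def by blast
    then show False
    proof cases
      case 1
      then show False using fin[of s q xs x] q by blast
    next
      case 2
      then show False using fin[of x q xs s] q by blast
    qed
  qed
  from p.long_port_path show False
  proof
    assume "\<exists>p\<in>nbr K. \<exists>q\<in>nbr K - {p}. \<exists>xs. opath K p q xs \<and> t \<le> nv xs"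
    then obtain p q xs where q: "p \<in> nbr K" "q \<in> nbr K" "q \<noteq> p" "opath K p q xs" "t \<le> nv xs" by blast
    have t3: "3 \<le> nv xs" using q(5) rt r3 by linarith
    consider "p \<in> X" | "q \<in> X" | "p \<in> AN" "q \<in> AN" using q(1,2) K(4) by blast
    then show False
    proof cases
      case 1
      then show False using fin'[OF q(4) _ q(2,3)] t3 by simp
    next
      case 2
      then show False using fin'[OF opath_rev[OF q(4)] _ q(1)] q(3) t3 by simp
    next
      case 3
      have "opath Q p q xs" using q(4) K(1) opath_mono by blast
      then show False using no_long[OF Q _ 3] q(3) t3 by fastforce
    qed
  next
    assume a: "\<forall>p\<in>nbr K. \<exists>q\<in>nbr K - {p}. \<exists>xs. opath K p q xs \<and> 1 \<le> nv xs \<and> t + 2 \<le> nv xs + card (nbr K)"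
    obtain p where p: "p \<in> nbr K" "p \<in> X" using K(5) by blast
    then obtain q xs where "q \<in> nbr K" "q \<noteq> p" "opath K p q xs" "1 \<le> nv xs" using a by blast
    then show False using fin' p by blast
  qed
qed

text \<open>All port paths have at most two vertices, so exits through a single node are impossible
  and the terminal path has at most two vertices, \<open>s\<close> and possibly \<open>x\<close>.
  The hyperedges at \<open>s\<close> are then at most \<open>C(t, r - 1)\<close> within
  \<open>A\<close> and \<open>s\<close>, at most one with \<open>x\<close> by
  \<open>no_double_edge\<close>, and at most two on the path; this is the constant 3.\<close>

lemma centre:
  assumes Q: "piece Q" and C: "A \<subseteq> C" "C \<subseteq> V" and S3: "3 \<le> card {c \<in> C. Inl c \<in> Q}"
    and deg: "\<And>v. v \<in> C \<Longrightarrow> Inl v \<in> Q \<Longrightarrow> t choose (r - 1) < card {e \<in> E. e \<subseteq> C \<and> v \<in> e}"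
  shows "\<exists>s\<in>C. Inl s \<in> Q \<and> card {e \<in> E. e \<subseteq> C \<and> s \<in> e} \<le> (t choose (r - 1)) + 3 \<and> (\<exists>f\<in>E. s \<in> f \<and> f \<subseteq> insert s A)"
proof -
  have "{c \<in> C. Inl c \<in> Q} \<noteq> {}" using S3 by (metis card.empty not_numeral_le_zero)
  then obtain c0 where c0: "c0 \<in> C" "Inl c0 \<in> Q" by blast
  interpret p: ports E Q "{c \<in> C. Inl c \<in> Q}" "{v \<in> C. Inl v \<in> nbr Q}" "{e \<in> E. e \<subseteq> C}" r t "card (nbr Q)"
    by (rule piece_ports(1)[OF Q c0 C(1) deg])
  have QA: "Q \<subseteq> N - AN" "nbr Q \<subseteq> AN" using Q unfolding piece_def by blast+
  have lim: "nv xs \<le> 2" if "p \<in> nbr Q" "q \<in> nbr Q - {p}" "opath Q p q xs" for p q xs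
    using no_long[OF Q that(3)] that QA(2) by blast
  have t3: "3 \<le> t" using rt r3 by simp
  have no: "\<not> (\<exists>p\<in>nbr Q. \<exists>q\<in>nbr Q - {p}. \<exists>xs. opath Q p q xs \<and> t \<le> nv xs)"
  proof
    assume "\<exists>p\<in>nbr Q. \<exists>q\<in>nbr Q - {p}. \<exists>xs. opath Q p q xs \<and> t \<le> nv xs"
    then obtain p q xs where "p \<in> nbr Q" "q \<in> nbr Q - {p}" "opath Q p q xs" "t \<le> nv xs" by blast
    then show False using lim[of p q xs] t3 by linarith
  qed
  then have cfgs: "\<forall>p\<in>nbr Q. \<exists>P R T. term_cfg Q p (Inl ` {c \<in> C. Inl c \<in> Q}) P R T" using p.initial_or_not by blast
  obtain p where p: "p \<in> nbr Q" using piece_ports(3)[OF Q c0 C(1) deg] by fastforce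
  then obtain P R T where cfg: "term_cfg Q p (Inl ` {c \<in> C. Inl c \<in> Q}) P R T" using cfgs by blast
  obtain s where "ports_cfg E Q {c \<in> C. Inl c \<in> Q} {v \<in> C. Inl v \<in> nbr Q} {e \<in> E. e \<subseteq> C} r t (card (nbr Q)) p P R T s"
    using p.cfg_end[OF cfg] by blast
  then interpret c: ports_cfg E Q "{c \<in> C. Inl c \<in> Q}" "{v \<in> C. Inl v \<in> nbr Q}" "{e \<in> E. e \<subseteq> C}" r t "card (nbr Q)" p P R T s .
  have T: "T = nbr Q - {p}"
    using cfg
  proof (cases rule: p.cfg_cases)
    case (2 w)
    then obtain q xs where "q \<in> nbr Q - {p}" "opath Q p q xs" "t \<le> nv xs" using c.beta_vertex by blast
    then show ?thesis using lim[OF p, of q xs] t3 by linarith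
  next
    case (3 w)
    then obtain q xs where "q \<in> nbr Q - {p}" "opath Q p q xs" "t \<le> nv xs \<or> (t \<le> nv xs + 1 \<and> 4 \<le> t)"
      using c.beta_edge by blast
    then show ?thesis using lim[OF p, of q xs] t3 by linarith
  qed
  have sC: "s \<in> C" "Inl s \<in> Q" using c.sS by auto
  have sA: "s \<notin> A" using sC QA by blast
  obtain q xs where "q \<in> nbr Q - {p}" "opath Q p q xs" "card c.J \<le> nv xs" using c.plain by blast
  then have J2: "card c.J \<le> 2" using lim[OF p, of q xs] by linarith
  obtain x where x: "c.J \<subseteq> {s, x}" "x \<in> c.J"
  proof (cases "c.J = {s}")
    case False
    then obtain x where x: "x \<in> c.J" "x \<noteq> s" using c.sJ by blast
    have "card {s, x} = 2" using x by auto
    then have "{s, x} = c.J" using c.finJ J2 x c.sJ by (intro card_seteq) auto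
    then show ?thesis using that x by blast
  qed (use that in blast)
  define D1 where "D1 = {e \<in> c.D. e \<subseteq> insert s A}"
  define D2 where "D2 = {e \<in> c.D. e \<subseteq> insert s (insert x A) \<and> \<not> e \<subseteq> insert s A}"
  have D: "e \<in> E \<and> s \<in> e \<and> card e = r" if "e \<in> c.D" for e using c.D(3)[OF that] by blast
  have "c.D \<subseteq> D1 \<union> D2 \<union> c.U"
  proof
    fix e assume e: "e \<in> c.D"
    have "Inr e \<notin> T" using T QA(2) by blast
    then consider "Inr e \<in> R" | "Inr e \<in> set P" using c.D_nbr[OF e] by blast
    then show "e \<in> D1 \<union> D2 \<union> c.U"
    proof cases
      case 1
      have "e \<subseteq> insert s (insert x A)"
      proof
        fix v assume "v \<in> e"
        then have "v \<in> c.J \<or> Inl v \<in> nbr Q" using c.R_edge[OF e 1] T by blast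
        then show "v \<in> insert s (insert x A)" using x QA(2) by blast
      qed
      then show ?thesis using e unfolding D1_def D2_def by blast
    next
      case 2
      then show ?thesis unfolding c.U_def by blast
    qed
  qed
  moreover have fD: "finite D1" "finite D2" "finite c.U" unfolding D1_def D2_def using c.D(1) c.finJ by auto
  ultimately have "card c.D \<le> card (D1 \<union> D2 \<union> c.U)" by (intro card_mono) auto
  also have "\<dots> \<le> card (D1 \<union> D2) + card c.U" by (rule card_Un_le)
  also have "\<dots> \<le> card D1 + card D2 + card c.U" using card_Un_le[of D1 D2] by simp
  finally have cD: "card c.D \<le> card D1 + card D2 + 2" using J2 c.card_U by simp
  have "card D1 \<le> (card (insert s A) - 1) choose (r - 1)"
    using finA D r3 by (intro card_edges_at(1)[where s = s]) (auto simp: D1_def)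
  then have c1: "card D1 \<le> t choose (r - 1)" using finA sA A(2) by simp
  have c2: "card D2 \<le> 1"
  proof (rule ccontr)
    assume "\<not> card D2 \<le> 1"
    then obtain e f where ef: "e \<in> D2" "f \<in> D2" "e \<noteq> f" using fD(2) card_le_Suc0_iff_eq[of D2] by auto
    have ef': "e \<in> E" "f \<in> E" "s \<in> e" "s \<in> f" "e \<subseteq> insert s (insert x A)" "f \<subseteq> insert s (insert x A)"
      using ef D unfolding D2_def by auto
    have xe: "x \<in> e" "x \<in> f" "x \<noteq> s" using ef unfolding D2_def by auto
    have xQ: "Inl x \<in> Q" using c.JQ x(2) by blast
    have "card {s, x} \<le> 2" by (simp add: card_insert_if)
    then have "\<not> {c \<in> C. Inl c \<in> Q} \<subseteq> {s, x}" using S3 card_mono[of "{s, x}" "{c \<in> C. Inl c \<in> Q}"] by auto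
    then obtain y where y: "y \<in> C" "Inl y \<in> Q" "y \<noteq> s" "y \<noteq> x" by blast
    show False by (rule no_double_edge[OF Q sC(2) xQ _ y ef'(1,2) ef(3) ef'(5,6,3) xe(1) ef'(4) xe(2) deg]) (use xe in auto)
  qed
  have Deq: "c.D = {e \<in> E. e \<subseteq> C \<and> s \<in> e}" unfolding c.D_def by auto
  have "D1 \<noteq> {}"
  proof
    assume "D1 = {}"
    then have "card c.D \<le> 3" using cD c2 by simp
    then show False using c.D(2) pascal_t(5)[OF r3 rt] t3 by linarith
  qed
  then obtain f where "f \<in> c.D" "f \<subseteq> insert s A" unfolding D1_def by blast
  then have "\<exists>f\<in>E. s \<in> f \<and> f \<subseteq> insert s A" using D by blast
  moreover have "card {e \<in> E. e \<subseteq> C \<and> s \<in> e} \<le> (t choose (r - 1)) + 3" using cD c1 c2 unfolding Deq by linarith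
  ultimately show ?thesis using sC by blast
qed

text \<open>As \<open>s\<close> is outside \<open>C\<close>, the port \<open>s\<close> of the
  component \<open>K\<close> does not count in \<open>M\<close>, and \<open>M = t\<close> can be
  used. A port path from \<open>s\<close> therefore has at least two vertices; prolonged through
  \<open>s\<close> and \<open>f\<close> to an anchor it has three, which is too long.\<close>

lemma no_core_beside_centre:
  assumes Q: "piece Q" and s: "Inl s \<in> Q" and f: "f \<in> E" "s \<in> f" "f \<subseteq> insert s A"
    and C: "s \<notin> C" "v \<in> C" and vQ: "\<And>u. u \<in> C - A \<Longrightarrow> Inl u \<in> Q" and vA: "v \<notin> A"
    and deg: "\<And>u. u \<in> C - A \<Longrightarrow> t choose (r - 1) < card {e \<in> E. e \<subseteq> C \<and> u \<in> e}"
  shows False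
proof -
  define X where "X = {Inl s :: 'a + 'a set}"
  define K where "K = comp_of (Q - X) (Inl v)"
  have QN: "Q \<subseteq> N - AN" using Q unfolding piece_def by blast
  have vX: "Inl v \<in> Q - X" using vQ C vA unfolding X_def by auto
  have X: "X \<subseteq> Q" "X \<noteq> {}" using s unfolding X_def by auto
  note K = sub_piece[OF Q X vX, folded K_def]
  have KN: "K \<subseteq> N" using K(1) QN by blast
  have fK: "Inr f \<notin> K" by (rule K(6)[OF f(1)]) (use f(3) QN in \<open>auto simp: X_def\<close>)
  obtain a1 a2 where a: "a1 \<in> A" "a2 \<in> A" "a1 \<noteq> a2" using two_anchors by blast
  have "Inl a1 \<in> N - K" "Inl a2 \<in> N - K" using a(1,2) QN K(1) cardAN(4) by blast+
  note out = outside_two[OF this]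
  have a12: "Inl a1 \<noteq> (Inl a2 :: 'a + 'a set)" using a(3) by simp
  have ports: "{u \<in> C. Inl u \<in> nbr K} \<subseteq> A" using K(4) C(1) unfolding X_def by auto
  have "{e. Inr e \<in> nbr K} = {}" using K(4) unfolding X_def by auto
  then have M: "card {u \<in> C. Inl u \<in> nbr K} + card {e. Inr e \<in> nbr K} \<le> t" using card_mono[OF finA ports] A(2) by simp
  have "u \<notin> A" if "Inl u \<in> K" for u using that K(1) QN by blast
  then have dK: "\<And>u. u \<in> C \<Longrightarrow> Inl u \<in> K \<Longrightarrow> t choose (r - 1) < card {e \<in> E. e \<subseteq> C \<and> u \<in> e}" using deg by blast
  have t3: "3 \<le> t" using rt r3 by simp
  then have t2: "2 \<le> t" by simp
  interpret p: ports E K "{c \<in> C. Inl c \<in> K}" "{u \<in> C. Inl u \<in> nbr K}" "{e \<in> E. e \<subseteq> C}" r t t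
    by (rule ports_of[OF KN K(2) C(2) K(3) rt dK out[OF a12] M t2])
  have fin: False if u: "opath K (Inl s) q xs" "2 \<le> nv xs" "q \<in> nbr K" "q \<noteq> Inl s" for q xs
  proof -
    obtain b where b: "q = Inl b" "b \<in> A" using u(3,4) K(4) unfolding X_def by auto
    have "finite f" "card f = r" using edge[OF f(1)] finV finite_subset by auto
    then have "\<not> f \<subseteq> {s, b}" using r3 card_mono[of "{s, b}" f] by (auto simp: card_insert_if split: if_splits)
    then obtain a where a: "a \<in> f" "a \<in> A" "a \<noteq> b" using f(3) by blast
    have x: "pth xs" "set xs \<subseteq> K" "inc E (Inl s) (hd xs)" "inc E (last xs) q" "xs \<noteq> []" using u(1) unfolding opath_def pth_def by auto
    have "Inl s \<notin> set xs" "Inr f \<notin> set xs" using x(2) K(1) fK unfolding X_def by blast+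
    moreover have "set xs \<subseteq> Q" "Inr f \<in> Q" using x(2) K(1) piece_edge[OF Q s f(1,2)] by blast+
    ultimately have "opath Q (Inl a) (Inl b) ([Inr f, Inl s] @ xs)"
      unfolding opath_def pth_def using x s f a b by (auto simp: pth_def successively_Cons)
    then have "nv ([Inr f, Inl s] @ xs) \<le> 2" using no_long[OF Q] a b by blast
    then show False using u(2) by simp
  qed
  from p.long_port_path show False
  proof
    assume "\<exists>p\<in>nbr K. \<exists>q\<in>nbr K - {p}. \<exists>xs. opath K p q xs \<and> t \<le> nv xs"
    then obtain p q xs where q: "p \<in> nbr K" "q \<in> nbr K" "q \<noteq> p" "opath K p q xs" "t \<le> nv xs" by blast
    have t3: "3 \<le> nv xs" using q(5) t3 by linarith
    consider "p = Inl s" | "q = Inl s" | "p \<in> AN" "q \<in> AN" using q(1,2) K(4) unfolding X_def by blast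
    then show False
    proof cases
      case 1
      then show False using fin[of q xs] q t3 by simp
    next
      case 2
      then show False using fin[of p "rev xs"] opath_rev[OF q(4)] q(1,3) t3 by simp
    next
      case 3
      have "opath Q p q xs" using q(4) K(1) opath_mono by blast
      then show False using no_long[OF Q _ 3] q(3) t3 by fastforce
    qed
  next
    assume a: "\<forall>p\<in>nbr K. \<exists>q\<in>nbr K - {p}. \<exists>xs. opath K p q xs \<and> 1 \<le> nv xs \<and> t + 2 \<le> nv xs + t"
    have "Inl s \<in> nbr K" using K(5) unfolding X_def by blast
    then obtain q xs where q: "q \<in> nbr K" "q \<noteq> Inl s" "opath K (Inl s) q xs" "t + 2 \<le> nv xs + t" using a by blast
    then show False using fin[OF q(3) _ q(1,2)] by simp
  qed
qed

text \<open>All core vertices outside \<open>A\<close> lie in one piece, and only for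
  \<open>k = 2 t + 2\<close>. Up to two of them are covered by the number of all
  \<open>r\<close>-subsets of \<open>C\<close>. With three or more, a centre \<open>s\<close> of
  degree at most \<open>d + 3\<close> is removed, after which each vertex accounts for at most
  \<open>d\<close> hyperedges; the surplus 3 is at most \<open>C(t, r - 2)\<close>.\<close>

lemma core_count:
  assumes C: "A \<subseteq> C" "C \<subseteq> V"
    and deg: "\<And>v. v \<in> C - A \<Longrightarrow> t choose (r - 1) < card {e \<in> E. e \<subseteq> C \<and> v \<in> e}"
  shows "card {e \<in> E. e \<subseteq> C} \<le> (t choose (r - 1)) * card (C - A) + (t choose r) + (if k \<le> 2 * t + 1 then 0 else t choose (r - 2))"
proof (cases "C = A")
  case True
  have "card {e \<in> E. e \<subseteq> A} \<le> card {e. e \<subseteq> A \<and> card e = r}" using finA edge by (intro card_mono) auto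
  also have "\<dots> = t choose r" using n_subsets[OF finA] A(2) by simp
  finally show ?thesis using True by simp
next
  case False
  have fC: "finite C" using C finV finite_subset by blast
  obtain s0 where s0: "s0 \<in> C" "s0 \<notin> A" using False C(1) by blast
  define Q where "Q = comp_of (N - AN) (Inl s0)"
  have Q: "piece Q" unfolding Q_def by (rule piece_comp)
  have QN: "Q \<subseteq> N - AN" using Q unfolding piece_def by blast
  have sQ: "Inl s0 \<in> Q" unfolding Q_def using s0 C(2) by (intro comp_of_self) auto
  have degQ: "\<And>v. v \<in> C \<Longrightarrow> Inl v \<in> Q \<Longrightarrow> t choose (r - 1) < card {e \<in> E. e \<subseteq> C \<and> v \<in> e}"
  proof -
    fix v assume "v \<in> C" "Inl v \<in> Q"
    then show "t choose (r - 1) < card {e \<in> E. e \<subseteq> C \<and> v \<in> e}" using QN by (intro deg) blast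
  qed
  have k: "k = 2 * t + 2" by (rule piece_path(1)[OF Q s0(1) sQ C(1) degQ])
  have all: "Inl u \<in> Q" if u: "u \<in> C - A" for u
  proof (rule ccontr)
    assume n: "Inl u \<notin> Q"
    define Q' where "Q' = comp_of (N - AN) (Inl u)"
    have Q': "piece Q'" unfolding Q'_def by (rule piece_comp)
    have uQ: "Inl u \<in> Q'" unfolding Q'_def using u C(2) by (intro comp_of_self) auto
    have "Q \<inter> Q' = {}"
    proof (rule ccontr)
      assume "Q \<inter> Q' \<noteq> {}"
      then obtain z where "reach (N - AN) (Inl s0) z" "reach (N - AN) (Inl u) z"
        unfolding Q_def Q'_def comp_of_def by blast
      then have "reach (N - AN) (Inl s0) (Inl u)" using reach_trans reach_sym by blast
      then show False using n unfolding Q_def comp_of_def by simp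
    qed
    then show False using one_piece[OF Q Q' _ s0(1) sQ _ uQ C(1) deg] u by blast
  qed
  have S: "{c \<in> C. Inl c \<in> Q} = C - A" using all QN by blast
  show ?thesis
  proof (cases "card (C - A) \<le> 2")
    case True
    have cC: "card C = t + card (C - A)" using card_Diff_subset[OF finA C(1)] card_mono[OF fC C(1)] A(2) by simp
    have "card {e \<in> E. e \<subseteq> C} \<le> card {e. e \<subseteq> C \<and> card e = r}" using fC edge by (intro card_mono) auto
    also have "\<dots> = (t + card (C - A)) choose r" using n_subsets[OF fC] cC by simp
    also have "\<dots> \<le> (t choose (r - 1)) * card (C - A) + (t choose r) + (t choose (r - 2))"
    proof -
      \<comment> \<open>Pascal's rule applied twice turns \<open>C(t + 2, r)\<close> into the
        right-hand side, with equality for two core vertices.\<close>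
      have "\<exists>q. r = Suc (Suc q)" using r3 by (intro exI[of _ "r - 2"]) simp
      then obtain q where r: "r = Suc (Suc q)" by blast
      consider "card (C - A) = 0" | "card (C - A) = 1" | "card (C - A) = 2" using True by linarith
      then show ?thesis unfolding r by cases simp_all
    qed
    finally show ?thesis using k by simp
  next
    case False
    then have "3 \<le> card {c \<in> C. Inl c \<in> Q}" unfolding S by simp
    then have "\<exists>s\<in>C. Inl s \<in> Q \<and> card {e \<in> E. e \<subseteq> C \<and> s \<in> e} \<le> (t choose (r - 1)) + 3 \<and> (\<exists>f\<in>E. s \<in> f \<and> f \<subseteq> insert s A)"
      by (rule centre[OF Q C _ degQ])
    then obtain s where s: "s \<in> C" "Inl s \<in> Q" "card {e \<in> E. e \<subseteq> C \<and> s \<in> e} \<le> (t choose (r - 1)) + 3"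
      and ex: "\<exists>f\<in>E. s \<in> f \<and> f \<subseteq> insert s A" by (elim bexE conjE) (rule that, assumption+, blast)
    from ex obtain f where f: "f \<in> E" "s \<in> f" "f \<subseteq> insert s A" by blast
    have sA: "s \<notin> A" using s(2) QN by blast
    let ?E = "{e \<in> E. e \<subseteq> C - {s}}"
    have fV: "finite (C - {s})" "finite ?E" "\<forall>e\<in>?E. e \<subseteq> C - {s}" "A \<subseteq> C - {s}" using fC finE C(1) sA by auto
    obtain C' and \<rho> :: "'a \<Rightarrow> nat" where C': "A \<subseteq> C'" "C' \<subseteq> C - {s}"
      "\<forall>v\<in>C' - A. t choose (r - 1) < card {e \<in> ?E. e \<subseteq> C' \<and> v \<in> e}"
      "\<forall>v\<in>C - {s} - C'. card {e \<in> ?E. v \<in> e \<and> (\<forall>u\<in>e - C'. \<rho> v \<le> \<rho> u)} \<le> t choose (r - 1)"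
      using peel[OF fV, of "t choose (r - 1)"] by (elim exE conjE) (rule that)
    have eq: "{e \<in> ?E. e \<subseteq> C' \<and> v \<in> e} = {e \<in> E. e \<subseteq> C' \<and> v \<in> e}" for v using C'(2) by blast
    \<comment> \<open>Peeling without \<open>s\<close> must go all the way down to the protected
      set, since a remaining core would contradict \<open>no_core_beside_centre\<close>.\<close>
    have "C' = A"
    proof (rule ccontr)
      assume "C' \<noteq> A"
      then obtain v where v: "v \<in> C'" "v \<notin> A" using C'(1) by blast
      show False
      proof (rule no_core_beside_centre[OF Q s(2) f _ v(1) _ v(2)])
        show "s \<notin> C'" using C'(2) by blast
        show "Inl u \<in> Q" if "u \<in> C' - A" for u using that C'(2) by (intro all) blast
        show "t choose (r - 1) < card {e \<in> E. e \<subseteq> C' \<and> u \<in> e}" if "u \<in> C' - A" for u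
          using C'(3) that unfolding eq by blast
      qed
    qed
    have "card ?E \<le> card {e \<in> ?E. e \<subseteq> A} + (\<Sum>v\<in>C - {s} - A. card {e \<in> ?E. v \<in> e \<and> (\<forall>u\<in>e - A. \<rho> v \<le> \<rho> u)})"
      by (rule peel_card[OF fV(1-3)])
    moreover have "(\<Sum>v\<in>C - {s} - A. card {e \<in> ?E. v \<in> e \<and> (\<forall>u\<in>e - A. \<rho> v \<le> \<rho> u)}) \<le> (\<Sum>v\<in>C - {s} - A. t choose (r - 1))"
      using C'(4) unfolding \<open>C' = A\<close> by (intro sum_mono) blast
    moreover have "card {e \<in> ?E. e \<subseteq> A} \<le> t choose r"
    proof -
      have "card {e \<in> ?E. e \<subseteq> A} \<le> card {e. e \<subseteq> A \<and> card e = r}" using finA edge by (intro card_mono) auto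
      then show ?thesis using n_subsets[OF finA] A(2) by simp
    qed
    moreover have "card {e \<in> E. e \<subseteq> C} \<le> card ?E + card {e \<in> E. e \<subseteq> C \<and> s \<in> e}"
    proof -
      have "{e \<in> E. e \<subseteq> C} = ?E \<union> {e \<in> E. e \<subseteq> C \<and> s \<in> e}" by blast
      then show ?thesis using card_Un_le[of ?E "{e \<in> E. e \<subseteq> C \<and> s \<in> e}"] by simp
    qed
    moreover have "card (C - A) = Suc (card (C - {s} - A))"
    proof -
      have "C - {s} - A = (C - A) - {s}" by blast
      moreover have "s \<in> C - A" using s(1) sA by blast
      ultimately show ?thesis using fC by (metis card_Suc_Diff1 finite_Diff)
    qed
    moreover have "3 \<le> t choose (r - 2)" 
    proof -
      have "1 \<le> r - 2" "r - 2 < t" using rt r3 by auto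
      then show ?thesis using choose_ge_self[of "r - 2" t] rt r3 by linarith
    qed
    ultimately show ?thesis using s(3) k by (simp add: algebra_simps)
  qed
qed

text \<open>Peeling protects \<open>A\<close>, so only core vertices outside \<open>A\<close> need
  large degree; \<open>core_count\<close> then bounds what is left.\<close>

lemma anchored_bound:
  "card E \<le> (t choose (r - 1)) * (card V - t) + (t choose r) + (if k \<le> 2 * t + 1 then 0 else t choose (r - 2))"
proof -
  have EV: "\<forall>e\<in>E. e \<subseteq> V" using edge by blast
  obtain C and \<rho> :: "'a \<Rightarrow> nat" where C: "A \<subseteq> C" "C \<subseteq> V"
      "\<forall>v\<in>C - A. t choose (r - 1) < card {e \<in> E. e \<subseteq> C \<and> v \<in> e}"
      "\<forall>v\<in>V - C. card {e \<in> E. v \<in> e \<and> (\<forall>u\<in>e - C. \<rho> v \<le> \<rho> u)} \<le> t choose (r - 1)"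
    using peel[OF finV finE EV A(1), of "t choose (r - 1)"] by (elim exE conjE) (rule that)
  have fC: "finite C" using C(2) finV finite_subset by blast
  have "card E \<le> card {e \<in> E. e \<subseteq> C} + (\<Sum>v\<in>V - C. card {e \<in> E. v \<in> e \<and> (\<forall>u\<in>e - C. \<rho> v \<le> \<rho> u)})"
    by (rule peel_card[OF finV finE EV])
  also have "(\<Sum>v\<in>V - C. card {e \<in> E. v \<in> e \<and> (\<forall>u\<in>e - C. \<rho> v \<le> \<rho> u)}) \<le> (\<Sum>v\<in>V - C. t choose (r - 1))"
    using C(4) by (intro sum_mono) blast
  also have "\<dots> = (t choose (r - 1)) * card (V - C)" by simp
  finally have "card E \<le> card {e \<in> E. e \<subseteq> C} + (t choose (r - 1)) * card (V - C)" by simp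
  also have "\<dots> \<le> ((t choose (r - 1)) * card (C - A) + (t choose r) + (if k \<le> 2 * t + 1 then 0 else t choose (r - 2)))
      + (t choose (r - 1)) * card (V - C)"
    using core_count[OF C(1,2)] C(3) by simp
  also have "\<dots> = (t choose (r - 1)) * (card (C - A) + card (V - C)) + (t choose r) + (if k \<le> 2 * t + 1 then 0 else t choose (r - 2))"
    by (simp add: algebra_simps)
  also have "card (C - A) + card (V - C) = card V - t"
    using card_Diff_subset[OF finA C(1)] card_Diff_subset[OF fC C(2)] card_mono[OF fC C(1)] card_mono[OF finV C(2)] A(2) by simp
  finally show ?thesis .
qed

end

text \<open>If the bound fails, the number of hyperedges misses \<open>d * card V\<close> by less
  than \<open>d t\<close>, which is the deficit passed to \<open>common_link\<close>. The required
  number of vertices with a common link is the sum of what \<open>common_link_size\<close> and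
  \<open>anchored\<close> ask for.\<close>

lemma (in twoconn) edge_bound:
  assumes rt: "r \<le> t" and kt: "k \<le> 2 * t + 2"
    and n: "link_bound k r t ((t choose (r - 1)) * t) ((t choose (r - 1)) * r + 8 * k * k + 4 + t) < card V"
  shows "card E \<le> (t choose (r - 1)) * (card V - t) + (t choose r) + (if k \<le> 2 * t + 1 then 0 else t choose (r - 2))"
proof (rule ccontr)
  assume no: "\<not> ?thesis"
  have "(t choose (r - 1)) * card V \<le> (t choose (r - 1)) * (card V - t) + (t choose (r - 1)) * t"
    unfolding add_mult_distrib2[symmetric] by (intro mult_le_mono2) simp
  then have big: "(t choose (r - 1)) * card V < card E + (t choose (r - 1)) * t" using no by linarith
  obtain F W where FW: "card F = t choose (r - 1)" "\<forall>f\<in>F. f \<subseteq> V \<and> card f = r - 1" "W \<subseteq> V"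
    "(t choose (r - 1)) * r + 8 * k * k + 4 + t < card W" "W \<inter> \<Union>F = {}" "\<forall>w\<in>W. \<forall>f\<in>F. insert w f \<in> E"
    using common_link[OF rt kt big n] by (elim exE conjE) (rule that)
  have F: "\<And>f. f \<in> F \<Longrightarrow> f \<subseteq> V \<and> card f = r - 1" and W: "\<And>w f. w \<in> W \<Longrightarrow> f \<in> F \<Longrightarrow> insert w f \<in> E"
    using FW(2,6) by blast+
  have cW: "(t choose (r - 1)) * r \<le> card W" using FW(4) by linarith
  note s = common_link_size[OF rt kt FW(1) F FW(3) cW FW(5) W]
  have "anchored E V r k (\<Union>F) W t"
  proof
    show "insert w f \<in> E" if "w \<in> W" "f \<subseteq> \<Union>F" "card f = r - 1" for w f
    proof -
      have "f \<in> F" by (subst s(2)) (use that in auto)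
      then show ?thesis using W that by blast
    qed
    show "\<Union>F \<subseteq> V" using F by blast
    show "8 * k * k + 4 + t \<le> card W" using FW(4) by linarith
  qed (use rt kt s(1) FW(5) in auto)
  then show False using anchored.anchored_bound no by blast
qed

theorem theorem1p10:
  fixes r k :: nat
  assumes "k \<ge> 2 * r + 2" and "2 * r + 2 \<ge> 8"
  shows "\<exists>N::nat. \<forall>n\<ge>N. \<forall>(V :: 'a set) E.
           r_graph r V E \<and> card V = n \<and> two_connected V E \<and>
           \<not> (\<exists>vs es. berge_cycle V E vs es \<and> length vs \<ge> k) \<longrightarrow>
           int (card E) \<le>
             int (nat \<lfloor>(real k - 1) / 2\<rfloor> choose (r - 1)) * (int n - \<lceil>(real k + 1) / 2\<rceil>)
             + int (nat \<lceil>(real k + 1) / 2\<rceil> choose r)"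
proof -
  define t where "t = (k - 1) div 2"
  define d where "d = t choose (r - 1)"
  define n0 where "n0 = link_bound k r t (d * t) (d * r + 8 * k * k + 4 + t)"
  have rt: "r \<le> t" and kt: "k \<le> 2 * t + 2" "k = 2 * t + 1 \<or> k = 2 * t + 2" using assms unfolding t_def by auto
  have "\<exists>q. r = Suc (Suc q)" using assms(2) by (intro exI[of _ "r - 2"]) simp
  then obtain q where r: "r = Suc (Suc q)" by blast
  have "int (card E) \<le> int (nat \<lfloor>(real k - 1) / 2\<rfloor> choose (r - 1)) * (int n - \<lceil>(real k + 1) / 2\<rceil>)
             + int (nat \<lceil>(real k + 1) / 2\<rceil> choose r)"
    if n: "n0 + t + 2 < n" and H: "r_graph r V E" "card V = n" "two_connected V E"
      "\<not> (\<exists>vs es. berge_cycle V E vs es \<and> length vs \<ge> k)" for n and V :: "'a set" and E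
  proof -
    interpret twoconn E V r k
    proof
      show "finite V" "\<And>e. e \<in> E \<Longrightarrow> e \<subseteq> V \<and> card e = r" using H(1) unfolding r_graph_def by auto
      show "3 \<le> r" using assms(2) by simp
    qed (use H(3,4) in blast)+
    have "card E \<le> (t choose (r - 1)) * (card V - t) + (t choose r) + (if k \<le> 2 * t + 1 then 0 else t choose (r - 2))"
      using n H(2) unfolding n0_def d_def by (intro edge_bound[OF rt kt(1)]) simp
    then have b: "int (card E) \<le> int (t choose (r - 1)) * (int n - int t) + int (t choose r) + (if k \<le> 2 * t + 1 then 0 else int (t choose (r - 2)))"
    proof -
      assume a: "card E \<le> (t choose (r - 1)) * (card V - t) + (t choose r) + (if k \<le> 2 * t + 1 then 0 else t choose (r - 2))"
      have nt: "int (n - t) = int n - int t" using n by (simp add: of_nat_diff)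
      have "int (card E) \<le> int ((t choose (r - 1)) * (card V - t) + (t choose r) + (if k \<le> 2 * t + 1 then 0 else t choose (r - 2)))"
        using a by (simp only: of_nat_le_iff)
      then show ?thesis by (simp only: of_nat_add of_nat_mult H(2) nt if_distrib[of int] of_nat_0)
    qed
    show ?thesis
    proof (cases "k = 2 * t + 1")
      case True
      have fc: "\<lfloor>(real k - 1) / 2\<rfloor> = int t" "\<lceil>(real k + 1) / 2\<rceil> = int (t + 1)"
        unfolding True by ((rule floor_unique; simp), (rule ceiling_unique; simp))
      \<comment> \<open>Here \<open>C(t + 1, r) = C(t, r) + C(t, r - 1)\<close> compensates for
        replacing \<open>n - t\<close> by \<open>n - t - 1\<close>; for even \<open>k\<close> the
        same rule is used twice and produces the term \<open>C(t, r - 2)\<close>.\<close>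
      show ?thesis unfolding fc nat_int using b True unfolding r by (simp add: algebra_simps)
    next
      case False
      then have k: "k = 2 * t + 2" using kt by simp
      have fc: "\<lfloor>(real k - 1) / 2\<rfloor> = int t" "\<lceil>(real k + 1) / 2\<rceil> = int (t + 2)"
        unfolding k by ((rule floor_unique; simp), (rule ceiling_unique; simp))
      show ?thesis unfolding fc nat_int using b k unfolding r by (simp add: algebra_simps)
    qed
  qed
  then show ?thesis by (intro exI[of _ "n0 + t + 3"]) auto
qed

end
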